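(* Let $R$ be an associative ring with identity. Then $R$ is quasi-Frobenius if and only if $R$ is strongly left and right ss-injective, left and right Kasch, and the chain $l(a_1)\subseteq l(a_1a_2)\subseteq l(a_1a_2a_3)\subseteq\cdots$ terminates (i.e. is eventually constant) for every sequence $a_1,a_2,\dots\in Z_\ell$.
   Context: Modules are unitary. $Z_\ell$ is the left singular ideal of $R$, i.e. the set of $a\in R$ whose left annihilator $l(a)=\{x\in R: xa=0\}$ is an essential left ideal. $R$ is quasi-Frobenius (QF) if it is right (or left) artinian and right (or left) self-injective. $R$ is right (left) Kasch if every simple right (left) $R$-module embeds in $R_R$ (in ${}_RR$). A submodule $K$ of a module $N$ is small if $K+L\neq N$ for every proper submodule $L$ of $N$. $R$ is strongly right ss-injective if for every right $R$-module $N$ and every semisimple small submodule $K$ of $N$, every $R$-homomorphism $K\to R_R$ extends to an $R$-homomorphism $N\to R_R$; strongly left ss-injective is defined symmetrically with left modules and ${}_RR$. *)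

theory Defs
  imports "HOL-Algebra.Algebra"
begin

text \<open>
  Rings are the (not necessarily commutative, possibly zero) unital rings of \<^locale>\<open>ring\<close>.
  The locale \<^locale>\<open>module\<close> requires a commutative ring of scalars;
  \<open>left_module\<close> has the same axioms over an arbitrary \<^locale>\<open>ring\<close>.
  \<^locale>\<open>submodule\<close> does not require commutativity and is used as it is.
\<close>

locale left_module = R?: ring R + M?: abelian_group M
  for R :: "('a, 'r) ring_scheme" (structure) and M :: "('a, 'm, 'x) module_scheme" (structure) +
  assumes smult_closed [simp, intro]:
      "\<lbrakk>a \<in> carrier R; x \<in> carrier M\<rbrakk> \<Longrightarrow> a \<odot>\<^bsub>M\<^esub> x \<in> carrier M"
    and smult_l_distr:
      "\<lbrakk>a \<in> carrier R; b \<in> carrier R; x \<in> carrier M\<rbrakk> \<Longrightarrow>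
        (a \<oplus> b) \<odot>\<^bsub>M\<^esub> x = a \<odot>\<^bsub>M\<^esub> x \<oplus>\<^bsub>M\<^esub> b \<odot>\<^bsub>M\<^esub> x"
    and smult_r_distr:
      "\<lbrakk>a \<in> carrier R; x \<in> carrier M; y \<in> carrier M\<rbrakk> \<Longrightarrow>
        a \<odot>\<^bsub>M\<^esub> (x \<oplus>\<^bsub>M\<^esub> y) = a \<odot>\<^bsub>M\<^esub> x \<oplus>\<^bsub>M\<^esub> a \<odot>\<^bsub>M\<^esub> y"
    and smult_assoc1:
      "\<lbrakk>a \<in> carrier R; b \<in> carrier R; x \<in> carrier M\<rbrakk> \<Longrightarrow>
        (a \<otimes> b) \<odot>\<^bsub>M\<^esub> x = a \<odot>\<^bsub>M\<^esub> (b \<odot>\<^bsub>M\<^esub> x)"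
    and smult_one [simp]:
      "x \<in> carrier M \<Longrightarrow> \<one> \<odot>\<^bsub>M\<^esub> x = x"

text \<open>
  Right \<open>R\<close>-modules are left modules over the opposite ring: \<open>a \<odot> x\<close> stands for \<open>x a\<close>, and the
  law \<open>(x a) b = x (a b)\<close> is \<open>smult_assoc1\<close> over \<open>opp_ring R\<close>. Every right-hand notion below is
  the left-hand notion for \<open>opp_ring R\<close>.
\<close>

definition opp_ring :: "('a, 'r) ring_scheme \<Rightarrow> ('a, 'r) ring_scheme"
  where "opp_ring R = R\<lparr>monoid.mult := \<lambda>a b. b \<otimes>\<^bsub>R\<^esub> a\<rparr>"

text \<open>
  The left module \<open>R\<close> over itself; \<open>regular_module (opp_ring R)\<close> is the right module \<open>R\<close> over
  itself. The fields \<open>mult\<close> and \<open>one\<close> of a module record carry no meaning.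
\<close>

definition regular_module :: "('a, 'r) ring_scheme \<Rightarrow> ('a, 'a) module"
  where "regular_module R =
    \<lparr>carrier = carrier R, monoid.mult = monoid.mult R, one = \<one>\<^bsub>R\<^esub>,
     ring.zero = \<zero>\<^bsub>R\<^esub>, ring.add = ring.add R, smult = monoid.mult R\<rparr>"

lemma opp_ring_simps [simp]:
  "carrier (opp_ring R) = carrier R" "a \<otimes>\<^bsub>opp_ring R\<^esub> b = b \<otimes>\<^bsub>R\<^esub> a"
  "\<one>\<^bsub>opp_ring R\<^esub> = \<one>\<^bsub>R\<^esub>" "\<zero>\<^bsub>opp_ring R\<^esub> = \<zero>\<^bsub>R\<^esub>" "a \<oplus>\<^bsub>opp_ring R\<^esub> b = a \<oplus>\<^bsub>R\<^esub> b"
  by (simp_all add: opp_ring_def)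

lemma regular_module_simps [simp]:
  "carrier (regular_module R) = carrier R" "\<zero>\<^bsub>regular_module R\<^esub> = \<zero>\<^bsub>R\<^esub>"
  "a \<oplus>\<^bsub>regular_module R\<^esub> b = a \<oplus>\<^bsub>R\<^esub> b" "a \<odot>\<^bsub>regular_module R\<^esub> b = a \<otimes>\<^bsub>R\<^esub> b"
  by (simp_all add: regular_module_def)

lemma ring_opp_ring:
  assumes "ring R"
  shows "ring (opp_ring R)"
proof -
  interpret ring R by fact
  have inverse: "\<exists>y\<in>carrier R. y \<oplus>\<^bsub>R\<^esub> x = \<zero>\<^bsub>R\<^esub>" if "x \<in> carrier R" for x
    using that by (metis a_inv_closed l_neg)
  show ?thesis
    by (intro ringI abelian_groupI monoidI)
      (auto simp: inverse add.m_assoc m_assoc l_distr r_distr intro: add.m_comm)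
qed

lemma left_module_regular_module:
  assumes "ring R"
  shows "left_module R (regular_module R)"
proof -
  interpret ring R by fact
  have inverse: "\<exists>y\<in>carrier R. y \<oplus>\<^bsub>R\<^esub> x = \<zero>\<^bsub>R\<^esub>" if "x \<in> carrier R" for x
    using that by (metis a_inv_closed l_neg)
  have "abelian_group (regular_module R)"
    by (intro abelian_groupI) (auto simp: inverse add.m_assoc intro: add.m_comm)
  then show ?thesis
    by (intro left_module.intro left_module_axioms.intro ring_axioms)
      (auto simp: m_assoc l_distr r_distr)
qed

definition module_hom ::
    "('a, 'r) ring_scheme \<Rightarrow> ('a, 'm, 'x) module_scheme \<Rightarrow> ('a, 'n, 'y) module_scheme \<Rightarrow> ('m \<Rightarrow> 'n) set"
  where "module_hom R M N =
    {f \<in> carrier M \<rightarrow> carrier N.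
      (\<forall>x\<in>carrier M. \<forall>y\<in>carrier M. f (x \<oplus>\<^bsub>M\<^esub> y) = f x \<oplus>\<^bsub>N\<^esub> f y) \<and>
      (\<forall>a\<in>carrier R. \<forall>x\<in>carrier M. f (a \<odot>\<^bsub>M\<^esub> x) = a \<odot>\<^bsub>N\<^esub> f x)}"

text \<open>Homomorphisms are only determined on the carrier, hence the pointwise equation.\<close>

definition homs_extend ::
    "('a, 'r) ring_scheme \<Rightarrow> ('a, 'm) module \<Rightarrow> 'm set \<Rightarrow> ('a, 'n) module \<Rightarrow> bool"
  where "homs_extend R N K E \<longleftrightarrow>
    (\<forall>f\<in>module_hom R (N\<lparr>carrier := K\<rparr>) E. \<exists>g\<in>module_hom R N E. \<forall>x\<in>K. g x = f x)"

definition embeds :: "('a, 'r) ring_scheme \<Rightarrow> ('a, 'm) module \<Rightarrow> ('a, 'n) module \<Rightarrow> bool"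
  where "embeds R M N \<longleftrightarrow> (\<exists>f\<in>module_hom R M N. inj_on f (carrier M))"

definition simple_module :: "('a, 'r) ring_scheme \<Rightarrow> ('a, 'm) module \<Rightarrow> bool"
  where "simple_module R M \<longleftrightarrow>
    left_module R M \<and> carrier M \<noteq> {\<zero>\<^bsub>M\<^esub>} \<and>
    (\<forall>H. submodule H R M \<longrightarrow> H = {\<zero>\<^bsub>M\<^esub>} \<or> H = carrier M)"

text \<open>The sum of a family of submodules is the smallest submodule containing all of them.\<close>

definition submodule_Sum :: "('a, 'r) ring_scheme \<Rightarrow> ('a, 'm) module \<Rightarrow> 'm set set \<Rightarrow> 'm set"
  where "submodule_Sum R M F = \<Inter>{H. submodule H R M \<and> (\<forall>S\<in>F. S \<subseteq> H)}"

definition semisimple_module :: "('a, 'r) ring_scheme \<Rightarrow> ('a, 'm) module \<Rightarrow> bool"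
  where "semisimple_module R M \<longleftrightarrow>
    left_module R M \<and>
    carrier M = submodule_Sum R M {S. submodule S R M \<and> simple_module R (M\<lparr>carrier := S\<rparr>)}"

definition small_submodule :: "'m set \<Rightarrow> ('a, 'r) ring_scheme \<Rightarrow> ('a, 'm) module \<Rightarrow> bool"
  where "small_submodule K R N \<longleftrightarrow>
    submodule K R N \<and>
    (\<forall>L. submodule L R N \<and> L \<noteq> carrier N \<longrightarrow> K <+>\<^bsub>N\<^esub> L \<noteq> carrier N)"

definition essential_submodule :: "'m set \<Rightarrow> ('a, 'r) ring_scheme \<Rightarrow> ('a, 'm) module \<Rightarrow> bool"
  where "essential_submodule K R N \<longleftrightarrow>
    submodule K R N \<and>
    (\<forall>L. submodule L R N \<and> L \<noteq> {\<zero>\<^bsub>N\<^esub>} \<longrightarrow> K \<inter> L \<noteq> {\<zero>\<^bsub>N\<^esub>})"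

text \<open>
  HOL has no quantification over types inside a formula, so "every module" is read as "every
  module whose carrier is a set of elements of the type \<open>'m\<close>", and \<open>'m\<close> is passed as an argument.
\<close>

definition strongly_left_ss_injective :: "'m itself \<Rightarrow> ('a, 'r) ring_scheme \<Rightarrow> bool"
  where "strongly_left_ss_injective (_ :: 'm itself) R \<longleftrightarrow>
    (\<forall>(N :: ('a, 'm) module) K.
      left_module R N \<and> small_submodule K R N \<and> semisimple_module R (N\<lparr>carrier := K\<rparr>) \<longrightarrow>
      homs_extend R N K (regular_module R))"

definition strongly_right_ss_injective :: "'m itself \<Rightarrow> ('a, 'r) ring_scheme \<Rightarrow> bool"
  where "strongly_right_ss_injective U R \<longleftrightarrow> strongly_left_ss_injective U (opp_ring R)"

definition left_kasch :: "'m itself \<Rightarrow> ('a, 'r) ring_scheme \<Rightarrow> bool"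
  where "left_kasch (_ :: 'm itself) R \<longleftrightarrow>
    (\<forall>M :: ('a, 'm) module. simple_module R M \<longrightarrow> embeds R M (regular_module R))"

definition right_kasch :: "'m itself \<Rightarrow> ('a, 'r) ring_scheme \<Rightarrow> bool"
  where "right_kasch U R \<longleftrightarrow> left_kasch U (opp_ring R)"

definition injective_module ::
    "'m itself \<Rightarrow> ('a, 'r) ring_scheme \<Rightarrow> ('a, 'n) module \<Rightarrow> bool"
  where "injective_module (_ :: 'm itself) R E \<longleftrightarrow>
    left_module R E \<and>
    (\<forall>(N :: ('a, 'm) module) K. left_module R N \<and> submodule K R N \<longrightarrow> homs_extend R N K E)"

definition left_self_injective :: "'m itself \<Rightarrow> ('a, 'r) ring_scheme \<Rightarrow> bool"
  where "left_self_injective U R \<longleftrightarrow> injective_module U R (regular_module R)"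

definition right_self_injective :: "'m itself \<Rightarrow> ('a, 'r) ring_scheme \<Rightarrow> bool"
  where "right_self_injective U R \<longleftrightarrow> left_self_injective U (opp_ring R)"

definition left_ideal :: "'a set \<Rightarrow> ('a, 'r) ring_scheme \<Rightarrow> bool"
  where "left_ideal I R \<longleftrightarrow> submodule I R (regular_module R)"

definition left_artinian :: "('a, 'r) ring_scheme \<Rightarrow> bool"
  where "left_artinian R \<longleftrightarrow>
    (\<forall>I :: nat \<Rightarrow> 'a set. (\<forall>n. left_ideal (I n) R) \<and> (\<forall>n. I (Suc n) \<subseteq> I n) \<longrightarrow>
      (\<exists>m. \<forall>n\<ge>m. I n = I m))"

definition right_artinian :: "('a, 'r) ring_scheme \<Rightarrow> bool"
  where "right_artinian R \<longleftrightarrow> left_artinian (opp_ring R)"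

text \<open>
  The sides in the two conditions may be chosen independently; it is a classical theorem that
  the four combinations are equivalent.
\<close>

definition quasi_frobenius :: "'m itself \<Rightarrow> ('a, 'r) ring_scheme \<Rightarrow> bool"
  where "quasi_frobenius U R \<longleftrightarrow>
    (right_artinian R \<or> left_artinian R) \<and> (right_self_injective U R \<or> left_self_injective U R)"

definition left_annihilator :: "('a, 'r) ring_scheme \<Rightarrow> 'a \<Rightarrow> 'a set"
  where "left_annihilator R a = {x \<in> carrier R. x \<otimes>\<^bsub>R\<^esub> a = \<zero>\<^bsub>R\<^esub>}"

definition left_singular_ideal :: "('a, 'r) ring_scheme \<Rightarrow> 'a set"
  where "left_singular_ideal R =
    {a \<in> carrier R. essential_submodule (left_annihilator R a) R (regular_module R)}"

text \<open>\<open>seq_prod R a n = a 0 \<otimes> a 1 \<otimes> \<dots> \<otimes> a n\<close>, in this order.\<close>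

primrec seq_prod :: "('a, 'r) ring_scheme \<Rightarrow> (nat \<Rightarrow> 'a) \<Rightarrow> nat \<Rightarrow> 'a"
  where
    "seq_prod R a 0 = a 0"
  | "seq_prod R a (Suc n) = seq_prod R a n \<otimes>\<^bsub>R\<^esub> a (Suc n)"

definition singular_annihilator_chains_terminate :: "('a, 'r) ring_scheme \<Rightarrow> bool"
  where "singular_annihilator_chains_terminate R \<longleftrightarrow>
    (\<forall>a :: nat \<Rightarrow> 'a. (\<forall>n. a n \<in> left_singular_ideal R) \<longrightarrow>
      (\<exists>m. \<forall>n\<ge>m. left_annihilator R (seq_prod R a n) = left_annihilator R (seq_prod R a m)))"

text \<open>
  The universe of modules for a ring with elements in \<open>'a\<close>. The parameter \<open>'m\<close> is arbitrary, so
  that modules of every type are covered (up to isomorphism, through \<open>Inl\<close>). The second summand,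
  of cardinality \<open>2\<close> to the power \<open>max |'a| \<aleph>\<^sub>0\<close>, rules out universes that are too small: it has room
  for isomorphic copies of \<open>R\<close>, of all cyclic modules and of their injective hulls (inside powers
  of \<open>Hom(R, \<rat>/\<int>)\<close> with at most \<open>max |'a| \<aleph>\<^sub>0\<close> factors). Hence relative to this type each of the
  notions above agrees with its absolute meaning.
\<close>

type_synonym ('a, 'm) module_universe = "'m + ('a \<times> nat) set"

end

theory Submission
  imports Defs
begin

text \<open>
  Write \<open>l(S)\<close> and \<open>r(S)\<close> for the left and right annihilators of a set \<open>S\<close>, and \<open>J\<close> for the Jacobson
  radical. All the conditions of the theorem become statements about one-sided ideals, and both
  directions pass through the duality \<open>I \<mapsto> r(I)\<close>, \<open>F \<mapsto> l(F)\<close> between left and right ideals.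

  Suppose first that \<open>R\<close> is strongly ss-injective and Kasch on both sides. A simple submodule \<open>V\<close> of
  a module \<open>N\<close> is either small, or \<open>V + L = N\<close> for a proper submodule \<open>L\<close>, and then \<open>V\<close> is a direct
  summand; in both cases every homomorphism \<open>V \<rightarrow> R\<close> extends to \<open>N\<close> (\<open>extends_from_simple\<close>). Apply
  this to the pushout \<open>N\<close> of the inclusion \<open>I \<rightarrow> R\<close> of a left ideal and a homomorphism \<open>f : I \<rightarrow> R\<close>:
  if \<open>Rs\<close> is simple, there are \<open>u, v\<close> with \<open>s u = s\<close> and \<open>f(x) u = x v\<close> on \<open>I\<close>
  (\<open>pushout_extension\<close>). The \<open>g\<close> for which \<open>x \<mapsto> f(x) g\<close> extends to \<open>R\<close> form a right ideal \<open>G\<close>. If it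
  were proper, the right Kasch condition would give \<open>s \<noteq> 0\<close> with \<open>s G = 0\<close> and \<open>sR\<close> simple; then \<open>Rs\<close>
  is simple too, and some \<open>u \<in> G\<close> satisfies \<open>s u = s\<close>, a contradiction. So \<open>1 \<in> G\<close>, and \<open>R\<close> is left
  self-injective by Baer's criterion; likewise it is right self-injective.

  Self-injectivity and the Kasch conditions give \<open>l(r(I)) = I\<close> and \<open>r(l(F)) = F\<close>. By this duality the
  annihilator of a decreasing intersection of ideals is the union of their annihilators, and
  therefore no \<open>R/B\<close> contains an infinite direct sum (\<open>no_independent_sequence\<close>): all socles of
  cyclic modules are finitely generated. For \<open>B = 0\<close> this makes \<open>J\<close> a finite intersection of maximal
  right ideals, so that \<open>R/J\<close> is semisimple. Moreover \<open>J\<close> is contained in the left singular ideal,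
  so the chain condition makes some product \<open>a\<^sub>1 \<cdots> a\<^sub>n\<close> vanish for every sequence in \<open>J\<close>, and
  every nonzero right module has a nonzero element killed by \<open>J\<close>. Hence all cyclic right modules have
  finitely generated essential socles, which makes \<open>R\<close> right artinian (\<open>artinian_of_socles\<close>).

  Conversely, let \<open>R\<close> be left self-injective and artinian on one side; the other two cases follow by
  passing to the opposite ring. Then \<open>r(l(F)) = F\<close> for finitely generated right ideals, and
  artinian implies noetherian, so \<open>R\<close> is right artinian in either case and \<open>r(l(F)) = F\<close> for all right
  ideals. The left Kasch condition follows once \<open>l(r(J)) = J\<close>, which is obtained from an ascending
  chain of two-sided ideals (\<open>lann_rann_jac\<close>). Now the duality is complete; it carries the chain
  conditions over to left ideals and yields right self-injectivity. Self-injective rings are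
  strongly ss-injective by Baer's criterion, and the last condition is an instance of the ascending
  chain condition on left ideals.
\<close>

section \<open>One-sided ideals and annihilators\<close>

abbreviation right_ideal :: "'a set \<Rightarrow> ('a, 'r) ring_scheme \<Rightarrow> bool"
  where "right_ideal I R \<equiv> left_ideal I (opp_ring R)"

definition lann :: "('a, 'r) ring_scheme \<Rightarrow> 'a set \<Rightarrow> 'a set"
  where "lann R T = {a \<in> carrier R. \<forall>x\<in>T. a \<otimes>\<^bsub>R\<^esub> x = \<zero>\<^bsub>R\<^esub>}"

abbreviation rann :: "('a, 'r) ring_scheme \<Rightarrow> 'a set \<Rightarrow> 'a set"
  where "rann R T \<equiv> lann (opp_ring R) T"

definition left_ideal_hom :: "('a, 'r) ring_scheme \<Rightarrow> 'a set \<Rightarrow> ('a \<Rightarrow> 'a) \<Rightarrow> bool"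
  where "left_ideal_hom R I f \<longleftrightarrow> left_ideal I R \<and> f \<in> I \<rightarrow> carrier R \<and>
    (\<forall>x\<in>I. \<forall>y\<in>I. f (x \<oplus>\<^bsub>R\<^esub> y) = f x \<oplus>\<^bsub>R\<^esub> f y) \<and>
    (\<forall>a\<in>carrier R. \<forall>x\<in>I. f (a \<otimes>\<^bsub>R\<^esub> x) = a \<otimes>\<^bsub>R\<^esub> f x)"

text \<open>
  Baer's form of left self-injectivity. It involves no module other than \<open>R\<close>, hence no universe
  of modules.
\<close>

definition left_baer :: "('a, 'r) ring_scheme \<Rightarrow> bool"
  where "left_baer R \<longleftrightarrow>
    (\<forall>I f. left_ideal_hom R I f \<longrightarrow> (\<exists>c\<in>carrier R. \<forall>x\<in>I. f x = x \<otimes>\<^bsub>R\<^esub> c))"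

text \<open>
  If \<open>M\<close> is a maximal left ideal and \<open>M s = 0\<close> with \<open>s \<noteq> 0\<close>, then \<open>R s\<close> is a copy of \<open>R/M\<close> in \<open>R\<close>. The
  condition is stated for all proper left ideals, each of which lies in a maximal one.
\<close>

definition elementwise_kasch :: "('a, 'r) ring_scheme \<Rightarrow> bool"
  where "elementwise_kasch R \<longleftrightarrow>
    (\<forall>I. left_ideal I R \<and> \<one>\<^bsub>R\<^esub> \<notin> I \<longrightarrow>
      (\<exists>s\<in>carrier R. s \<noteq> \<zero>\<^bsub>R\<^esub> \<and> (\<forall>x\<in>I. x \<otimes>\<^bsub>R\<^esub> s = \<zero>\<^bsub>R\<^esub>)))"

definition maximal_left :: "('a, 'r) ring_scheme \<Rightarrow> 'a set \<Rightarrow> bool"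
  where "maximal_left R M \<longleftrightarrow> left_ideal M R \<and> \<one>\<^bsub>R\<^esub> \<notin> M \<and>
    (\<forall>x\<in>carrier R - M. \<exists>y\<in>carrier R. \<one>\<^bsub>R\<^esub> \<ominus>\<^bsub>R\<^esub> y \<otimes>\<^bsub>R\<^esub> x \<in> M)"

definition jac :: "('a, 'r) ring_scheme \<Rightarrow> 'a set"
  where "jac R = {x \<in> carrier R. \<forall>M. maximal_left R M \<longrightarrow> x \<in> M}"

definition lsum :: "('a, 'r) ring_scheme \<Rightarrow> 'a set \<Rightarrow> 'a \<Rightarrow> 'a set"
  where "lsum R I y = {x \<oplus>\<^bsub>R\<^esub> r \<otimes>\<^bsub>R\<^esub> y | x r. x \<in> I \<and> r \<in> carrier R}"

primrec lspan :: "('a, 'r) ring_scheme \<Rightarrow> 'a set \<Rightarrow> 'a list \<Rightarrow> 'a set"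
  where "lspan R B [] = B"
  | "lspan R B (y # ys) = lsum R (lspan R B ys) y"

text \<open>
  The elements whose class generates a simple or zero submodule of \<open>R/B\<close>.
\<close>

definition simple_mod :: "('a, 'r) ring_scheme \<Rightarrow> 'a set \<Rightarrow> 'a set"
  where "simple_mod R B = {y \<in> carrier R. \<forall>a\<in>carrier R. a \<otimes>\<^bsub>R\<^esub> y \<notin> B \<longrightarrow>
    (\<exists>b\<in>carrier R. b \<otimes>\<^bsub>R\<^esub> (a \<otimes>\<^bsub>R\<^esub> y) \<ominus>\<^bsub>R\<^esub> y \<in> B)}"

lemma opp_ring_opp_ring [simp]: "opp_ring (opp_ring R) = R"
  by (simp add: opp_ring_def)

lemma add_monoid_opp_ring [simp]: "add_monoid (opp_ring R) = add_monoid R"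
  by (simp add: opp_ring_def)

lemma a_inv_opp_ring [simp]: "\<ominus>\<^bsub>opp_ring R\<^esub> x = \<ominus>\<^bsub>R\<^esub> x"
  unfolding a_inv_def add_monoid_opp_ring ..

lemma a_minus_opp_ring [simp]: "x \<ominus>\<^bsub>opp_ring R\<^esub> y = x \<ominus>\<^bsub>R\<^esub> y"
  by (simp add: a_minus_def)

lemma mem_lann: "a \<in> lann R T \<longleftrightarrow> a \<in> carrier R \<and> (\<forall>x\<in>T. a \<otimes>\<^bsub>R\<^esub> x = \<zero>\<^bsub>R\<^esub>)"
  by (simp add: lann_def)

lemma mem_rann: "a \<in> rann R T \<longleftrightarrow> a \<in> carrier R \<and> (\<forall>x\<in>T. x \<otimes>\<^bsub>R\<^esub> a = \<zero>\<^bsub>R\<^esub>)"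
  by (simp add: lann_def)

lemma lann_antimono: "S \<subseteq> T \<Longrightarrow> lann R T \<subseteq> lann R S"
  unfolding lann_def by blast

text \<open>
  Closure under negation comes for free, since \<open>-x = (-1) x\<close>.
\<close>

lemma submodule_iff:
  assumes "left_module R M"
  shows "submodule H R M \<longleftrightarrow> H \<subseteq> carrier M \<and> \<zero>\<^bsub>M\<^esub> \<in> H \<and>
    (\<forall>x\<in>H. \<forall>y\<in>H. x \<oplus>\<^bsub>M\<^esub> y \<in> H) \<and> (\<forall>a\<in>carrier R. \<forall>x\<in>H. a \<odot>\<^bsub>M\<^esub> x \<in> H)"
proof -
  interpret M: left_module R M by fact
  have neg: "inv\<^bsub>add_monoid M\<^esub> x = (\<ominus>\<^bsub>R\<^esub> \<one>\<^bsub>R\<^esub>) \<odot>\<^bsub>M\<^esub> x" if x: "x \<in> carrier M" for x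
  proof -
    have z: "\<zero>\<^bsub>R\<^esub> \<odot>\<^bsub>M\<^esub> x = \<zero>\<^bsub>M\<^esub>"
    proof -
      have "\<zero>\<^bsub>R\<^esub> \<odot>\<^bsub>M\<^esub> x \<oplus>\<^bsub>M\<^esub> \<zero>\<^bsub>R\<^esub> \<odot>\<^bsub>M\<^esub> x = \<zero>\<^bsub>R\<^esub> \<odot>\<^bsub>M\<^esub> x"
        using x by (simp flip: M.smult_l_distr)
      then show ?thesis using x
        by (metis M.M.add.l_cancel_one M.R.zero_closed M.smult_closed)
    qed
    have "(\<ominus>\<^bsub>R\<^esub> \<one>\<^bsub>R\<^esub>) \<odot>\<^bsub>M\<^esub> x \<oplus>\<^bsub>M\<^esub> x = ((\<ominus>\<^bsub>R\<^esub> \<one>\<^bsub>R\<^esub>) \<oplus>\<^bsub>R\<^esub> \<one>\<^bsub>R\<^esub>) \<odot>\<^bsub>M\<^esub> x"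
      using x by (simp add: M.smult_l_distr)
    also have "\<dots> = \<zero>\<^bsub>M\<^esub>"
      using z by (simp add: M.R.l_neg)
    finally show ?thesis
      using x M.M.minus_equality M.R.a_inv_closed M.R.one_closed M.smult_closed
      by (metis a_inv_def)
  qed
  show ?thesis
  proof
    assume "submodule H R M"
    then interpret H: submodule H R M .
    show "H \<subseteq> carrier M \<and> \<zero>\<^bsub>M\<^esub> \<in> H \<and>
      (\<forall>x\<in>H. \<forall>y\<in>H. x \<oplus>\<^bsub>M\<^esub> y \<in> H) \<and> (\<forall>a\<in>carrier R. \<forall>x\<in>H. a \<odot>\<^bsub>M\<^esub> x \<in> H)"
      using H.subset H.m_closed H.one_closed by auto
  next
    assume *: "H \<subseteq> carrier M \<and> \<zero>\<^bsub>M\<^esub> \<in> H \<and>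
      (\<forall>x\<in>H. \<forall>y\<in>H. x \<oplus>\<^bsub>M\<^esub> y \<in> H) \<and> (\<forall>a\<in>carrier R. \<forall>x\<in>H. a \<odot>\<^bsub>M\<^esub> x \<in> H)"
    then show "submodule H R M"
      by (intro submodule.intro subgroup.intro submodule_axioms.intro)
        (auto simp: neg subset_eq)
  qed
qed

context ring
begin

lemma opp: "ring (opp_ring R)"
  by (rule ring_opp_ring) (rule ring_axioms)

lemma mult_one_minus:
  "x \<in> carrier R \<Longrightarrow> a \<in> carrier R \<Longrightarrow> x \<otimes> (\<one> \<ominus> a) = x \<ominus> x \<otimes> a"
  "x \<in> carrier R \<Longrightarrow> a \<in> carrier R \<Longrightarrow> (\<one> \<ominus> a) \<otimes> x = x \<ominus> a \<otimes> x"
  by (simp_all add: a_minus_def l_distr r_distr l_minus r_minus)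

lemma left_ideal_iff: "left_ideal I R \<longleftrightarrow> I \<subseteq> carrier R \<and> \<zero> \<in> I \<and>
    (\<forall>x\<in>I. \<forall>y\<in>I. x \<oplus> y \<in> I) \<and> (\<forall>a\<in>carrier R. \<forall>x\<in>I. a \<otimes> x \<in> I)"
  unfolding left_ideal_def
  using submodule_iff[OF left_module_regular_module[OF ring_axioms]] by simp

lemma right_ideal_iff: "right_ideal I R \<longleftrightarrow> I \<subseteq> carrier R \<and> \<zero> \<in> I \<and>
    (\<forall>x\<in>I. \<forall>y\<in>I. x \<oplus> y \<in> I) \<and> (\<forall>a\<in>carrier R. \<forall>x\<in>I. x \<otimes> a \<in> I)"
  using ring.left_ideal_iff[OF opp] by simp

lemma left_idealD:
  assumes "left_ideal I R"
  shows "x \<in> I \<Longrightarrow> x \<in> carrier R" "\<zero> \<in> I" "x \<in> I \<Longrightarrow> y \<in> I \<Longrightarrow> x \<oplus> y \<in> I"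
    "a \<in> carrier R \<Longrightarrow> x \<in> I \<Longrightarrow> a \<otimes> x \<in> I" "x \<in> I \<Longrightarrow> \<ominus> x \<in> I"
    "x \<in> I \<Longrightarrow> y \<in> I \<Longrightarrow> x \<ominus> y \<in> I"
proof -
  have *: "\<ominus> x \<in> I" if "x \<in> I" for x
  proof -
    have "x \<in> carrier R" using assms that by (auto simp: left_ideal_iff)
    then have "\<ominus> x = (\<ominus> \<one>) \<otimes> x" by (simp add: l_minus)
    then show ?thesis using assms that by (simp add: left_ideal_iff)
  qed
  show "x \<in> I \<Longrightarrow> x \<in> carrier R" "\<zero> \<in> I" "x \<in> I \<Longrightarrow> y \<in> I \<Longrightarrow> x \<oplus> y \<in> I"
    "a \<in> carrier R \<Longrightarrow> x \<in> I \<Longrightarrow> a \<otimes> x \<in> I" "x \<in> I \<Longrightarrow> \<ominus> x \<in> I"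
    using assms * by (auto simp: left_ideal_iff)
  show "x \<in> I \<Longrightarrow> y \<in> I \<Longrightarrow> x \<ominus> y \<in> I"
    using assms * by (auto simp: left_ideal_iff a_minus_def)
qed

lemma right_idealD:
  assumes "right_ideal I R"
  shows "x \<in> I \<Longrightarrow> x \<in> carrier R" "\<zero> \<in> I" "x \<in> I \<Longrightarrow> y \<in> I \<Longrightarrow> x \<oplus> y \<in> I"
    "a \<in> carrier R \<Longrightarrow> x \<in> I \<Longrightarrow> x \<otimes> a \<in> I" "x \<in> I \<Longrightarrow> \<ominus> x \<in> I"
    "x \<in> I \<Longrightarrow> y \<in> I \<Longrightarrow> x \<ominus> y \<in> I"
  using ring.left_idealD[OF opp assms] by auto

lemma left_ideal_zero: "left_ideal {\<zero>} R"
  by (auto simp: left_ideal_iff)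

lemma left_ideal_carrier: "left_ideal (carrier R) R"
  by (auto simp: left_ideal_iff)

lemma left_ideal_Int: "left_ideal I R \<Longrightarrow> left_ideal K R \<Longrightarrow> left_ideal (I \<inter> K) R"
  by (auto simp: left_ideal_iff)

lemma left_ideal_INT: "(\<And>i. left_ideal (C i) R) \<Longrightarrow> left_ideal (\<Inter>i. C i) R"
  unfolding left_ideal_iff by (simp add: subset_eq)

lemma left_ideal_UN:
  fixes A :: "nat \<Rightarrow> 'a set"
  assumes "\<And>i. left_ideal (A i) R" "\<And>i. A i \<subseteq> A (Suc i)"
  shows "left_ideal (\<Union>i. A i) R"
proof -
  have mono: "i \<le> j \<Longrightarrow> A i \<subseteq> A j" for i j
    using assms(2) by (rule lift_Suc_mono_le)
  have "\<exists>k. x \<oplus> y \<in> A k" if "x \<in> A i" "y \<in> A j" for x y i j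
    using that mono[of i "max i j"] mono[of j "max i j"] left_idealD(3)[OF assms(1)[of "max i j"]]
    by (intro exI[of _ "max i j"]) auto
  note add = this
  show ?thesis
    unfolding left_ideal_iff
  proof (intro conjI ballI)
    show "(\<Union>i. A i) \<subseteq> carrier R" using left_idealD(1)[OF assms(1)] by (simp add: subset_eq)
    show "\<zero> \<in> (\<Union>i. A i)" using left_idealD(2)[OF assms(1)] by simp
    show "x \<oplus> y \<in> (\<Union>i. A i)" if "x \<in> (\<Union>i. A i)" "y \<in> (\<Union>i. A i)" for x y
    proof -
      from that obtain i j where "x \<in> A i" "y \<in> A j" by auto
      from add[OF this] show ?thesis by simp
    qed
    show "a \<otimes> x \<in> (\<Union>i. A i)" if "a \<in> carrier R" "x \<in> (\<Union>i. A i)" for a x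
      using left_idealD(4)[OF assms(1) that(1)] that(2) by auto
  qed
qed

lemma left_ideal_lann: "T \<subseteq> carrier R \<Longrightarrow> left_ideal (lann R T) R"
  by (auto simp: left_ideal_iff mem_lann subset_eq l_distr m_assoc)

lemma right_ideal_rann: "T \<subseteq> carrier R \<Longrightarrow> right_ideal (rann R T) R"
  using ring.left_ideal_lann[OF opp] by simp

lemma right_ideal_lann:
  assumes "left_ideal T R" shows "right_ideal (lann R T) R"
  using assms by (auto simp: right_ideal_iff left_ideal_iff mem_lann subset_eq l_distr m_assoc)

lemma left_ideal_quot:
  assumes "left_ideal I R" "x \<in> carrier R"
  shows "left_ideal {a \<in> carrier R. a \<otimes> x \<in> I} R"
  using assms by (auto simp: left_ideal_iff l_distr m_assoc)

lemma lsum_I: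
  assumes "left_ideal I R" "y \<in> carrier R"
  shows "left_ideal (lsum R I y) R" "I \<subseteq> lsum R I y" "r \<in> carrier R \<Longrightarrow> r \<otimes> y \<in> lsum R I y" "y \<in> lsum R I y"
proof -
  note I = left_idealD[OF assms(1)] and y = assms(2)
  have 1: "(x \<oplus> r \<otimes> y) \<oplus> (x' \<oplus> r' \<otimes> y) = (x \<oplus> x') \<oplus> (r \<oplus> r') \<otimes> y"
    if "x \<in> I" "x' \<in> I" "r \<in> carrier R" "r' \<in> carrier R" for x x' r r'
    using that(3,4) I(1)[OF that(1)] I(1)[OF that(2)] y by algebra
  have 2: "a \<otimes> (x \<oplus> r \<otimes> y) = a \<otimes> x \<oplus> (a \<otimes> r) \<otimes> y"
    if "x \<in> I" "r \<in> carrier R" "a \<in> carrier R" for x a r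
    using that(2,3) I(1)[OF that(1)] y by algebra
  show 3: "I \<subseteq> lsum R I y"
  proof
    fix x assume "x \<in> I"
    then have "x = x \<oplus> \<zero> \<otimes> y" using I(1) y by simp
    then show "x \<in> lsum R I y" using \<open>x \<in> I\<close> by (auto simp: lsum_def)
  qed
  show 4: "r \<otimes> y \<in> lsum R I y" if "r \<in> carrier R" for r
  proof -
    have "r \<otimes> y = \<zero> \<oplus> r \<otimes> y" using y that by simp
    then show ?thesis using I(2) that unfolding lsum_def by blast
  qed
  show "y \<in> lsum R I y" using 4[of \<one>] y by simp
  show "left_ideal (lsum R I y) R"
    unfolding left_ideal_iff
  proof (intro conjI ballI)
    show "lsum R I y \<subseteq> carrier R" using I(1) y by (auto simp: lsum_def)
    show "\<zero> \<in> lsum R I y" using 3 I(2) by blast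
  next
    fix u v assume "u \<in> lsum R I y" "v \<in> lsum R I y"
    then obtain x r x' r' where "u = x \<oplus> r \<otimes> y" "v = x' \<oplus> r' \<otimes> y"
      "x \<in> I" "x' \<in> I" "r \<in> carrier R" "r' \<in> carrier R"
      by (auto simp: lsum_def)
    then show "u \<oplus> v \<in> lsum R I y"
      unfolding lsum_def using 1[of x x' r r'] I(3) by blast
  next
    fix a u assume "a \<in> carrier R" "u \<in> lsum R I y"
    then obtain x r where "u = x \<oplus> r \<otimes> y" "x \<in> I" "r \<in> carrier R"
      by (auto simp: lsum_def)
    then show "a \<otimes> u \<in> lsum R I y"
      unfolding lsum_def using 2[of x r a] I(4) \<open>a \<in> carrier R\<close> by blast
  qed
qed

lemma lsum_least:
  assumes "I \<subseteq> K" "y \<in> K" "left_ideal K R"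
  shows "lsum R I y \<subseteq> K"
  using assms left_idealD(3,4)[OF assms(3)] by (auto simp: lsum_def)

lemma lspan_ideal: "left_ideal B R \<Longrightarrow> set ys \<subseteq> carrier R \<Longrightarrow> left_ideal (lspan R B ys) R"
  by (induction ys) (auto intro: lsum_I)

lemma lspan_I:
  assumes "left_ideal B R" "set ys \<subseteq> carrier R"
  shows "B \<subseteq> lspan R B ys" "set ys \<subseteq> lspan R B ys"
proof -
  have "B \<subseteq> lspan R B ys \<and> set ys \<subseteq> lspan R B ys"
    using assms
  proof (induction ys)
    case (Cons y ys)
    then show ?case
      using lsum_I(2,4)[OF lspan_ideal[of B ys], of y] by auto
  qed auto
  then show "B \<subseteq> lspan R B ys" "set ys \<subseteq> lspan R B ys" by auto
qed

lemma lspan_least: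
  assumes "B \<subseteq> K" "set ys \<subseteq> K" "left_ideal K R"
  shows "lspan R B ys \<subseteq> K"
  using assms by (induction ys) (simp_all add: lsum_least)

lemma lspan_append: "lspan R B (xs @ ys) = lspan R (lspan R B ys) xs"
  by (induction xs) auto

lemma maximal_left_ideal_avoiding:
  assumes "left_ideal I R" "a \<in> carrier R" "a \<notin> I"
  obtains H where "left_ideal H R" "I \<subseteq> H" "a \<notin> H"
    "\<And>K. left_ideal K R \<Longrightarrow> H \<subseteq> K \<Longrightarrow> a \<notin> K \<Longrightarrow> K = H"
proof -
  let ?A = "{H. left_ideal H R \<and> I \<subseteq> H \<and> a \<notin> H}"
  have "\<exists>M\<in>?A. \<forall>T\<in>?A. M \<subseteq> T \<longrightarrow> T = M"
  proof (rule subset_Zorn_nonempty)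
    show "?A \<noteq> {}" using assms by auto
  next
    fix \<C> assume ne: "\<C> \<noteq> {}" and ch: "subset.chain ?A \<C>"
    then have sub: "\<And>H. H \<in> \<C> \<Longrightarrow> left_ideal H R \<and> I \<subseteq> H \<and> a \<notin> H"
      by (auto simp: subset.chain_def)
    have "left_ideal (\<Union>\<C>) R"
      unfolding left_ideal_iff
    proof (intro conjI ballI)
      show "\<Union>\<C> \<subseteq> carrier R" using sub left_idealD(1) by fast
      show "\<zero> \<in> \<Union>\<C>" using sub left_idealD(2) ne by fast
    next
      fix x y assume "x \<in> \<Union>\<C>" "y \<in> \<Union>\<C>"
      then obtain T Y where XY: "x \<in> T" "T \<in> \<C>" "y \<in> Y" "Y \<in> \<C>" by auto
      then have "T \<subseteq> Y \<or> Y \<subseteq> T" using ch by (auto simp: subset.chain_def)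
      then show "x \<oplus> y \<in> \<Union>\<C>" using XY sub left_idealD(3) by (meson UnionI subsetD)
    next
      fix b x assume "b \<in> carrier R" "x \<in> \<Union>\<C>"
      then show "b \<otimes> x \<in> \<Union>\<C>" using sub left_idealD(4) by fast
    qed
    then show "\<Union>\<C> \<in> ?A" using sub ne by auto
  qed
  then obtain H where H: "left_ideal H R" "I \<subseteq> H" "a \<notin> H"
    and max: "\<forall>K\<in>?A. H \<subseteq> K \<longrightarrow> K = H" by blast
  show thesis
  proof (rule that[OF H])
    fix K assume "left_ideal K R" "H \<subseteq> K" "a \<notin> K"
    then show "K = H" using max H(2) by blast
  qed
qed

lemma maximal_left_exists:
  assumes "left_ideal I R" "\<one> \<notin> I"
  obtains M where "maximal_left R M" "I \<subseteq> M"
proof -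
  obtain H where H: "left_ideal H R" "I \<subseteq> H" "\<one> \<notin> H"
    and max: "\<And>K. left_ideal K R \<Longrightarrow> H \<subseteq> K \<Longrightarrow> \<one> \<notin> K \<Longrightarrow> K = H"
    using maximal_left_ideal_avoiding[OF assms(1) one_closed assms(2)] by blast
  have "\<exists>y\<in>carrier R. \<one> \<ominus> y \<otimes> x \<in> H" if x: "x \<in> carrier R - H" for x
  proof -
    have "\<one> \<in> lsum R H x"
      using max[OF lsum_I(1,2)[OF H(1)], of x] lsum_I(4)[OF H(1), of x] x by auto
    then obtain h y where hy: "h \<in> H" "y \<in> carrier R" "\<one> = h \<oplus> y \<otimes> x"
      by (auto simp: lsum_def)
    then have hc: "h \<in> carrier R" and xc: "x \<in> carrier R" using left_idealD(1)[OF H(1)] x by auto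
    have "(h \<oplus> y \<otimes> x) \<ominus> y \<otimes> x = h" using hc xc hy(2) by algebra
    then have "\<one> \<ominus> y \<otimes> x \<in> H" using hy by simp
    then show ?thesis using hy(2) by blast
  qed
  then have "maximal_left R H" using H by (simp add: maximal_left_def)
  then show thesis using that H(2) by blast
qed

end

section \<open>Self-injectivity and annihilator duality\<close>

lemma mono_seq:
  fixes A :: "nat \<Rightarrow> 'b set"
  assumes "\<And>n. A n \<subseteq> A (Suc n)" "n \<le> m" shows "A n \<subseteq> A m"
  using assms by (rule lift_Suc_mono_le)

lemma antimono_seq:
  fixes C :: "nat \<Rightarrow> 'b set"
  assumes "\<And>n. C (Suc n) \<subseteq> C n" "n \<le> m" shows "C m \<subseteq> C n"
  using assms by (rule lift_Suc_antimono_le)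

context ring
begin

lemma left_ideal_homD:
  assumes "left_ideal_hom R I f"
  shows "left_ideal I R" "x \<in> I \<Longrightarrow> f x \<in> carrier R"
    "x \<in> I \<Longrightarrow> y \<in> I \<Longrightarrow> f (x \<oplus> y) = f x \<oplus> f y"
    "a \<in> carrier R \<Longrightarrow> x \<in> I \<Longrightarrow> f (a \<otimes> x) = a \<otimes> f x"
    "f \<zero> = \<zero>" "x \<in> I \<Longrightarrow> f (\<ominus> x) = \<ominus> f x" "x \<in> I \<Longrightarrow> y \<in> I \<Longrightarrow> f (x \<ominus> y) = f x \<ominus> f y"
proof -
  show I: "left_ideal I R" and c: "\<And>x. x \<in> I \<Longrightarrow> f x \<in> carrier R"
    and a: "\<And>x y. x \<in> I \<Longrightarrow> y \<in> I \<Longrightarrow> f (x \<oplus> y) = f x \<oplus> f y"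
    and m: "\<And>a x. a \<in> carrier R \<Longrightarrow> x \<in> I \<Longrightarrow> f (a \<otimes> x) = a \<otimes> f x"
    using assms by (auto simp: left_ideal_hom_def)
  note D = left_idealD[OF I]
  show "f \<zero> = \<zero>" using m[OF zero_closed D(2)] c[OF D(2)] by simp
  show n: "f (\<ominus> x) = \<ominus> f x" if "x \<in> I" for x
    using m[OF a_inv_closed[OF one_closed] that] c[OF that] D(1)[OF that] by (simp add: l_minus)
  show "f (x \<ominus> y) = f x \<ominus> f y" if "x \<in> I" "y \<in> I" for x y
    using that a[of x "\<ominus> y"] n[of y] D(5) by (simp add: a_minus_def)
qed

lemma left_baerD:
  assumes "left_baer R" "left_ideal_hom R I f"
  obtains c where "c \<in> carrier R" "\<And>x. x \<in> I \<Longrightarrow> f x = x \<otimes> c"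
  using assms unfolding left_baer_def by metis

text \<open>
  Homomorphisms on left ideals are constructed below as additive relations \<open>G\<close>. Well-definedness
  then only has to be checked at \<open>0\<close>, and no values have to be chosen.
\<close>

lemma left_baer_relation:
  assumes "left_baer R"
    and sub: "G \<subseteq> carrier R \<times> carrier R" and zero: "(\<zero>, \<zero>) \<in> G"
    and add: "\<And>x y x' y'. (x, y) \<in> G \<Longrightarrow> (x', y') \<in> G \<Longrightarrow> (x \<oplus> x', y \<oplus> y') \<in> G"
    and mult: "\<And>a x y. a \<in> carrier R \<Longrightarrow> (x, y) \<in> G \<Longrightarrow> (a \<otimes> x, a \<otimes> y) \<in> G"
    and single: "\<And>y. (\<zero>, y) \<in> G \<Longrightarrow> y = \<zero>"
  shows "\<exists>c\<in>carrier R. \<forall>x y. (x, y) \<in> G \<longrightarrow> y = x \<otimes> c"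
proof -
  have eq: "y = y'" if "(x, y) \<in> G" "(x, y') \<in> G" for x y y'
  proof -
    have c: "x \<in> carrier R" "y \<in> carrier R" "y' \<in> carrier R" using that sub by auto
    have "(x \<oplus> (\<ominus> \<one>) \<otimes> x, y \<oplus> (\<ominus> \<one>) \<otimes> y') \<in> G" using that by (intro add mult) auto
    moreover have "x \<oplus> (\<ominus> \<one>) \<otimes> x = \<zero>" "y \<oplus> (\<ominus> \<one>) \<otimes> y' = y \<ominus> y'" using c by algebra+
    ultimately have "y \<ominus> y' = \<zero>" using single by simp
    then show ?thesis using c by (simp add: r_right_minus_eq)
  qed
  define f where "f x = (THE y. (x, y) \<in> G)" for x
  have f: "f x = y" if "(x, y) \<in> G" for x y
    unfolding f_def using eq that by blast
  have "left_ideal (fst ` G) R"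
    unfolding left_ideal_iff
  proof (intro conjI ballI)
    show "fst ` G \<subseteq> carrier R" using sub by auto
    show "\<zero> \<in> fst ` G" using zero by force
    show "x \<oplus> x' \<in> fst ` G" if "x \<in> fst ` G" "x' \<in> fst ` G" for x x'
    proof -
      from that obtain y y' where "(x, y) \<in> G" "(x', y') \<in> G" by auto
      from add[OF this] show ?thesis by (rule image_eqI[rotated]) simp
    qed
    show "a \<otimes> x \<in> fst ` G" if "a \<in> carrier R" "x \<in> fst ` G" for a x
    proof -
      from that obtain y where "(x, y) \<in> G" by auto
      from mult[OF that(1) this] show ?thesis by (rule image_eqI[rotated]) simp
    qed
  qed
  then have "left_ideal_hom R (fst ` G) f"
    unfolding left_ideal_hom_def
  proof (intro conjI ballI)
    show "f \<in> fst ` G \<rightarrow> carrier R" using sub f by auto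
    show "f (x \<oplus> x') = f x \<oplus> f x'" if "x \<in> fst ` G" "x' \<in> fst ` G" for x x'
    proof -
      from that obtain y y' where *: "(x, y) \<in> G" "(x', y') \<in> G" by auto
      show ?thesis using f[OF add[OF *]] f[OF *(1)] f[OF *(2)] by simp
    qed
    show "f (a \<otimes> x) = a \<otimes> f x" if "a \<in> carrier R" "x \<in> fst ` G" for a x
    proof -
      from that obtain y where *: "(x, y) \<in> G" by auto
      show ?thesis using f[OF mult[OF that(1) *]] f[OF *] by simp
    qed
  qed
  then obtain c where "c \<in> carrier R" "\<And>x. x \<in> fst ` G \<Longrightarrow> f x = x \<otimes> c"
    using left_baerD[OF assms(1)] by blast
  moreover have "y = x \<otimes> c" if "(x, y) \<in> G" for x y
    using f[OF that] calculation(2)[of x] that by force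
  ultimately show ?thesis by blast
qed

text \<open>
  The common form of the maps in the annihilator computations. With \<open>I = 0\<close> it extends \<open>z a \<mapsto> z b\<close> from
  \<open>L a\<close> to \<open>R\<close>; with \<open>a = 1\<close> it glues the zero map on \<open>I\<close> to right multiplication by \<open>b\<close> on \<open>L\<close>.
\<close>

lemma left_baer_two_term:
  assumes lb: "left_baer R" and I: "left_ideal I R" and L: "left_ideal L R"
    and ab: "a \<in> carrier R" "b \<in> carrier R"
    and wd: "\<And>h z. h \<in> I \<Longrightarrow> z \<in> L \<Longrightarrow> h \<oplus> z \<otimes> a = \<zero> \<Longrightarrow> z \<otimes> b = \<zero>"
  shows "\<exists>c\<in>carrier R. (\<forall>h\<in>I. h \<otimes> c = \<zero>) \<and> (\<forall>z\<in>L. z \<otimes> a \<otimes> c = z \<otimes> b)"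
proof -
  note ID = left_idealD[OF I] and LD = left_idealD[OF L]
  let ?G = "{(h \<oplus> z \<otimes> a, z \<otimes> b) | h z. h \<in> I \<and> z \<in> L}"
  have memG: "(h \<oplus> z \<otimes> a, z \<otimes> b) \<in> ?G" if "h \<in> I" "z \<in> L" for h z using that by blast
  have "\<exists>c\<in>carrier R. \<forall>x y. (x, y) \<in> ?G \<longrightarrow> y = x \<otimes> c"
  proof (rule left_baer_relation[OF lb])
    show "?G \<subseteq> carrier R \<times> carrier R" using ID(1) LD(1) ab by auto
    show "(\<zero>, \<zero>) \<in> ?G" using memG[OF ID(2) LD(2)] ab by simp
  next
    fix x y x' y' assume "(x, y) \<in> ?G" "(x', y') \<in> ?G"
    then obtain h z h' z' where *: "x = h \<oplus> z \<otimes> a" "y = z \<otimes> b" "x' = h' \<oplus> z' \<otimes> a" "y' = z' \<otimes> b"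
      "h \<in> I" "h' \<in> I" "z \<in> L" "z' \<in> L" by blast
    have "x \<oplus> x' = (h \<oplus> h') \<oplus> (z \<oplus> z') \<otimes> a" "y \<oplus> y' = (z \<oplus> z') \<otimes> b"
      unfolding *(1-4) using *(5,6)[THEN ID(1)] *(7,8)[THEN LD(1)] ab by algebra+
    then show "(x \<oplus> x', y \<oplus> y') \<in> ?G" using memG[OF ID(3)[OF *(5,6)] LD(3)[OF *(7,8)]] by simp
  next
    fix r x y assume r: "r \<in> carrier R" "(x, y) \<in> ?G"
    then obtain h z where *: "x = h \<oplus> z \<otimes> a" "y = z \<otimes> b" "h \<in> I" "z \<in> L" by blast
    have "r \<otimes> x = r \<otimes> h \<oplus> (r \<otimes> z) \<otimes> a" "r \<otimes> y = (r \<otimes> z) \<otimes> b"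
      unfolding *(1,2) using ID(1)[OF *(3)] LD(1)[OF *(4)] ab r(1) by algebra+
    then show "(r \<otimes> x, r \<otimes> y) \<in> ?G" using memG[OF ID(4)[OF r(1) *(3)] LD(4)[OF r(1) *(4)]] by simp
  next
    fix y assume "(\<zero>, y) \<in> ?G"
    then obtain h z where "\<zero> = h \<oplus> z \<otimes> a" "y = z \<otimes> b" "h \<in> I" "z \<in> L" by blast
    then show "y = \<zero>" using wd[of h z] by simp
  qed
  then obtain c where c: "c \<in> carrier R" "\<And>x y. (x, y) \<in> ?G \<Longrightarrow> y = x \<otimes> c" by blast
  have "h \<otimes> c = \<zero>" if "h \<in> I" for h using c(2)[OF memG[OF that LD(2)]] ID(1)[OF that] ab by simp
  moreover have "z \<otimes> a \<otimes> c = z \<otimes> b" if "z \<in> L" for z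
    using c(2)[OF memG[OF ID(2) that]] LD(1)[OF that] ab by simp
  ultimately show ?thesis using c(1) by blast
qed

text \<open>
  An injective module in which every simple module embeds is a cogenerator. Explicitly, for
  \<open>a \<notin> I\<close> the proper left ideal of all \<open>x\<close> with \<open>x a \<in> I\<close> annihilates some \<open>s \<noteq> 0\<close>, so \<open>I + R a\<close> maps
  to \<open>R\<close> by \<open>h + x a \<mapsto> x s\<close>; the element inducing this map lies in \<open>r(I)\<close> and does not kill \<open>a\<close>.
\<close>

lemma lann_rann_of_kasch:
  assumes "left_baer R" "elementwise_kasch R" "left_ideal I R"
  shows "lann R (rann R I) = I"
proof (rule antisym)
  note I = left_idealD[OF assms(3)]
  show "I \<subseteq> lann R (rann R I)" using I(1) by (auto simp: mem_lann mem_rann)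
  show "lann R (rann R I) \<subseteq> I"
  proof (rule subsetI, rule ccontr)
    fix a assume a: "a \<in> lann R (rann R I)" and "a \<notin> I"
    then have ac: "a \<in> carrier R" by (simp add: mem_lann)
    let ?M = "{x \<in> carrier R. x \<otimes> a \<in> I}"
    have "left_ideal ?M R" using left_ideal_quot[OF assms(3) ac] .
    moreover have "\<one> \<notin> ?M" using \<open>a \<notin> I\<close> ac by simp
    ultimately obtain s where s: "s \<in> carrier R" "s \<noteq> \<zero>" "\<And>x. x \<in> ?M \<Longrightarrow> x \<otimes> s = \<zero>"
      using assms(2) unfolding elementwise_kasch_def by blast
    have "z \<otimes> s = \<zero>" if h: "h \<in> I" and z: "z \<in> carrier R" and 0: "h \<oplus> z \<otimes> a = \<zero>" for h z
    proof -
      have "z \<otimes> a = \<ominus> h" using 0 z I(1)[OF h] ac by (metis a_comm m_closed minus_equality)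
      then show ?thesis using s(3)[of z] I(5)[OF h] z by simp
    qed
    then have "\<exists>v\<in>carrier R. (\<forall>h\<in>I. h \<otimes> v = \<zero>) \<and> (\<forall>z\<in>carrier R. z \<otimes> a \<otimes> v = z \<otimes> s)"
      using ac s(1) by (intro left_baer_two_term assms(1,3) left_ideal_carrier)
    then obtain v where v: "v \<in> carrier R" "\<forall>h\<in>I. h \<otimes> v = \<zero>" "\<one> \<otimes> a \<otimes> v = \<one> \<otimes> s" by blast
    then have "a \<otimes> v = \<zero>" using a by (simp add: mem_lann mem_rann)
    moreover have "a \<otimes> v = s" using v ac s(1) by simp
    ultimately show False using s(2) by simp
  qed
qed

text \<open>
  The union on the right is a right ideal and has the same left annihilator as the ideal on the
  left, hence equals it by duality.
\<close>

lemma rann_Inter: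
  assumes lr: "\<And>I. left_ideal I R \<Longrightarrow> lann R (rann R I) = I"
    and rl: "\<And>I. right_ideal I R \<Longrightarrow> rann R (lann R I) = I"
    and C: "\<And>n. left_ideal (C n) R" "\<And>n. C (Suc n) \<subseteq> C n"
  shows "rann R (\<Inter>n. C n) = (\<Union>n. rann R (C n))"
proof -
  have sub: "C n \<subseteq> carrier R" for n using C(1) by (simp add: left_ideal_iff)
  have V: "right_ideal (\<Union>n. rann R (C n)) R"
  proof (rule ring.left_ideal_UN[OF opp])
    show "right_ideal (rann R (C n)) R" for n using right_ideal_rann[OF sub] .
    show "rann R (C n) \<subseteq> rann R (C (Suc n))" for n using C(2)[of n] unfolding subset_iff mem_rann by blast
  qed
  have "lann R (\<Union>n. rann R (C n)) = (\<Inter>n. lann R (rann R (C n)))"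
    by (auto simp: mem_lann)
  also have "\<dots> = (\<Inter>n. C n)" using lr C by simp
  finally show ?thesis using rl[OF V] by simp
qed

text \<open>
  With \<open>A\<^sub>n = B + R x\<^sub>0 + \<dots> + R x\<^sub>n\<^sub>-\<^sub>1\<close> and \<open>C\<^sub>n = B + R x\<^sub>n + R x\<^sub>n\<^sub>+\<^sub>1 + \<dots>\<close> the hypotheses say that the
  \<open>x\<^sub>n\<close> span an infinite direct sum in \<open>R/B\<close>. On the union of the \<open>A\<^sub>n\<close> there is a homomorphism to \<open>R\<close>
  which kills \<open>A\<^sub>0\<close> but no \<open>x\<^sub>n\<close>. It is given by an element \<open>v\<close> that kills the intersection of the
  \<open>C\<^sub>n\<close>, and so, by \<open>rann_Inter\<close>, kills some \<open>C\<^sub>n\<close> and with it \<open>x\<^sub>n\<close>.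
\<close>

lemma no_independent_sequence:
  assumes lb: "left_baer R"
    and lr: "\<And>I. left_ideal I R \<Longrightarrow> lann R (rann R I) = I"
    and rl: "\<And>I. right_ideal I R \<Longrightarrow> rann R (lann R I) = I"
    and A: "\<And>n. left_ideal (A n) R" "\<And>n. A n \<subseteq> A (Suc n)"
    and C: "\<And>n. left_ideal (C n) R" "\<And>n. C (Suc n) \<subseteq> C n"
    and le: "(\<Inter>n. C n) \<subseteq> A 0"
    and x: "\<And>n. x n \<in> C n" "\<And>n. x n \<in> A (Suc n)" "\<And>n. x n \<notin> A n"
  shows False
proof -
  have Asub: "A n \<subseteq> carrier R" for n using A(1) by (simp add: left_ideal_iff)
  have "\<exists>d. d \<in> rann R (A n) \<and> x n \<otimes> d \<noteq> \<zero>" for n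
  proof (rule ccontr)
    assume "\<nexists>d. d \<in> rann R (A n) \<and> x n \<otimes> d \<noteq> \<zero>"
    then have "x n \<in> lann R (rann R (A n))" using x(2)[of n] Asub by (auto simp: mem_lann)
    then show False using lr[OF A(1)] x(3) by simp
  qed
  then obtain d where d: "\<And>n. d n \<in> rann R (A n)" "\<And>n. x n \<otimes> d n \<noteq> \<zero>" by metis
  \<comment> \<open>\<open>q n\<close> gives the homomorphism on \<open>A n\<close>; the correction by \<open>d n\<close>, which kills \<open>A n\<close>, is made
    only if otherwise \<open>x n\<close> would be sent to \<open>0\<close>.\<close>
  define q where "q = rec_nat \<zero> (\<lambda>n p. if x n \<otimes> p \<noteq> \<zero> then p else p \<oplus> d n)"
  have q0: "q 0 = \<zero>" and qS: "q (Suc n) = (if x n \<otimes> q n \<noteq> \<zero> then q n else q n \<oplus> d n)" for n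
    by (simp_all add: q_def)
  have dc: "d n \<in> carrier R" for n using d(1)[of n] by (simp add: mem_rann)
  have qc: "q n \<in> carrier R" for n by (induction n) (auto simp: q0 qS dc)
  have xc: "x n \<in> carrier R" for n using x(2) Asub by blast
  have qx: "x n \<otimes> q (Suc n) \<noteq> \<zero>" for n
    using d(2)[of n] xc qc dc by (auto simp: qS r_distr)
  have stepq: "y \<otimes> q (Suc n) = y \<otimes> q n" if "y \<in> A n" for y n
    using d(1)[of n] that Asub qc dc by (auto simp: qS mem_rann r_distr subset_iff)
  have eqq: "y \<otimes> q m = y \<otimes> q n" if "y \<in> A n" "n \<le> m" for y n m
    using that(2)
  proof (induction m rule: dec_induct)
    case (step m)
    then show ?case using stepq[of y m] mono_seq[of A, OF A(2) step(1)] that(1) by auto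
  qed simp
  let ?G = "{(y, y \<otimes> q n) | y n. y \<in> A n}"
  have memG: "(y, y \<otimes> q n) \<in> ?G" if "y \<in> A n" for y n using that by blast
  have "\<exists>v\<in>carrier R. \<forall>y z. (y, z) \<in> ?G \<longrightarrow> z = y \<otimes> v"
  proof (rule left_baer_relation[OF lb, of ?G])
    show "?G \<subseteq> carrier R \<times> carrier R" using Asub qc by auto
    show "(\<zero>, \<zero>) \<in> ?G" using memG[of \<zero> 0] left_idealD(2)[OF A(1)] qc by simp
  next
    fix y z y' z' assume "(y, z) \<in> ?G" "(y', z') \<in> ?G"
    then obtain n n' where n: "y \<in> A n" "z = y \<otimes> q n" "y' \<in> A n'" "z' = y' \<otimes> q n'" by auto
    let ?m = "max n n'"
    have m: "y \<in> A ?m" "y' \<in> A ?m" "z = y \<otimes> q ?m" "z' = y' \<otimes> q ?m"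
      using n mono_seq[of A, OF A(2), of n ?m] mono_seq[of A, OF A(2), of n' ?m]
        eqq[of y n ?m] eqq[of y' n' ?m] by auto
    then have "(y \<oplus> y', (y \<oplus> y') \<otimes> q ?m) \<in> ?G"
      by (intro memG left_idealD(3)[OF A(1)])
    then show "(y \<oplus> y', z \<oplus> z') \<in> ?G"
      using m Asub qc by (simp add: l_distr subset_iff)
  next
    fix a y z assume "a \<in> carrier R" "(y, z) \<in> ?G"
    then obtain n where n: "y \<in> A n" "z = y \<otimes> q n" by auto
    then have "(a \<otimes> y, a \<otimes> y \<otimes> q n) \<in> ?G"
      using \<open>a \<in> carrier R\<close> by (intro memG left_idealD(4)[OF A(1)])
    moreover have "a \<otimes> y \<otimes> q n = a \<otimes> z"
      using n Asub qc \<open>a \<in> carrier R\<close> by (simp add: m_assoc subset_iff)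
    ultimately show "(a \<otimes> y, a \<otimes> z) \<in> ?G" by simp
  next
    fix z assume "(\<zero>, z) \<in> ?G"
    then show "z = \<zero>" using qc by auto
  qed
  then obtain v where v: "v \<in> carrier R" "\<And>y z. (y, z) \<in> ?G \<Longrightarrow> z = y \<otimes> v" by blast
  have "y \<otimes> v = \<zero>" if "y \<in> A 0" for y
    using v(2)[OF memG[OF that]] subsetD[OF Asub that] by (simp add: q0)
  then have "v \<in> rann R (\<Inter>n. C n)" using v(1) le by (auto simp: mem_rann)
  then obtain n where "v \<in> rann R (C n)" using rann_Inter[of C, OF lr rl C] by auto
  then have "x n \<otimes> v = \<zero>" using x(1) by (simp add: mem_rann)
  moreover have "x n \<otimes> q (Suc n) = x n \<otimes> v" using v(2)[OF memG[OF x(2)]] .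
  ultimately show False using qx by simp
qed

lemma simple_modD:
  assumes "y \<in> simple_mod R B"
  shows "y \<in> carrier R" "a \<in> carrier R \<Longrightarrow> a \<otimes> y \<notin> B \<Longrightarrow> \<exists>b\<in>carrier R. b \<otimes> (a \<otimes> y) \<ominus> y \<in> B"
  using assms by (auto simp: simple_mod_def)

lemma simple_mod_absorb:
  assumes B: "left_ideal B R" and K: "left_ideal K R" "B \<subseteq> K" and y: "y \<in> simple_mod R B"
    and a: "a \<in> carrier R" "a \<otimes> y \<in> K" "a \<otimes> y \<notin> B"
  shows "y \<in> K"
proof -
  obtain b where b: "b \<in> carrier R" "b \<otimes> (a \<otimes> y) \<ominus> y \<in> B" using simple_modD(2)[OF y] a by blast
  have yc: "y \<in> carrier R" using simple_modD(1)[OF y] .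
  have "b \<otimes> (a \<otimes> y) \<ominus> (b \<otimes> (a \<otimes> y) \<ominus> y) \<in> K"
    using left_idealD(4,6)[OF K(1)] b a K(2) by blast
  moreover have "b \<otimes> (a \<otimes> y) \<ominus> (b \<otimes> (a \<otimes> y) \<ominus> y) = y" using yc a b by algebra
  ultimately show ?thesis by simp
qed

text \<open>
  If each \<open>x\<^sub>n\<close> is simple modulo \<open>B\<close> and not in the span of its predecessors, the sum of the \<open>R x\<^sub>n\<close>
  modulo \<open>B\<close> is direct: a relation whose last term is \<open>r x\<^sub>n\<close> with \<open>r x\<^sub>n \<notin> B\<close> would put \<open>x\<^sub>n\<close> itself in
  the span of the earlier ones. So the tails \<open>C\<^sub>n\<close> meet the heads \<open>A\<^sub>n\<close> in \<open>B\<close> only.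
\<close>

lemma independent_tails:
  assumes B: "left_ideal B R" and A0: "A 0 = B" and AS: "\<And>n. A (Suc n) = lsum R (A n) (x n)"
    and x: "\<And>n. x n \<in> simple_mod R B" "\<And>n. x n \<notin> A n"
  obtains C where "\<And>n. left_ideal (C n) R" "\<And>n. C (Suc n) \<subseteq> C n" "(\<Inter>n. C n) \<subseteq> B"
    "\<And>n. x n \<in> C n" "\<And>n. C n \<inter> A n \<subseteq> B"
proof -
  have xc: "x n \<in> carrier R" for n using simple_modD(1)[OF x(1)] .
  have A: "left_ideal (A n) R" for n by (induction n) (auto simp: A0 AS B intro: lsum_I xc)
  have Amono: "A n \<subseteq> A (Suc n)" for n using lsum_I(2)[OF A xc] AS by simp
  have BA: "B \<subseteq> A n" for n using mono_seq[of A, OF Amono, of 0 n] A0 by simp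
  define D where "D n = rec_nat B (\<lambda>k I. lsum R I (x (n + k)))" for n
  have D0: "D n 0 = B" and DS: "D n (Suc k) = lsum R (D n k) (x (n + k))" for n k
    by (simp_all add: D_def)
  have D: "left_ideal (D n k) R" for n k by (induction k) (auto simp: D0 DS B intro: lsum_I xc)
  have Dmono: "D n k \<subseteq> D n (Suc k)" for n k unfolding DS by (rule lsum_I(2)[OF D xc])
  have BD: "B \<subseteq> D n k" for n k using mono_seq[of "D n", OF Dmono, of 0 k] D0 by simp
  have DA: "D n k \<subseteq> A (n + k)" for n k
  proof (induction k)
    case (Suc k)
    have "D n (Suc k) \<subseteq> A (Suc (n + k))"
      unfolding DS AS using lsum_I(1,2,4)[OF A[of "n + k"] xc[of "n + k"]] Suc by (intro lsum_least) auto
    then show ?case by simp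
  qed (use BA in \<open>auto simp: D0\<close>)
  have DD: "D (Suc n) k \<subseteq> D n (Suc k)" for n k
  proof (induction k)
    case (Suc k)
    have e: "D n (Suc (Suc k)) = lsum R (D n (Suc k)) (x (Suc n + k))" using DS[of n "Suc k"] by simp
    show ?case
      unfolding DS[of "Suc n" k] e using lsum_I(1,2,4)[OF D[of n "Suc k"] xc[of "Suc n + k"]] Suc
      by (intro lsum_least) (blast intro: subsetD)+
  qed (use BD in \<open>auto simp: D0\<close>)
  have disj: "D n k \<inter> A n \<subseteq> B" for n k
  proof (induction k)
    case (Suc k)
    show ?case
    proof
      fix y assume y: "y \<in> D n (Suc k) \<inter> A n"
      then obtain u r where ur: "y = u \<oplus> r \<otimes> x (n + k)" "u \<in> D n k" "r \<in> carrier R"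
        by (auto simp: DS lsum_def)
      have An: "y \<in> A (n + k)" using y mono_seq[of A, OF Amono, of n "n + k"] by auto
      have uA: "u \<in> A (n + k)" using DA ur(2) by blast
      have uc: "u \<in> carrier R" and yc: "y \<in> carrier R"
        using left_idealD(1)[OF A] uA An by auto
      have "y \<ominus> u = r \<otimes> x (n + k)" unfolding ur(1) using uc ur(3) xc[of "n + k"] by algebra
      then have "r \<otimes> x (n + k) \<in> A (n + k)" using left_idealD(6)[OF A An uA] by simp
      then have "r \<otimes> x (n + k) \<in> B"
        using simple_mod_absorb[OF B A BA x(1) ur(3)] x(2) by blast
      then have "y \<in> D n k" unfolding ur(1) using left_idealD(3)[OF D ur(2)] BD by blast
      then show "y \<in> B" using Suc y by blast
    qed
  qed (simp add: D0)
  define C where "C n = (\<Union>k. D n k)" for n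
  have A_D: "A k = D 0 k" for k by (induction k) (simp_all add: A0 AS D0 DS)
  show thesis
  proof (rule that[of C])
    show "left_ideal (C n) R" for n unfolding C_def using D Dmono by (rule left_ideal_UN)
    show dec: "C (Suc n) \<subseteq> C n" for n unfolding C_def using DD by blast
    have CA: "C n \<inter> A n \<subseteq> B" for n unfolding C_def using disj by blast
    then show "C n \<inter> A n \<subseteq> B" for n .
    show "x n \<in> C n" for n
    proof -
      have "x n \<in> D n (Suc 0)" using lsum_I(4)[OF B xc] by (simp add: DS D0)
      then show ?thesis by (auto simp: C_def)
    qed
    show "(\<Inter>n. C n) \<subseteq> B"
    proof
      fix y assume y: "y \<in> (\<Inter>n. C n)"
      then have "y \<in> C 0" by blast
      then obtain k where "y \<in> A k" unfolding C_def A_D by blast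
      then show "y \<in> B" using y CA[of k] by blast
    qed
  qed
qed

lemma fg_or_sequence:
  assumes B: "left_ideal B R" and Y: "Y \<subseteq> carrier R"
    and nofg: "\<And>xs. set xs \<subseteq> Y \<Longrightarrow> \<not> Y \<subseteq> lspan R B xs"
  obtains A x where "A 0 = B" "\<And>n. A (Suc n) = lsum R (A n) (x n)" "\<And>n. left_ideal (A n) R"
    "\<And>n. x n \<in> Y" "\<And>n. x n \<notin> A n"
proof -
  have "\<exists>y. y \<in> Y \<and> y \<notin> lspan R B xs" if "set xs \<subseteq> Y" for xs using nofg[OF that] by blast
  then obtain f where f: "\<And>xs. set xs \<subseteq> Y \<Longrightarrow> f xs \<in> Y \<and> f xs \<notin> lspan R B xs" by metis
  define L where "L = rec_nat [] (\<lambda>n xs. f xs # xs)"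
  have L0: "L 0 = []" and LS: "L (Suc n) = f (L n) # L n" for n by (simp_all add: L_def)
  have LY: "set (L n) \<subseteq> Y" for n by (induction n) (auto simp: L0 LS f)
  show thesis
  proof (rule that[of "\<lambda>n. lspan R B (L n)" "\<lambda>n. f (L n)"])
    show "left_ideal (lspan R B (L n)) R" for n using lspan_ideal[OF B] LY Y by blast
  qed (use f LY in \<open>auto simp: L0 LS\<close>)
qed

end

text \<open>
  Every semisimple submodule of a cyclic module \<open>R/B\<close> is finitely generated. The generators are
  taken from a prescribed set \<open>Y\<close> of simple elements so that they can be kept inside a given ideal.
\<close>

definition finite_socles :: "('a, 'r) ring_scheme \<Rightarrow> bool"
  where "finite_socles R \<longleftrightarrow> (\<forall>B Y. left_ideal B R \<and> Y \<subseteq> simple_mod R B \<longrightarrow>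
    (\<exists>ys. set ys \<subseteq> Y \<and> Y \<subseteq> lspan R B ys))"

context ring
begin

lemma finite_soclesI:
  assumes "\<And>B A C x. left_ideal B R \<Longrightarrow> A 0 = B \<Longrightarrow> (\<And>n. left_ideal (A n) R) \<Longrightarrow>
    (\<And>n. A n \<subseteq> A (Suc n)) \<Longrightarrow> (\<And>n. left_ideal (C n) R) \<Longrightarrow> (\<And>n. C (Suc n) \<subseteq> C n) \<Longrightarrow>
    (\<Inter>n. C n) \<subseteq> B \<Longrightarrow> (\<And>n. x n \<in> C n) \<Longrightarrow> (\<And>n. C n \<inter> A n \<subseteq> B) \<Longrightarrow>
    (\<And>n. x n \<in> A (Suc n)) \<Longrightarrow> (\<And>n. x n \<notin> A n) \<Longrightarrow> False"
  shows "finite_socles R"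
  unfolding finite_socles_def
proof (intro allI impI, elim conjE, rule ccontr)
  fix B Y assume B: "left_ideal B R" and Y: "Y \<subseteq> simple_mod R B"
    and "\<not> (\<exists>ys. set ys \<subseteq> Y \<and> Y \<subseteq> lspan R B ys)"
  then have *: "\<And>xs. set xs \<subseteq> Y \<Longrightarrow> \<not> Y \<subseteq> lspan R B xs" by blast
  have Yc: "Y \<subseteq> carrier R" using Y simple_modD(1) by blast
  obtain A x where A: "A 0 = B" "\<And>n. A (Suc n) = lsum R (A n) (x n)" "\<And>n. left_ideal (A n) R"
    "\<And>n. x n \<in> Y" "\<And>n. x n \<notin> A n"
    using fg_or_sequence[OF B Yc *] by metis
  have xm: "x n \<in> simple_mod R B" for n using A(4) Y by blast
  obtain C where C: "\<And>n. left_ideal (C n) R" "\<And>n. C (Suc n) \<subseteq> C n" "(\<Inter>n. C n) \<subseteq> B"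
    "\<And>n. x n \<in> C n" "\<And>n. C n \<inter> A n \<subseteq> B"
    using independent_tails[OF B A(1,2) xm A(5)] by metis
  have xc: "x n \<in> carrier R" for n using A(4) Yc by blast
  have "A n \<subseteq> A (Suc n)" "x n \<in> A (Suc n)" for n
    using lsum_I(2,4)[OF A(3) xc] A(2) by simp_all
  then show False using assms[OF B A(1) A(3) _ C(1) C(2) C(3) C(4) C(5) _ A(5)] by blast
qed

lemma finite_socles_of_duality:
  assumes lb: "left_baer R"
    and lr: "\<And>I. left_ideal I R \<Longrightarrow> lann R (rann R I) = I"
    and rl: "\<And>I. right_ideal I R \<Longrightarrow> rann R (lann R I) = I"
  shows "finite_socles R"
proof (rule finite_soclesI)
  fix B A C x
  assume "left_ideal B R" "A 0 = B" and A: "\<And>n. left_ideal (A n) R" "\<And>n. A n \<subseteq> A (Suc n)"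
    and C: "\<And>n. left_ideal (C n) R" "\<And>n. C (Suc n) \<subseteq> C n" and CB: "(\<Inter>n. C n) \<subseteq> B"
    and "\<And>n. C n \<inter> A n \<subseteq> B"
    and x: "\<And>n. x n \<in> C n" "\<And>n. x n \<in> A (Suc n)" "\<And>n. x n \<notin> A n"
  have "(\<Inter>n. C n) \<subseteq> A 0" using CB \<open>A 0 = B\<close> by simp
  from no_independent_sequence[OF lb, of A C x, OF lr rl A C this x] show False .
qed

lemma finite_socles_of_artinian:
  assumes "left_artinian R"
  shows "finite_socles R"
proof (rule finite_soclesI)
  fix B A C x
  assume "left_ideal B R" "A 0 = B" and A: "\<And>n. left_ideal (A n) R" "\<And>n. A n \<subseteq> A (Suc n)"
    and C: "\<And>n. left_ideal (C n) R" "\<And>n. C (Suc n) \<subseteq> C n" and CB: "(\<Inter>n. C n) \<subseteq> B"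
    and CA: "\<And>n. C n \<inter> A n \<subseteq> B"
    and x: "\<And>n. x n \<in> C n" "\<And>n. x n \<in> A (Suc n)" "\<And>n. x n \<notin> A n"
  obtain m where m: "\<And>n. n \<ge> m \<Longrightarrow> C n = C m"
    using assms C unfolding left_artinian_def by metis
  have "x m \<in> C (Suc m)" using m[of "Suc m"] x(1) by simp
  then have "x m \<in> B" using CA x(2) by blast
  then show False using x(3) mono_seq[of A, OF A(2), of 0 m] \<open>A 0 = B\<close> by auto
qed

end

section \<open>Semisimplicity modulo the Jacobson radical\<close>

context ring
begin

lemma maximal_leftD:
  assumes "maximal_left R M"
  shows "left_ideal M R" "\<one> \<notin> M"
    "x \<in> carrier R \<Longrightarrow> x \<notin> M \<Longrightarrow> \<exists>y\<in>carrier R. \<one> \<ominus> y \<otimes> x \<in> M"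
  using assms by (auto simp: maximal_left_def)

lemma left_ideal_jac: "left_ideal (jac R) R"
  unfolding left_ideal_iff jac_def
  using left_idealD[OF maximal_leftD(1)] by (simp add: subset_eq)

lemma jac_carrier: "x \<in> jac R \<Longrightarrow> x \<in> carrier R"
  by (simp add: jac_def)

text \<open>
  For \<open>r \<notin> M\<close> the left ideal of all \<open>z\<close> with \<open>z r \<in> M\<close> is again maximal.
\<close>

lemma right_ideal_jac: "right_ideal (jac R) R"
proof -
  have "x \<otimes> r \<in> M" if x: "x \<in> jac R" and r: "r \<in> carrier R" and M: "maximal_left R M" for x r M
  proof (cases "r \<in> M")
    case True
    then show ?thesis using left_idealD(4)[OF maximal_leftD(1)[OF M]] jac_carrier[OF x] by blast
  next
    case False
    let ?N = "{z \<in> carrier R. z \<otimes> r \<in> M}"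
    note MI = left_idealD[OF maximal_leftD(1)[OF M]]
    have "maximal_left R ?N"
      unfolding maximal_left_def
    proof (intro conjI ballI)
      show "left_ideal ?N R" using left_ideal_quot[OF maximal_leftD(1)[OF M] r] .
      show "\<one> \<notin> ?N" using False r by simp
    next
      fix z assume z: "z \<in> carrier R - ?N"
      then obtain y where y: "y \<in> carrier R" "\<one> \<ominus> y \<otimes> (z \<otimes> r) \<in> M"
        using maximal_leftD(3)[OF M, of "z \<otimes> r"] r by auto
      have "r \<otimes> (\<one> \<ominus> y \<otimes> (z \<otimes> r)) \<in> M" using MI(4)[OF r y(2)] .
      moreover have "r \<otimes> (\<one> \<ominus> y \<otimes> (z \<otimes> r)) = (\<one> \<ominus> (r \<otimes> y) \<otimes> z) \<otimes> r"
        using r z y(1) by (simp add: mult_one_minus m_assoc)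
      ultimately show "\<exists>y\<in>carrier R. \<one> \<ominus> y \<otimes> z \<in> ?N"
        using r y z by (intro bexI[of _ "r \<otimes> y"]) auto
    qed
    then show ?thesis using x by (auto simp: jac_def)
  qed
  then have "x \<otimes> r \<in> jac R" if "x \<in> jac R" "r \<in> carrier R" for x r
    using that jac_carrier[OF that(1)] unfolding jac_def by blast
  moreover have "\<zero> \<in> jac R" "x \<oplus> y \<in> jac R" if "x \<in> jac R" "y \<in> jac R" for x y
    using left_ideal_jac that by (simp_all add: left_ideal_iff)
  ultimately show ?thesis
    using left_ideal_jac by (simp add: right_ideal_iff left_ideal_iff)
qed

lemma jac_one_minus:
  assumes a: "a \<in> jac R"
  obtains c where "c \<in> carrier R" "c \<otimes> (\<one> \<ominus> a) = \<one>" "(\<one> \<ominus> a) \<otimes> c = \<one>"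
proof -
  have left: "\<exists>c\<in>carrier R. c \<otimes> (\<one> \<ominus> a) = \<one>" if a: "a \<in> jac R" for a
  proof (rule ccontr)
    assume no: "\<not> (\<exists>c\<in>carrier R. c \<otimes> (\<one> \<ominus> a) = \<one>)"
    have ac: "a \<in> carrier R" using jac_carrier[OF a] .
    let ?I = "lsum R {\<zero>} (\<one> \<ominus> a)"
    have I: "left_ideal ?I R" "\<one> \<ominus> a \<in> ?I" using lsum_I(1,4)[OF left_ideal_zero] ac by auto
    have "\<one> \<notin> ?I" using no ac by (auto simp: lsum_def)
    then obtain M where M: "maximal_left R M" "?I \<subseteq> M" using maximal_left_exists[OF I(1)] by blast
    have "(\<one> \<ominus> a) \<oplus> a \<in> M"
      using left_idealD(3)[OF maximal_leftD(1)[OF M(1)]] a M I(2) by (auto simp: jac_def)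
    moreover have "(\<one> \<ominus> a) \<oplus> a = \<one>" using ac by algebra
    ultimately show False using maximal_leftD(2)[OF M(1)] by simp
  qed
  have ac: "a \<in> carrier R" using jac_carrier[OF a] .
  obtain c where c: "c \<in> carrier R" "c \<otimes> (\<one> \<ominus> a) = \<one>" using left[OF a] by blast
  have "\<ominus> (c \<otimes> a) \<in> jac R" using left_idealD(4,5)[OF left_ideal_jac] a c(1) by blast
  then obtain d where d: "d \<in> carrier R" "d \<otimes> (\<one> \<ominus> \<ominus> (c \<otimes> a)) = \<one>" using left by blast
  have "c \<otimes> (\<one> \<ominus> a) \<oplus> c \<otimes> a = c"
    unfolding mult_one_minus(1)[OF c(1) ac] using c(1) ac by algebra
  then have "\<one> \<ominus> \<ominus> (c \<otimes> a) = c" using c ac by (simp add: a_minus_def)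
  then have dc: "d \<otimes> c = \<one>" using d by simp
  have "d = d \<otimes> (c \<otimes> (\<one> \<ominus> a))" using c d by simp
  also have "\<dots> = \<one> \<ominus> a" using c(1) d(1) ac dc by (simp flip: m_assoc)
  finally show thesis using that c dc by simp
qed

text \<open>
  The left-right symmetry of the radical comes from its quasi-regularity: if \<open>a\<close> is in the right
  radical and \<open>1 - y a\<close> in a left ideal \<open>M\<close>, then \<open>M\<close> contains a unit.
\<close>

lemma jac_opp_subset: "jac (opp_ring R) \<subseteq> jac R"
proof
  interpret op: ring "opp_ring R" by (rule opp)
  fix a assume a: "a \<in> jac (opp_ring R)"
  have ac: "a \<in> carrier R" using op.jac_carrier[OF a] by simp
  have "a \<in> M" if M: "maximal_left R M" for M
  proof (rule ccontr)
    assume "a \<notin> M"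
    then obtain y where y: "y \<in> carrier R" "\<one> \<ominus> y \<otimes> a \<in> M" using maximal_leftD(3)[OF M ac] by blast
    have "y \<otimes> a \<in> jac (opp_ring R)"
      using ring.right_idealD(4)[OF opp op.right_ideal_jac, of y a] a y by simp
    then obtain c where c: "c \<in> carrier R" "c \<otimes> (\<one> \<ominus> y \<otimes> a) = \<one>"
      using op.jac_one_minus[of "y \<otimes> a"] by auto
    then show False using left_idealD(4)[OF maximal_leftD(1)[OF M] c(1) y(2)] maximal_leftD(2)[OF M] by simp
  qed
  then show "a \<in> jac R" using ac by (simp add: jac_def)
qed

lemma jac_opp [simp]: "jac (opp_ring R) = jac R"
  using jac_opp_subset ring.jac_opp_subset[OF opp] by auto

end

text \<open>
  Semisimplicity of \<open>R/J\<close>: the class of \<open>1\<close> lies in a finite sum of simple submodules.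
\<close>

definition semilocal :: "('a, 'r) ring_scheme \<Rightarrow> bool"
  where "semilocal R \<longleftrightarrow> (\<exists>ts. set ts \<subseteq> simple_mod R (jac R) \<and> \<one>\<^bsub>R\<^esub> \<in> lspan R (jac R) ts)"

text \<open>
  For semilocal \<open>R\<close> the elements of a module killed by \<open>J\<close> form its socle; the condition says that
  the socle of each \<open>R/B\<close> is essential.
\<close>

definition essential_socles :: "('a, 'r) ring_scheme \<Rightarrow> bool"
  where "essential_socles R \<longleftrightarrow> (\<forall>B x. left_ideal B R \<and> x \<in> carrier R - B \<longrightarrow>
    (\<exists>a\<in>carrier R. a \<otimes>\<^bsub>R\<^esub> x \<notin> B \<and> (\<forall>j\<in>jac R. j \<otimes>\<^bsub>R\<^esub> (a \<otimes>\<^bsub>R\<^esub> x) \<in> B)))"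

context ring
begin

lemma simple_mod_I:
  assumes "y \<in> carrier R"
    "\<And>a. a \<in> carrier R \<Longrightarrow> a \<otimes> y \<notin> B \<Longrightarrow> \<exists>b\<in>carrier R. b \<otimes> (a \<otimes> y) \<ominus> y \<in> B"
  shows "y \<in> simple_mod R B"
  using assms by (simp add: simple_mod_def)

text \<open>
  Chinese remainder: when a maximal \<open>M\<close> not containing the current intersection \<open>I\<close> is added, write
  \<open>1 = m + i\<close> with \<open>m \<in> M\<close>, \<open>i \<in> I\<close>. The elements \<open>t m\<close> replace the previous \<open>t\<close>, to which they are
  congruent modulo \<open>I\<close>, and \<open>i\<close> generates the new simple summand.
\<close>

lemma finite_maximal_intersection:
  assumes "\<And>M. M \<in> set Ms \<Longrightarrow> maximal_left R M"
  shows "left_ideal (carrier R \<inter> \<Inter>(set Ms)) R \<and>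
    (\<exists>ts. set ts \<subseteq> simple_mod R (carrier R \<inter> \<Inter>(set Ms)) \<and> \<one> \<in> lspan R (carrier R \<inter> \<Inter>(set Ms)) ts)"
  using assms
proof (induction Ms)
  case Nil
  show ?case
    using left_ideal_carrier by (auto intro!: exI[of _ "[]"])
next
  case (Cons M Ms)
  let ?I = "carrier R \<inter> \<Inter>(set Ms)" and ?K = "carrier R \<inter> \<Inter>(set (M # Ms))"
  have M: "maximal_left R M" using Cons.prems by simp
  note Ml = maximal_leftD(1)[OF M]
  obtain ts where I: "left_ideal ?I R" and ts: "set ts \<subseteq> simple_mod R ?I" "\<one> \<in> lspan R ?I ts"
    using Cons by auto
  have K: "?K = ?I \<inter> M" by auto
  have Kl: "left_ideal ?K R" unfolding K using left_ideal_Int[OF I Ml] .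
  show ?case
  proof (cases "?I \<subseteq> M")
    case True
    then have "?K = ?I" unfolding K by blast
    then show ?thesis using I ts by metis
  next
    case False
    then obtain w where w: "w \<in> ?I" "w \<notin> M" by blast
    then obtain y where y: "y \<in> carrier R" "\<one> \<ominus> y \<otimes> w \<in> M" using maximal_leftD(3)[OF M] by blast
    define i where "i = y \<otimes> w"
    define m where "m = \<one> \<ominus> i"
    have iI: "i \<in> ?I" unfolding i_def using left_idealD(4)[OF I y(1) w(1)] .
    have ic: "i \<in> carrier R" and mc: "m \<in> carrier R" and mM: "m \<in> M"
      using iI y by (auto simp: m_def i_def)
    have im: "m \<oplus> i = \<one>" unfolding m_def using ic by algebra
    have toK: "z \<otimes> m \<in> ?K" if z: "z \<in> ?I" for z
    proof -
      have "z \<otimes> m = z \<ominus> z \<otimes> i" unfolding m_def using z ic by (simp add: mult_one_minus)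
      then have "z \<otimes> m \<in> ?I" using left_idealD(4,6)[OF I] z iI by auto
      moreover have "z \<otimes> m \<in> M" using left_idealD(4)[OF Ml _ mM] z by auto
      ultimately show ?thesis unfolding K by blast
    qed
    have span: "z \<otimes> m \<in> lspan R ?K (map (\<lambda>t. t \<otimes> m) us)"
      if "z \<in> lspan R ?I us" "set us \<subseteq> carrier R" for z us
      using that
    proof (induction us arbitrary: z)
      case Nil
      then show ?case using toK by simp
    next
      case (Cons u us)
      then obtain v r where v: "z = v \<oplus> r \<otimes> u" "v \<in> lspan R ?I us" "r \<in> carrier R"
        by (auto simp: lsum_def)
      have "v \<otimes> m \<in> lspan R ?K (map (\<lambda>t. t \<otimes> m) us)" using Cons v by simp
      moreover have "v \<in> carrier R" using left_idealD(1)[OF lspan_ideal[OF I] v(2)] Cons.prems by simp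
      then have "z \<otimes> m = v \<otimes> m \<oplus> r \<otimes> (u \<otimes> m)"
        unfolding v(1) using v(3) mc Cons.prems(2) by (simp add: l_distr m_assoc)
      ultimately show ?case using v(3) by (auto simp: lsum_def)
    qed
    have tsc: "set ts \<subseteq> carrier R" using ts(1) simple_modD(1) by blast
    have "\<one> \<otimes> m \<in> lspan R ?K (map (\<lambda>t. t \<otimes> m) ts)" using span[OF ts(2) tsc] .
    then have one: "\<one> \<in> lspan R ?K (i # map (\<lambda>t. t \<otimes> m) ts)"
      unfolding lspan.simps lsum_def using im mc ic
      by (intro CollectI exI[of _ m] exI[of _ \<one>]) simp
    have tmin: "t \<otimes> m \<in> simple_mod R ?K" if t: "t \<in> set ts" for t
    proof (rule simple_mod_I)
      have tI: "t \<in> simple_mod R ?I" and tc: "t \<in> carrier R" using t ts(1) tsc by auto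
      then show "t \<otimes> m \<in> carrier R" using mc by simp
      fix a assume a: "a \<in> carrier R" "a \<otimes> (t \<otimes> m) \<notin> ?K"
      then have "a \<otimes> t \<notin> ?I" using toK[of "a \<otimes> t"] tc mc by (auto simp: m_assoc)
      then obtain b where b: "b \<in> carrier R" "b \<otimes> (a \<otimes> t) \<ominus> t \<in> ?I" using simple_modD(2)[OF tI a(1)] by blast
      have "(b \<otimes> (a \<otimes> t) \<ominus> t) \<otimes> m = b \<otimes> (a \<otimes> (t \<otimes> m)) \<ominus> t \<otimes> m"
        using b(1) a(1) tc mc by algebra
      then show "\<exists>b\<in>carrier R. b \<otimes> (a \<otimes> (t \<otimes> m)) \<ominus> t \<otimes> m \<in> ?K"
        using toK[OF b(2)] b(1) by auto
    qed
    have imin: "i \<in> simple_mod R ?K"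
    proof (rule simple_mod_I[OF ic])
      fix a assume a: "a \<in> carrier R" "a \<otimes> i \<notin> ?K"
      have aI: "a \<otimes> i \<in> ?I" using left_idealD(4)[OF I a(1) iI] .
      then have "a \<otimes> i \<notin> M" using a(2) unfolding K by blast
      then obtain b where b: "b \<in> carrier R" "\<one> \<ominus> b \<otimes> (a \<otimes> i) \<in> M"
        using maximal_leftD(3)[OF M, of "a \<otimes> i"] a(1) ic by blast
      have e: "(i \<otimes> b) \<otimes> (a \<otimes> i) \<ominus> i = \<ominus> (i \<otimes> (\<one> \<ominus> b \<otimes> (a \<otimes> i)))"
        using ic b(1) a(1) by (simp add: mult_one_minus m_assoc) algebra
      have "(i \<otimes> b) \<otimes> (a \<otimes> i) \<ominus> i \<in> M"
        unfolding e by (intro left_idealD(5)[OF Ml] left_idealD(4)[OF Ml ic b(2)])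
      moreover have "(i \<otimes> b) \<otimes> (a \<otimes> i) \<ominus> i \<in> ?I"
        using ic b(1) by (intro left_idealD(6)[OF I _ iI] left_idealD(4)[OF I _ aI]) simp
      ultimately show "\<exists>b\<in>carrier R. b \<otimes> (a \<otimes> i) \<ominus> i \<in> ?K"
        unfolding K using ic b(1) by blast
    qed
    have "set (i # map (\<lambda>t. t \<otimes> m) ts) \<subseteq> simple_mod R ?K"
      using imin tmin by (simp add: image_subset_iff)
    then show ?thesis using Kl one by (intro conjI exI[of _ "i # map (\<lambda>t. t \<otimes> m) ts"])
  qed
qed

lemma semilocal_of_finite:
  assumes "\<And>M. M \<in> set Ms \<Longrightarrow> maximal_left R M" "carrier R \<inter> \<Inter>(set Ms) \<subseteq> jac R"
  shows "semilocal R"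
proof -
  have "carrier R \<inter> \<Inter>(set Ms) = jac R" using assms by (auto simp: jac_def)
  then show ?thesis using finite_maximal_intersection[of Ms, OF assms(1)] by (simp add: semilocal_def)
qed

text \<open>
  As \<open>J f \<subseteq> B\<close>, \<open>R f\<close> is semisimple modulo \<open>B\<close>, being spanned by the \<open>t f\<close> for the \<open>t\<close>
  that span \<open>R/J\<close>; since \<open>f \<notin> A\<close>, one of these is outside \<open>A\<close>.
\<close>

lemma semilocal_simple_above:
  assumes sl: "semilocal R" and B: "left_ideal B R" "left_ideal A R" "B \<subseteq> A"
    and f: "f \<in> carrier R" "\<And>j. j \<in> jac R \<Longrightarrow> j \<otimes> f \<in> B" "f \<notin> A"
  obtains t where "t \<in> carrier R" "t \<otimes> f \<notin> A" "t \<otimes> f \<in> simple_mod R B"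
proof -
  obtain ts where ts: "set ts \<subseteq> simple_mod R (jac R)" "\<one> \<in> lspan R (jac R) ts"
    using sl by (auto simp: semilocal_def)
  have tsc: "set ts \<subseteq> carrier R" using ts(1) simple_modD(1) by blast
  have "\<exists>t\<in>set ts. t \<otimes> f \<notin> A"
  proof (rule ccontr)
    assume no: "\<not> (\<exists>t\<in>set ts. t \<otimes> f \<notin> A)"
    have "lspan R (jac R) ts \<subseteq> {z \<in> carrier R. z \<otimes> f \<in> A}"
    proof (rule lspan_least)
      show "jac R \<subseteq> {z \<in> carrier R. z \<otimes> f \<in> A}" using f(2) B(3) jac_carrier by auto
      show "set ts \<subseteq> {z \<in> carrier R. z \<otimes> f \<in> A}" using no tsc by auto
      show "left_ideal {z \<in> carrier R. z \<otimes> f \<in> A} R" using left_ideal_quot[OF B(2) f(1)] .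
    qed
    then show False using ts(2) f(1,3) by auto
  qed
  then obtain t where t: "t \<in> set ts" "t \<otimes> f \<notin> A" by blast
  have tc: "t \<in> carrier R" and tm: "t \<in> simple_mod R (jac R)" using t ts(1) tsc by auto
  have "t \<otimes> f \<in> simple_mod R B"
  proof (rule simple_mod_I)
    show "t \<otimes> f \<in> carrier R" using tc f(1) by simp
    fix a assume a: "a \<in> carrier R" "a \<otimes> (t \<otimes> f) \<notin> B"
    then have "a \<otimes> t \<notin> jac R" using f(2)[of "a \<otimes> t"] tc f(1) by (auto simp: m_assoc)
    then obtain b where b: "b \<in> carrier R" "b \<otimes> (a \<otimes> t) \<ominus> t \<in> jac R" using simple_modD(2)[OF tm a(1)] by blast
    have "(b \<otimes> (a \<otimes> t) \<ominus> t) \<otimes> f = b \<otimes> (a \<otimes> (t \<otimes> f)) \<ominus> t \<otimes> f"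
      using b(1) a(1) tc f(1) by algebra
    then show "\<exists>b\<in>carrier R. b \<otimes> (a \<otimes> (t \<otimes> f)) \<ominus> t \<otimes> f \<in> B"
      using f(2)[OF b(2)] b(1) by auto
  qed
  then show thesis using that tc t(2) by blast
qed

lemma artinianD:
  assumes "left_artinian R" "\<And>n. left_ideal (C n) R" "\<And>n. C (Suc n) \<subseteq> C n"
  shows "\<exists>m. \<forall>n\<ge>m. C n = C m"
  using assms by (simp add: left_artinian_def)

lemma artinian_minimal:
  assumes art: "left_artinian R" and ne: "I0 \<in> \<F>" and li: "\<And>I. I \<in> \<F> \<Longrightarrow> left_ideal I R"
  obtains I where "I \<in> \<F>" "\<And>K. K \<in> \<F> \<Longrightarrow> K \<subseteq> I \<Longrightarrow> K = I"
proof (rule ccontr)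
  assume "\<not> thesis"
  then have "\<forall>I\<in>\<F>. \<exists>K. K \<in> \<F> \<and> K \<subset> I" using that by blast
  then obtain f where f: "\<And>I. I \<in> \<F> \<Longrightarrow> f I \<in> \<F> \<and> f I \<subset> I" by metis
  define C where "C = rec_nat I0 (\<lambda>_. f)"
  have C0: "C 0 = I0" and CS: "C (Suc n) = f (C n)" for n by (simp_all add: C_def)
  have CF: "C n \<in> \<F>" for n by (induction n) (use ne f in \<open>auto simp: C0 CS\<close>)
  have dec: "C (Suc n) \<subset> C n" for n using f[OF CF] by (simp add: CS)
  have "left_ideal (C n) R" "C (Suc n) \<subseteq> C n" for n using li[OF CF[of n]] dec[of n] by auto
  from artinianD[of C, OF art this] obtain m where m: "\<forall>n\<ge>m. C n = C m" by (rule exE)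
  have "C (Suc m) = C m" by (rule m[rule_format]) simp
  then show False using dec[of m] by simp
qed

lemma semilocal_of_artinian:
  assumes "left_artinian R" shows "semilocal R"
proof -
  let ?F = "{carrier R \<inter> \<Inter>(set Ms) | Ms. \<forall>M\<in>set Ms. maximal_left R M}"
  have "carrier R \<in> ?F" by (auto intro!: exI[of _ "[]"])
  then obtain I where I: "I \<in> ?F" "\<And>K. K \<in> ?F \<Longrightarrow> K \<subseteq> I \<Longrightarrow> K = I"
  proof (rule artinian_minimal[OF assms])
    show "left_ideal K R" if "K \<in> ?F" for K using that finite_maximal_intersection by blast
  qed blast
  then obtain Ms where Ms: "I = carrier R \<inter> \<Inter>(set Ms)" "\<forall>M\<in>set Ms. maximal_left R M" by blast
  have "I \<subseteq> M" if M: "maximal_left R M" for M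
  proof -
    have "I \<inter> M \<in> ?F" using Ms M by (auto intro!: exI[of _ "M # Ms"])
    then show ?thesis using I(2) by blast
  qed
  then show ?thesis using semilocal_of_finite[of Ms] Ms by (auto simp: jac_def)
qed

text \<open>
  A finitely generated semisimple module is artinian, so a chain with intersection \<open>B\<close> meets its
  preimage in \<open>B\<close> only from some point on. The induction on the generators replaces a composition length.
\<close>

lemma socle_chain:
  assumes B: "left_ideal B R" and C: "\<And>n. left_ideal (C n) R" "\<And>n. C (Suc n) \<subseteq> C n"
    and BC: "B = (\<Inter>n. C n)" and ys: "set ys \<subseteq> simple_mod R B"
  shows "\<exists>k. C k \<inter> lspan R B ys \<subseteq> B"
  using ys
proof (induction ys)
  case (Cons y ys)
  let ?A = "lspan R B ys"
  have ysc: "set ys \<subseteq> carrier R" and yc: "y \<in> carrier R" and ym: "y \<in> simple_mod R B"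
    using Cons.prems simple_modD(1) by auto
  have A: "left_ideal ?A R" "B \<subseteq> ?A" using lspan_ideal[OF B ysc] lspan_I(1)[OF B ysc] by auto
  obtain k where k: "C k \<inter> ?A \<subseteq> B" using Cons by auto
  show ?case
  proof (cases "C k \<inter> lspan R B (y # ys) \<subseteq> B")
    case False
    then obtain z0 where z0: "z0 \<in> C k" "z0 \<in> lsum R ?A y" "z0 \<notin> B" by auto
    then obtain k1 where k1: "z0 \<notin> C k1" unfolding BC by blast
    obtain a0 r0 where a0: "z0 = a0 \<oplus> r0 \<otimes> y" "a0 \<in> ?A" "r0 \<in> carrier R"
      using z0(2) by (auto simp: lsum_def)
    have "z \<in> B" if z: "z \<in> C (max k k1)" "z \<in> lsum R ?A y" for z
    proof (rule ccontr)
      assume zB: "z \<notin> B"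
      have zk: "z \<in> C k" "z \<in> C k1"
        using z(1) antimono_seq[of C, OF C(2), of k "max k k1"]
          antimono_seq[of C, OF C(2), of k1 "max k k1"] by auto
      obtain a r where a: "z = a \<oplus> r \<otimes> y" "a \<in> ?A" "r \<in> carrier R"
        using z(2) by (auto simp: lsum_def)
      have "z \<notin> ?A" using zB zk(1) k by blast
      then have "r \<otimes> y \<notin> ?A" using a left_idealD(3)[OF A(1)] by blast
      then have "r \<otimes> y \<notin> B" using A(2) by blast
      then obtain b where b: "b \<in> carrier R" "b \<otimes> (r \<otimes> y) \<ominus> y \<in> B" using simple_modD(2)[OF ym a(3)] by blast
      have ac: "a \<in> carrier R" "a0 \<in> carrier R" using left_idealD(1)[OF A(1)] a(2) a0(2) by auto
      have e: "z0 \<ominus> (r0 \<otimes> b) \<otimes> z = (a0 \<ominus> (r0 \<otimes> b) \<otimes> a) \<ominus> r0 \<otimes> (b \<otimes> (r \<otimes> y) \<ominus> y)"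
        unfolding a(1) a0(1) using ac a(3) a0(3) b(1) yc by algebra
      have "z0 \<ominus> (r0 \<otimes> b) \<otimes> z \<in> ?A"
        unfolding e
      proof (intro left_idealD(6)[OF A(1)])
        show "r0 \<otimes> (b \<otimes> (r \<otimes> y) \<ominus> y) \<in> ?A"
          using left_idealD(4)[OF A(1) a0(3)] b(2) A(2) by blast
      qed (use left_idealD(4)[OF A(1)] a0 b a in auto)
      moreover have "z0 \<ominus> (r0 \<otimes> b) \<otimes> z \<in> C k"
        using z0(1) zk(1) a0(3) b(1)
        by (intro left_idealD(6)[OF C(1)] left_idealD(4)[OF C(1)]) auto
      ultimately have "z0 \<ominus> (r0 \<otimes> b) \<otimes> z \<in> C k1" using k BC by blast
      then have "(z0 \<ominus> (r0 \<otimes> b) \<otimes> z) \<oplus> (r0 \<otimes> b) \<otimes> z \<in> C k1"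
        using zk(2) a0(3) b(1)
        by (intro left_idealD(3)[OF C(1)] left_idealD(4)[OF C(1)]) auto
      moreover have "(z0 \<ominus> (r0 \<otimes> b) \<otimes> z) \<oplus> (r0 \<otimes> b) \<otimes> z = z0"
      proof -
        have "z0 \<in> carrier R" "z \<in> carrier R" using left_idealD(1)[OF C(1)] z0(1) zk(1) by auto
        then show ?thesis using a0(3) b(1) by algebra
      qed
      ultimately show False using k1 by simp
    qed
    then show ?thesis by auto
  qed blast
qed auto

text \<open>
  Vamos' criterion: for a decreasing chain with intersection \<open>B\<close>, the finitely generated socle of
  \<open>R/B\<close> meets some member \<open>C\<^sub>k\<close> trivially, and being essential it forces \<open>C\<^sub>k = B\<close>.
\<close>

lemma artinian_of_socles:
  assumes fg: "finite_socles R" and sl: "semilocal R" and soc: "essential_socles R"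
  shows "left_artinian R"
  unfolding left_artinian_def
proof (intro allI impI, elim conjE)
  fix C :: "nat \<Rightarrow> 'a set"
  assume "\<forall>n. left_ideal (C n) R" "\<forall>n. C (Suc n) \<subseteq> C n"
  then have C: "\<And>n. left_ideal (C n) R" "\<And>n. C (Suc n) \<subseteq> C n" by auto
  define B where "B = (\<Inter>n. C n)"
  have B: "left_ideal B R" unfolding B_def using left_ideal_INT C(1) .
  obtain ys where ys: "set ys \<subseteq> simple_mod R B" "simple_mod R B \<subseteq> lspan R B ys"
    using fg B unfolding finite_socles_def by blast
  obtain k where k: "C k \<inter> lspan R B ys \<subseteq> B"
    using socle_chain[OF B C B_def ys(1)] by blast
  have "C k \<subseteq> B"
  proof (rule subsetI, rule ccontr)
    fix x assume x: "x \<in> C k" "x \<notin> B"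
    have xc: "x \<in> carrier R" using left_idealD(1)[OF C(1) x(1)] .
    then obtain a where a: "a \<in> carrier R" "a \<otimes> x \<notin> B" "\<forall>j\<in>jac R. j \<otimes> (a \<otimes> x) \<in> B"
      using soc B x(2) unfolding essential_socles_def by blast
    obtain t where t: "t \<in> carrier R" "t \<otimes> (a \<otimes> x) \<notin> B" "t \<otimes> (a \<otimes> x) \<in> simple_mod R B"
      using semilocal_simple_above[OF sl B B subset_refl, of "a \<otimes> x"] a xc by blast
    moreover have "t \<otimes> (a \<otimes> x) \<in> C k" using left_idealD(4)[OF C(1)] t(1) a(1) x(1) by blast
    ultimately show False using k ys(2) by blast
  qed
  then have "C n = C k" if "n \<ge> k" for n
    using antimono_seq[of C, OF C(2) that] B_def by blast
  then show "\<exists>m. \<forall>n\<ge>m. C n = C m" by blast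
qed

text \<open>
  Here \<open>R s\<close> is zero or a copy of \<open>R/M\<close>.
\<close>

lemma simple_mod_of_maximal_left:
  assumes M: "maximal_left R M" and s: "s \<in> carrier R" "\<And>x. x \<in> M \<Longrightarrow> x \<otimes> s = \<zero>"
  shows "x \<in> carrier R \<Longrightarrow> x \<notin> M \<Longrightarrow> \<exists>b\<in>carrier R. b \<otimes> (x \<otimes> s) = s"
    and "s \<in> simple_mod R {\<zero>}"
proof -
  show ret: "\<exists>b\<in>carrier R. b \<otimes> (x \<otimes> s) = s" if x: "x \<in> carrier R" "x \<notin> M" for x
  proof -
    obtain y where y: "y \<in> carrier R" "\<one> \<ominus> y \<otimes> x \<in> M" using maximal_leftD(3)[OF M x] by blast
    have "(\<one> \<ominus> y \<otimes> x) \<otimes> s = s \<ominus> y \<otimes> (x \<otimes> s)"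
      using s(1) x y(1) by (simp add: mult_one_minus m_assoc)
    then have "s \<ominus> y \<otimes> (x \<otimes> s) = \<zero>" using s(2)[OF y(2)] by simp
    then show ?thesis using s(1) x y(1) by (intro bexI[of _ y]) (simp_all add: r_right_minus_eq)
  qed
  show "s \<in> simple_mod R {\<zero>}"
  proof (rule simple_mod_I[OF s(1)])
    fix a assume a: "a \<in> carrier R" "a \<otimes> s \<notin> {\<zero>}"
    then have "a \<notin> M" using s(2) by blast
    then obtain b where "b \<in> carrier R" "b \<otimes> (a \<otimes> s) = s" using ret[OF a(1)] by blast
    then show "\<exists>b\<in>carrier R. b \<otimes> (a \<otimes> s) \<ominus> s \<in> {\<zero>}"
      using s(1) by (intro bexI[of _ b]) (simp_all add: r_right_minus_eq)
  qed
qed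

text \<open>
  By the right Kasch condition every maximal right ideal is \<open>r(s)\<close> with \<open>sR\<close> simple, so \<open>J\<close> is the
  intersection of all these \<open>r(s)\<close>. The elements \<open>s\<close> are also simple on the left, and finitely many of
  them span the same left ideal as all; the intersection over those few is already \<open>J\<close>.
\<close>

lemma semilocal_opp_of_socle:
  assumes fg: "finite_socles R" and rk: "elementwise_kasch (opp_ring R)"
    and mininj: "\<And>s. s \<in> simple_mod (opp_ring R) {\<zero>} \<Longrightarrow> s \<in> simple_mod R {\<zero>}"
  shows "semilocal (opp_ring R)"
proof -
  interpret op: ring "opp_ring R" by (rule opp)
  let ?Y = "simple_mod (opp_ring R) {\<zero>} - {\<zero>}"
  have Yc: "s \<in> ?Y \<Longrightarrow> s \<in> carrier R" for s using op.simple_modD(1) by auto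
  have Ymin: "\<exists>b\<in>carrier R. s \<otimes> a \<otimes> b = s" if "s \<in> ?Y" "a \<in> carrier R" "s \<otimes> a \<noteq> \<zero>" for s a
    using op.simple_modD(2)[of s "{\<zero>}" a] that Yc by auto
  obtain ys where ys: "set ys \<subseteq> ?Y" "?Y \<subseteq> lspan R {\<zero>} ys"
    using fg[unfolded finite_socles_def, rule_format, of "{\<zero>}" ?Y] left_ideal_zero mininj by blast
  show ?thesis
  proof (rule op.semilocal_of_finite[of "map (\<lambda>s. rann R {s}) ys"])
    fix M assume "M \<in> set (map (\<lambda>s. rann R {s}) ys)"
    then obtain s where s: "s \<in> ?Y" "M = rann R {s}" using ys(1) by auto
    note sc = Yc[OF s(1)]
    show "maximal_left (opp_ring R) M"
      unfolding maximal_left_def s(2)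
    proof (intro conjI ballI)
      show "right_ideal (rann R {s}) R" using right_ideal_rann[of "{s}"] sc by simp
      show "\<one>\<^bsub>opp_ring R\<^esub> \<notin> rann R {s}" using s(1) sc by (auto simp: mem_rann)
    next
      fix x assume x: "x \<in> carrier (opp_ring R) - rann R {s}"
      then have "x \<in> carrier R" "s \<otimes> x \<noteq> \<zero>" by (auto simp: mem_rann)
      then obtain b where b: "b \<in> carrier R" "s \<otimes> x \<otimes> b = s" using Ymin[OF s(1)] by blast
      have "s \<otimes> (\<one> \<ominus> x \<otimes> b) = s \<ominus> s \<otimes> x \<otimes> b" using sc b(1) \<open>x \<in> carrier R\<close> by (simp add: mult_one_minus m_assoc)
      then have "s \<otimes> (\<one> \<ominus> x \<otimes> b) = \<zero>" using b sc by (simp add: r_right_minus_eq)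
      then show "\<exists>y\<in>carrier (opp_ring R).
          \<one>\<^bsub>opp_ring R\<^esub> \<ominus>\<^bsub>opp_ring R\<^esub> y \<otimes>\<^bsub>opp_ring R\<^esub> x \<in> rann R {s}"
        using b(1) \<open>x \<in> carrier R\<close> by (intro bexI[of _ b]) (auto simp: mem_rann)
    qed
  next
    show "carrier (opp_ring R) \<inter> \<Inter>(set (map (\<lambda>s. rann R {s}) ys)) \<subseteq> jac (opp_ring R)"
    proof
      fix a assume "a \<in> carrier (opp_ring R) \<inter> \<Inter>(set (map (\<lambda>s. rann R {s}) ys))"
      then have ac: "a \<in> carrier R" and a: "\<And>s. s \<in> set ys \<Longrightarrow> s \<otimes> a = \<zero>" by (auto simp: mem_rann)
      have ysc: "set ys \<subseteq> carrier R" using ys(1) Yc by blast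
      have "lspan R {\<zero>} ys \<subseteq> lann R {a}"
        using ac a ysc left_ideal_lann[of "{a}"]
        by (intro lspan_least) (auto simp: mem_lann)
      then have kill: "s \<otimes> a = \<zero>" if "s \<in> ?Y" for s using ys(2) that by (auto simp: mem_lann)
      have "a \<in> F" if F: "maximal_left (opp_ring R) F" for F
      proof (rule ccontr)
        assume "a \<notin> F"
        obtain s where s: "s \<in> carrier R" "s \<noteq> \<zero>" "\<And>x. x \<in> F \<Longrightarrow> s \<otimes> x = \<zero>"
          using rk op.maximal_leftD(1,2)[OF F] unfolding elementwise_kasch_def by auto
        have so: "s \<in> carrier (opp_ring R)" "x \<in> F \<Longrightarrow> x \<otimes>\<^bsub>opp_ring R\<^esub> s = \<zero>\<^bsub>opp_ring R\<^esub>" for x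
          using s by simp_all
        have "s \<in> ?Y" using op.simple_mod_of_maximal_left(2)[OF F so] s(2) by simp
        then have "s \<otimes> a = \<zero>" by (rule kill)
        then show False using op.simple_mod_of_maximal_left(1)[OF F so _ \<open>a \<notin> F\<close>] ac s(1,2) by auto
      qed
      then show "a \<in> jac (opp_ring R)" using ac by (simp add: jac_def)
    qed
  qed
qed

end

section \<open>Artinian rings are noetherian\<close>

definition lfg :: "('a, 'r) ring_scheme \<Rightarrow> 'a set \<Rightarrow> bool"
  where "lfg R I \<longleftrightarrow> (\<exists>ys. set ys \<subseteq> I \<and> I = lspan R {\<zero>\<^bsub>R\<^esub>} ys)"

definition lhull :: "('a, 'r) ring_scheme \<Rightarrow> 'a set \<Rightarrow> 'a set"
  where "lhull R T = \<Inter>{I. left_ideal I R \<and> T \<subseteq> I}"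

text \<open>
  The ideals \<open>J\<^sup>n\<close>. Taking the hull in each step makes them ideals, while an element \<open>y\<close> is killed by
  \<open>J\<^sup>n\<^sup>+\<^sup>1\<close> from the left as soon as the products \<open>a j\<close> kill it.
\<close>

primrec jpow :: "('a, 'r) ring_scheme \<Rightarrow> nat \<Rightarrow> 'a set"
  where "jpow R 0 = carrier R"
  | "jpow R (Suc n) = lhull R {a \<otimes>\<^bsub>R\<^esub> j | a j. a \<in> jpow R n \<and> j \<in> jac R}"

context ring
begin

lemma lhull_least: "left_ideal I R \<Longrightarrow> T \<subseteq> I \<Longrightarrow> lhull R T \<subseteq> I"
  by (auto simp: lhull_def)

lemma lhull_incl: "T \<subseteq> lhull R T"
  by (auto simp: lhull_def)

lemma left_ideal_lhull:
  assumes "T \<subseteq> carrier R"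
  shows "left_ideal (lhull R T) R"
proof (rule left_ideal_iff[THEN iffD2], intro conjI ballI)
  show "lhull R T \<subseteq> carrier R" using lhull_least[OF left_ideal_carrier assms] .
qed (auto simp: lhull_def left_ideal_iff)

text \<open>
  If \<open>R x\<close> had no nonzero element modulo \<open>B\<close> that is killed by \<open>J\<close>, there would be \<open>j\<^sub>i \<in> J\<close> with
  \<open>p\<^sub>n = j\<^sub>n \<cdots> j\<^sub>1\<close> and \<open>p\<^sub>n x \<notin> B\<close> for all \<open>n\<close>. But the chain of the \<open>R p\<^sub>n\<close> stops, and \<open>p\<^sub>m = c j p\<^sub>m\<close> with
  \<open>j \<in> J\<close> implies \<open>p\<^sub>m = 0\<close>, because \<open>1 - c j\<close> is a unit.
\<close>

lemma essential_socles_of_artinian: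
  assumes art: "left_artinian R"
  shows "essential_socles R"
  unfolding essential_socles_def
proof (intro allI impI, elim conjE)
  fix B x assume B: "left_ideal B R" and x: "x \<in> carrier R - B"
  show "\<exists>a\<in>carrier R. a \<otimes> x \<notin> B \<and> (\<forall>j\<in>jac R. j \<otimes> (a \<otimes> x) \<in> B)"
  proof (rule ccontr)
    assume no: "\<not> (\<exists>a\<in>carrier R. a \<otimes> x \<notin> B \<and> (\<forall>j\<in>jac R. j \<otimes> (a \<otimes> x) \<in> B))"
    have ex: "\<exists>j. j \<in> jac R \<and> (j \<otimes> a) \<otimes> x \<notin> B" if "a \<in> carrier R" "a \<otimes> x \<notin> B" for a
    proof -
      obtain j where j: "j \<in> jac R" "j \<otimes> (a \<otimes> x) \<notin> B" using no \<open>a \<in> carrier R\<close> \<open>a \<otimes> x \<notin> B\<close> by blast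
      then show ?thesis using \<open>a \<in> carrier R\<close> jac_carrier[OF j(1)] x by (auto simp: m_assoc)
    qed
    then obtain f where f: "\<And>a. a \<in> carrier R \<Longrightarrow> a \<otimes> x \<notin> B \<Longrightarrow> f a \<in> jac R \<and> (f a \<otimes> a) \<otimes> x \<notin> B"
      by metis
    define p where "p = rec_nat \<one> (\<lambda>_ a. f a \<otimes> a)"
    have p0: "p 0 = \<one>" and pS: "p (Suc n) = f (p n) \<otimes> p n" for n by (simp_all add: p_def)
    have p: "p n \<in> carrier R \<and> p n \<otimes> x \<notin> B" for n
    proof (induction n)
      case (Suc n)
      then show ?case using f[of "p n"] jac_carrier[of "f (p n)"] by (simp add: pS)
    qed (use x in \<open>simp add: p0\<close>)
    define C where "C n = lsum R {\<zero>} (p n)" for n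
    have C: "left_ideal (C n) R" "p n \<in> C n" for n
      unfolding C_def using lsum_I(1,4)[OF left_ideal_zero] p by simp_all
    have "C (Suc n) \<subseteq> C n" for n
    proof -
      have "p (Suc n) \<in> C n"
        unfolding pS using f[of "p n"] p[of n] jac_carrier by (intro left_idealD(4)[OF C(1) _ C(2)]) blast
      then show ?thesis
        unfolding C_def[of "Suc n"] using left_idealD(2)[OF C(1)] by (intro lsum_least C(1)) auto
    qed
    from artinianD[of C, OF art C(1) this] obtain m where m: "\<forall>n\<ge>m. C n = C m" by (rule exE)
    have "p m \<in> C (Suc m)" using C(2)[of m] m[rule_format, of "Suc m"] by simp
    then obtain c where c: "c \<in> carrier R" "p m = \<zero> \<oplus> c \<otimes> p (Suc m)" by (auto simp: C_def lsum_def)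
    let ?j = "c \<otimes> f (p m)"
    have fj: "f (p m) \<in> jac R" using f p by blast
    then have j: "?j \<in> jac R" using left_idealD(4)[OF left_ideal_jac c(1)] by blast
    obtain d where d: "d \<in> carrier R" "d \<otimes> (\<one> \<ominus> ?j) = \<one>" using jac_one_minus[OF j] by metis
    have pc: "p m \<in> carrier R" "p m \<otimes> x \<notin> B" "f (p m) \<in> carrier R" using p jac_carrier[OF fj] by auto
    have pe: "p m = ?j \<otimes> p m" using c pc by (simp add: pS m_assoc)
    have "(\<one> \<ominus> ?j) \<otimes> p m = p m \<ominus> ?j \<otimes> p m" using c(1) pc by (simp add: mult_one_minus)
    also have "\<dots> = \<zero>" using pe pc by (simp add: r_right_minus_eq)
    finally have "d \<otimes> ((\<one> \<ominus> ?j) \<otimes> p m) = \<zero>" using d by simp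
    then have "p m = \<zero>" using d pc c(1) by (simp flip: m_assoc)
    then show False using pc x left_idealD(2)[OF B] by simp
  qed
qed

lemma jpow_props:
  shows "left_ideal (jpow R n) R" "right_ideal (jpow R n) R"
proof -
  have "left_ideal (jpow R n) R \<and> right_ideal (jpow R n) R"
  proof (induction n)
    case 0
    then show ?case by (simp add: left_ideal_iff right_ideal_iff)
  next
    case (Suc n)
    let ?T = "{a \<otimes> j | a j. a \<in> jpow R n \<and> j \<in> jac R}"
    have nc: "a \<in> jpow R n \<Longrightarrow> a \<in> carrier R" for a using Suc left_idealD(1) by blast
    have Tc: "?T \<subseteq> carrier R" using nc jac_carrier by auto
    have L: "left_ideal (lhull R ?T) R" using left_ideal_lhull[OF Tc] .
    have "x \<otimes> r \<in> lhull R ?T" if x: "x \<in> lhull R ?T" and r: "r \<in> carrier R" for x r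
    proof -
      let ?K = "{z \<in> carrier R. z \<otimes> r \<in> lhull R ?T}"
      have "?T \<subseteq> ?K"
      proof
        fix t assume "t \<in> ?T"
        then obtain a j where t: "t = a \<otimes> j" "a \<in> jpow R n" "j \<in> jac R" by blast
        have "a \<otimes> (j \<otimes> r) \<in> ?T" using t r right_idealD(4)[OF right_ideal_jac] by blast
        then have "t \<otimes> r \<in> lhull R ?T"
          using lhull_incl[of ?T] t nc jac_carrier r by (auto simp: m_assoc)
        then show "t \<in> ?K" using t nc jac_carrier by simp
      qed
      then have "lhull R ?T \<subseteq> ?K" using lhull_least[OF left_ideal_quot[OF L r]] by blast
      then show ?thesis using x by blast
    qed
    then have "right_ideal (lhull R ?T) R"
      using L by (simp add: left_ideal_iff right_ideal_iff)
    then show ?case using L by simp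
  qed
  then show "left_ideal (jpow R n) R" "right_ideal (jpow R n) R" by auto
qed

lemma jpow_step: "a \<in> jpow R n \<Longrightarrow> j \<in> jac R \<Longrightarrow> a \<otimes> j \<in> jpow R (Suc n)"
  using lhull_incl[of "{a \<otimes> j | a j. a \<in> jpow R n \<and> j \<in> jac R}"] by auto

lemma jpow_decreasing: "jpow R (Suc n) \<subseteq> jpow R n"
proof -
  have "{a \<otimes> j | a j. a \<in> jpow R n \<and> j \<in> jac R} \<subseteq> jpow R n"
    using right_idealD(4)[OF jpow_props(2)[of n]] jac_carrier by (simp add: subset_iff) metis
  then show ?thesis using lhull_least[OF jpow_props(1)[of n]] by simp
qed

text \<open>
  Let \<open>J\<^sup>m = J\<^sup>m\<^sup>+\<^sup>1\<close>. If \<open>r(J\<^sup>m) \<noteq> R\<close>, there is \<open>y \<notin> r(J\<^sup>m)\<close> with \<open>J y \<subseteq> r(J\<^sup>m)\<close>; then \<open>J\<^sup>m\<^sup>+\<^sup>1 y = 0\<close>, so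
  \<open>J\<^sup>m y = 0\<close>, a contradiction.
\<close>

lemma jac_nilpotent:
  assumes art: "left_artinian R"
  obtains m where "jpow R m = {\<zero>}"
proof -
  from artinianD[of "jpow R", OF art jpow_props(1) jpow_decreasing]
  obtain m where m: "\<forall>n\<ge>m. jpow R n = jpow R m" by (rule exE)
  have eq: "jpow R (Suc m) = jpow R m" by (rule m[rule_format]) simp
  have Jc: "jpow R m \<subseteq> carrier R" using jpow_props(1)[of m] left_idealD(1) by blast
  have A: "left_ideal (rann R (jpow R m)) R"
    using ring.right_ideal_lann[OF opp, of "jpow R m"] jpow_props(2) by simp
  have "\<one> \<in> rann R (jpow R m)"
  proof (rule ccontr)
    assume "\<one> \<notin> rann R (jpow R m)"
    then obtain a where a: "a \<in> carrier R" "a \<otimes> \<one> \<notin> rann R (jpow R m)"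
      "\<And>j. j \<in> jac R \<Longrightarrow> j \<otimes> (a \<otimes> \<one>) \<in> rann R (jpow R m)"
      using essential_socles_of_artinian[OF art] A unfolding essential_socles_def by blast
    have "{b \<otimes> j | b j. b \<in> jpow R m \<and> j \<in> jac R} \<subseteq> lann R {a}"
      using a jac_carrier Jc by (auto simp: mem_rann mem_lann m_assoc)
    then have "jpow R (Suc m) \<subseteq> lann R {a}"
      using lhull_least left_ideal_lann[of "{a}"] a(1) by simp
    then show False using a(1,2) unfolding eq by (auto simp: mem_rann mem_lann)
  qed
  then have "jpow R m \<subseteq> {\<zero>}" using Jc by (force simp: mem_rann)
  then show thesis using that left_idealD(2)[OF jpow_props(1), of m] by blast
qed

text \<open>
  Hopkins and Levitzki. The ideals \<open>r(J\<^sup>k)\<close> fill up \<open>R\<close> in finitely many steps, and for a left ideal \<open>F\<close>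
  inside \<open>r(J\<^sup>k\<^sup>+\<^sup>1)\<close> the quotient by \<open>F \<inter> r(J\<^sup>k)\<close> is killed by \<open>J\<close>, hence semisimple, hence finitely
  generated.
\<close>

lemma lfg_of_artinian:
  assumes art: "left_artinian R" and I: "left_ideal I R"
  shows "lfg R I"
proof -
  obtain m where m: "jpow R m = {\<zero>}" using jac_nilpotent[OF art] .
  have jc: "jpow R k \<subseteq> carrier R" for k using jpow_props(1) left_idealD(1) by blast
  have *: "lfg R F" if "left_ideal F R" "F \<subseteq> rann R (jpow R k)" for F k
    using that
  proof (induction k arbitrary: F)
    case 0
    have "x = \<zero>" if x: "x \<in> F" for x
    proof -
      have "x \<in> carrier R" "\<one> \<otimes> x = \<zero>" using subsetD[OF 0(2) x] by (auto simp: mem_rann)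
      then show ?thesis by simp
    qed
    then have "F \<subseteq> {\<zero>}" by blast
    then have "F = {\<zero>}" using left_idealD(2)[OF 0(1)] by blast
    then show ?case unfolding lfg_def by (intro exI[of _ "[]"]) simp
  next
    case (Suc k)
    let ?U = "rann R (jpow R k)"
    have U: "left_ideal ?U R"
      using ring.right_ideal_lann[OF opp, of "jpow R k"] jpow_props(2) by simp
    let ?B = "F \<inter> ?U"
    have B: "left_ideal ?B R" using left_ideal_Int[OF Suc.prems(1) U] .
    obtain zs where zs: "set zs \<subseteq> ?B" "?B = lspan R {\<zero>} zs"
      using Suc.IH[OF B] unfolding lfg_def by blast
    obtain ys where ys: "set ys \<subseteq> F \<inter> simple_mod R ?B" "F \<inter> simple_mod R ?B \<subseteq> lspan R ?B ys"
      using finite_socles_of_artinian[OF art, unfolded finite_socles_def, rule_format, of ?B "F \<inter> simple_mod R ?B"] B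
      by (elim meta_impE exE conjE) auto
    have ysc: "set ys \<subseteq> carrier R" using ys(1) simple_modD(1) by blast
    have A: "left_ideal (lspan R ?B ys) R" "?B \<subseteq> lspan R ?B ys"
      using lspan_ideal[OF B ysc] lspan_I(1)[OF B ysc] by auto
    have "F \<subseteq> lspan R ?B ys"
    proof (rule subsetI, rule ccontr)
      fix f assume f: "f \<in> F" "f \<notin> lspan R ?B ys"
      have fc: "f \<in> carrier R" using left_idealD(1)[OF Suc.prems(1) f(1)] .
      have "j \<otimes> f \<in> ?B" if j: "j \<in> jac R" for j
      proof
        show "j \<otimes> f \<in> F" using left_idealD(4)[OF Suc.prems(1) jac_carrier[OF j] f(1)] .
        have "a \<otimes> (j \<otimes> f) = \<zero>" if a: "a \<in> jpow R k" for a
        proof -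
          have "(a \<otimes> j) \<otimes> f = \<zero>" using jpow_step[OF a j] Suc.prems(2) f(1) by (auto simp: mem_rann)
          moreover have "a \<in> carrier R" using a jc by blast
          ultimately show ?thesis using jac_carrier[OF j] fc by (simp add: m_assoc)
        qed
        then show "j \<otimes> f \<in> ?U" using jac_carrier[OF j] fc by (simp add: mem_rann)
      qed
      then obtain t where t: "t \<in> carrier R" "t \<otimes> f \<notin> lspan R ?B ys" "t \<otimes> f \<in> simple_mod R ?B"
        using semilocal_simple_above[OF semilocal_of_artinian[OF art] B A fc _ f(2)] by blast
      moreover have "t \<otimes> f \<in> F" using left_idealD(4)[OF Suc.prems(1) t(1) f(1)] .
      ultimately show False using ys(2) by blast
    qed
    moreover have "lspan R ?B ys \<subseteq> F"
      using ys(1) by (intro lspan_least Suc.prems(1)) auto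
    ultimately have "F = lspan R ?B ys" by blast
    also have "\<dots> = lspan R {\<zero>} (ys @ zs)" unfolding lspan_append zs(2)[symmetric] ..
    finally show ?case
      unfolding lfg_def using ys(1) zs(1) by (intro exI[of _ "ys @ zs"]) auto
  qed
  have "I \<subseteq> rann R (jpow R m)" using left_idealD(1)[OF I] by (auto simp: m mem_rann)
  then show ?thesis using * I by blast
qed

lemma acc_of_lfg:
  assumes fg: "\<And>I. left_ideal I R \<Longrightarrow> lfg R I"
    and A: "\<And>n. left_ideal (A n) R" "\<And>n. A n \<subseteq> A (Suc n)"
  shows "\<exists>m. \<forall>n\<ge>m. A n = A m"
proof -
  obtain ys where ys: "set ys \<subseteq> (\<Union>n. A n)" "(\<Union>n. A n) = lspan R {\<zero>} ys"
    using fg[OF left_ideal_UN[of A, OF A]] unfolding lfg_def by blast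
  have "\<exists>m. set zs \<subseteq> A m" if "set zs \<subseteq> (\<Union>n. A n)" for zs
    using that
  proof (induction zs)
    case (Cons z zs)
    then obtain m k where mk: "set zs \<subseteq> A m" "z \<in> A k" by auto
    then have "set (z # zs) \<subseteq> A (max m k)"
      using mono_seq[of A, OF A(2), of m "max m k"] mono_seq[of A, OF A(2), of k "max m k"] by auto
    then show ?case ..
  qed simp
  then obtain m where m: "set ys \<subseteq> A m" using ys(1) by blast
  have "(\<Union>n. A n) \<subseteq> A m"
    unfolding ys(2) using left_idealD(2)[OF A(1)] m by (intro lspan_least A(1)) auto
  then have "A n = A m" if "n \<ge> m" for n
    using mono_seq[of A, OF A(2) that] by blast
  then show ?thesis by blast
qed

text \<open>
  If \<open>b\<close> is killed by \<open>l(a)\<close>, then \<open>x a \<mapsto> x b\<close> is well defined on \<open>R a\<close>.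
\<close>

lemma rann_principal:
  assumes lb: "left_baer R" and a: "a \<in> carrier R" and b: "b \<in> rann R (lann R {a})"
  shows "\<exists>c\<in>carrier R. b = a \<otimes> c"
proof -
  have bc: "b \<in> carrier R" using b by (simp add: mem_rann)
  have "\<exists>c\<in>carrier R. (\<forall>h\<in>{\<zero>}. h \<otimes> c = \<zero>) \<and> (\<forall>z\<in>carrier R. z \<otimes> a \<otimes> c = z \<otimes> b)"
    using a b bc by (intro left_baer_two_term lb left_ideal_zero left_ideal_carrier)
      (auto simp: mem_rann mem_lann)
  then obtain c where "c \<in> carrier R" "\<one> \<otimes> a \<otimes> c = \<one> \<otimes> b" by blast
  then show ?thesis using a bc by auto
qed

text \<open>
  The map \<open>I + K \<rightarrow> R\<close> that kills \<open>I\<close> and is right multiplication by \<open>b\<close> on \<open>K\<close> is well defined and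
  given by some \<open>c\<close>; then \<open>b - c\<close> kills \<open>K\<close>.
\<close>

lemma rann_Int:
  assumes lb: "left_baer R" and I: "left_ideal I R" "left_ideal K R" and b: "b \<in> rann R (I \<inter> K)"
  obtains c d where "c \<in> rann R I" "d \<in> rann R K" "b = c \<oplus> d"
proof -
  have bc: "b \<in> carrier R" using b by (simp add: mem_rann)
  note ID = left_idealD[OF I(1)] and KD = left_idealD[OF I(2)]
  have "z \<otimes> b = \<zero>" if "h \<in> I" "z \<in> K" "h \<oplus> z \<otimes> \<one> = \<zero>" for h z
  proof -
    have "z = \<ominus> h" using that ID(1)[of h] KD(1)[of z] by (metis a_comm minus_equality r_one)
    then have "z \<in> I \<inter> K" using that ID(5) by simp
    then show ?thesis using b by (simp add: mem_rann)
  qed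
  then have "\<exists>c\<in>carrier R. (\<forall>h\<in>I. h \<otimes> c = \<zero>) \<and> (\<forall>z\<in>K. z \<otimes> \<one> \<otimes> c = z \<otimes> b)"
    using bc by (intro left_baer_two_term lb I) simp_all
  then obtain c where c: "c \<in> carrier R" "\<forall>h\<in>I. h \<otimes> c = \<zero>" "\<forall>z\<in>K. z \<otimes> \<one> \<otimes> c = z \<otimes> b" by blast
  then have cI: "c \<in> rann R I" by (simp add: mem_rann)
  have "y \<otimes> (b \<ominus> c) = \<zero>" if "y \<in> K" for y
  proof -
    have yc: "y \<in> carrier R" using KD(1) that .
    have "y \<otimes> b = y \<otimes> c" using bspec[OF c(3) that] yc by simp
    moreover have "y \<otimes> (b \<ominus> c) = y \<otimes> b \<ominus> y \<otimes> c" using yc bc c(1) by algebra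
    ultimately show ?thesis using yc bc c(1) by (simp add: r_right_minus_eq)
  qed
  then have "b \<ominus> c \<in> rann R K" using bc c(1) by (simp add: mem_rann)
  moreover have "b = c \<oplus> (b \<ominus> c)" using bc c(1) by algebra
  ultimately show thesis using that cI by blast
qed

text \<open>
  From \<open>l(F + yR) = l(F) \<inter> l(y)\<close> the two preceding lemmas compute \<open>r(l(F + yR)) = r(l(F)) + yR\<close>.
\<close>

lemma rann_lann_lsum:
  assumes lb: "left_baer R" and F: "right_ideal F R" "rann R (lann R F) = F" and y: "y \<in> carrier R"
  shows "rann R (lann R (lsum (opp_ring R) F y)) = lsum (opp_ring R) F y"
proof
  interpret op: ring "opp_ring R" by (rule opp)
  let ?S = "lsum (opp_ring R) F y"
  have yo: "y \<in> carrier (opp_ring R)" using y by simp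
  note S = op.lsum_I[OF F(1) yo]
  note FD = right_idealD[OF F(1)]
  have Fc: "F \<subseteq> carrier R" using FD(1) by blast
  show "?S \<subseteq> rann R (lann R ?S)"
    using right_idealD(1)[OF S(1)] by (auto simp: mem_rann mem_lann)
  show "rann R (lann R ?S) \<subseteq> ?S"
  proof
    fix b assume b: "b \<in> rann R (lann R ?S)"
    have "lann R F \<inter> lann R {y} \<subseteq> lann R ?S"
    proof
      fix a assume a: "a \<in> lann R F \<inter> lann R {y}"
      have "a \<otimes> (x \<oplus> y \<otimes> r) = \<zero>" if "x \<in> F" "r \<in> carrier R" for x r
        using a that FD(1)[OF that(1)] y by (simp add: mem_lann r_distr flip: m_assoc)
      then show "a \<in> lann R ?S" using a by (auto simp: mem_lann lsum_def)
    qed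
    then have b': "b \<in> rann R (lann R F \<inter> lann R {y})" using b by (auto simp: mem_rann)
    have "left_ideal (lann R {y}) R" using y by (intro left_ideal_lann) simp
    then obtain c d where cd: "c \<in> rann R (lann R F)" "d \<in> rann R (lann R {y})" "b = c \<oplus> d"
      using rann_Int[OF lb left_ideal_lann[OF Fc] _ b'] by metis
    then obtain e where "e \<in> carrier R" "d = y \<otimes> e" using rann_principal[OF lb y] by blast
    then show "b \<in> ?S" using cd F(2) by (auto simp: lsum_def)
  qed
qed

lemma rann_lann_fg:
  assumes lb: "left_baer R" and ys: "set ys \<subseteq> carrier R"
  shows "rann R (lann R (lspan (opp_ring R) {\<zero>} ys)) = lspan (opp_ring R) {\<zero>} ys"
  using ys
proof (induction ys)
  case Nil
  have "b = \<zero>" if b: "b \<in> rann R (lann R {\<zero>})" for b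
  proof -
    have "\<one> \<in> lann R {\<zero>}" by (simp add: mem_lann)
    then have "b \<in> carrier R" "\<one> \<otimes> b = \<zero>" using b by (auto simp: mem_rann)
    then show ?thesis by simp
  qed
  moreover have "\<zero> \<in> rann R (lann R {\<zero>})" by (simp add: mem_rann mem_lann)
  ultimately show ?case by auto
next
  interpret op: ring "opp_ring R" by (rule opp)
  case (Cons y ys)
  have "right_ideal (lspan (opp_ring R) {\<zero>} ys) R"
    using op.lspan_ideal[OF op.left_ideal_zero] Cons.prems by simp
  then show ?case using rann_lann_lsum[OF lb] Cons by simp
qed

text \<open>
  The left singular ideal of a left self-injective ring is contained in the radical: \<open>l(1 - a b)\<close> meets
  the essential left ideal \<open>l(a)\<close> in \<open>0\<close>, so it vanishes, and \<open>1 - a b\<close> has a right inverse by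
  \<open>rann_principal\<close>.
\<close>

lemma jac_of_essential_annihilator:
  assumes lb: "left_baer R" and a: "a \<in> carrier R"
    and ess: "\<And>x. x \<in> carrier R \<Longrightarrow> x \<noteq> \<zero> \<Longrightarrow> \<exists>r\<in>carrier R. r \<otimes> x \<noteq> \<zero> \<and> (r \<otimes> x) \<otimes> a = \<zero>"
  shows "a \<in> jac R"
proof -
  interpret op: ring "opp_ring R" by (rule opp)
  have "a \<in> F" if F: "maximal_left (opp_ring R) F" for F
  proof (rule ccontr)
    assume "a \<notin> F"
    then obtain b where b: "b \<in> carrier R" "\<one> \<ominus> a \<otimes> b \<in> F" using op.maximal_leftD(3)[OF F] a by auto
    let ?u = "\<one> \<ominus> a \<otimes> b"
    have uc: "?u \<in> carrier R" using a b by simp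
    have "x = \<zero>" if x: "x \<in> carrier R" "x \<otimes> ?u = \<zero>" for x
    proof (rule ccontr)
      assume "x \<noteq> \<zero>"
      then obtain r where r: "r \<in> carrier R" "r \<otimes> x \<noteq> \<zero>" "(r \<otimes> x) \<otimes> a = \<zero>" using ess x(1) by blast
      have "x \<otimes> ?u = x \<ominus> x \<otimes> (a \<otimes> b)" using x(1) a b(1) by (simp add: mult_one_minus)
      then have "x = x \<otimes> (a \<otimes> b)" using x a b(1) by (metis m_closed r_right_minus_eq)
      then have "r \<otimes> x = r \<otimes> (x \<otimes> (a \<otimes> b))" by simp
      also have "\<dots> = ((r \<otimes> x) \<otimes> a) \<otimes> b" using r(1) x(1) a b(1) by (simp add: m_assoc)
      finally show False using r b(1) by simp
    qed
    then have "\<one> \<in> rann R (lann R {?u})" by (simp add: mem_rann mem_lann)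
    then obtain c where "c \<in> carrier R" "\<one> = ?u \<otimes> c" using rann_principal[OF lb uc] by blast
    then have "\<one> \<in> F" using right_idealD(4)[OF op.maximal_leftD(1)[OF F] _ b(2)] by metis
    then show False using op.maximal_leftD(2)[OF F] by simp
  qed
  then have "a \<in> jac (opp_ring R)" using a by (simp add: jac_def)
  then show ?thesis by simp
qed

text \<open>
  \<open>F \<mapsto> l(F)\<close> is injective on finitely generated right ideals, so the descending chain condition on left
  ideals becomes an ascending one for them.
\<close>

lemma right_lfg_of_left_artinian:
  assumes lb: "left_baer R" and art: "left_artinian R" and F: "right_ideal F R"
  shows "lfg (opp_ring R) F"
proof (rule ccontr)
  interpret op: ring "opp_ring R" by (rule opp)
  assume no: "\<not> lfg (opp_ring R) F"
  have Fc: "F \<subseteq> carrier (opp_ring R)" using right_idealD(1)[OF F] by auto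
  have "\<not> F \<subseteq> lspan (opp_ring R) {\<zero>\<^bsub>opp_ring R\<^esub>} ys" if ys: "set ys \<subseteq> F" for ys
  proof
    assume "F \<subseteq> lspan (opp_ring R) {\<zero>\<^bsub>opp_ring R\<^esub>} ys"
    moreover have "lspan (opp_ring R) {\<zero>\<^bsub>opp_ring R\<^esub>} ys \<subseteq> F"
      using right_idealD(2)[OF F] ys by (intro op.lspan_least F) auto
    ultimately show False using no ys unfolding lfg_def by blast
  qed
  then obtain A x where A: "A 0 = {\<zero>}" "\<And>n. A (Suc n) = lsum (opp_ring R) (A n) (x n)"
    "\<And>n. right_ideal (A n) R" "\<And>n. x n \<in> F" "\<And>n. x n \<notin> A n"
    using op.fg_or_sequence[OF op.left_ideal_zero Fc] by (metis opp_ring_simps(4))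
  have xc: "x n \<in> carrier (opp_ring R)" for n using A(4) Fc by blast
  have xo: "x n \<in> carrier R" for n using xc by simp
  have rl: "rann R (lann R (A n)) = A n" for n
  proof (induction n)
    case 0
    then show ?case using rann_lann_fg[OF lb, of "[]"] by (simp add: A(1))
  next
    case (Suc n)
    then show ?case using rann_lann_lsum[OF lb A(3) _ xo] by (simp add: A(2))
  qed
  have Ac: "A n \<subseteq> carrier R" for n using right_idealD(1)[OF A(3)] by blast
  have Asuc: "A n \<subseteq> A (Suc n)" "x n \<in> A (Suc n)" for n
    unfolding A(2) using op.lsum_I(2,4)[OF A(3) xc] by auto
  have "lann R (A (Suc n)) \<subseteq> lann R (A n)" for n by (rule lann_antimono[OF Asuc(1)])
  from artinianD[of "\<lambda>n. lann R (A n)", OF art left_ideal_lann[OF Ac] this]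
  obtain m where m: "\<forall>n\<ge>m. lann R (A n) = lann R (A m)" by (rule exE)
  have "lann R (A (Suc m)) = lann R (A m)" by (rule m[rule_format]) simp
  then have "A (Suc m) = A m" using rl by metis
  then show False using Asuc(2) A(5) by metis
qed

lemma right_artinian_of_left:
  assumes lb: "left_baer R" and art: "left_artinian R"
  shows "left_artinian (opp_ring R)"
  unfolding left_artinian_def
proof (intro allI impI, elim conjE)
  interpret op: ring "opp_ring R" by (rule opp)
  fix C :: "nat \<Rightarrow> 'a set"
  assume "\<forall>n. right_ideal (C n) R" "\<forall>n. C (Suc n) \<subseteq> C n"
  then have C: "\<And>n. right_ideal (C n) R" "\<And>n. C (Suc n) \<subseteq> C n" by auto
  have rl: "rann R (lann R (C n)) = C n" for n
  proof -
    obtain ys where ys: "set ys \<subseteq> C n" "C n = lspan (opp_ring R) {\<zero>} ys"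
      using right_lfg_of_left_artinian[OF lb art C(1)[of n]] unfolding lfg_def by auto
    have "set ys \<subseteq> carrier R" using ys(1) right_idealD(1)[OF C(1)] by blast
    then show ?thesis using rann_lann_fg[OF lb, of ys] ys(2) by simp
  qed
  have Cc: "C n \<subseteq> carrier R" for n using right_idealD(1)[OF C(1)] by blast
  have "lann R (C n) \<subseteq> lann R (C (Suc n))" for n by (rule lann_antimono[OF C(2)])
  from acc_of_lfg[of "\<lambda>n. lann R (C n)", OF lfg_of_artinian[OF art] left_ideal_lann[OF Cc] this]
  obtain m where m: "\<forall>n\<ge>m. lann R (C n) = lann R (C m)" by (rule exE)
  then have "\<forall>n\<ge>m. C n = C m" using rl by metis
  then show "\<exists>m. \<forall>n\<ge>m. C n = C m" by blast
qed

end

section \<open>One-sided quasi-Frobenius conditions are two-sided\<close>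

text \<open>
  Symmetric under passage to the opposite ring, so that it suffices to derive it from conditions in
  which the self-injectivity is on the left.
\<close>

definition two_sided_qf :: "('a, 'r) ring_scheme \<Rightarrow> bool"
  where "two_sided_qf R \<longleftrightarrow> left_baer R \<and> left_baer (opp_ring R) \<and> elementwise_kasch R \<and> elementwise_kasch (opp_ring R) \<and>
    left_artinian R \<and> left_artinian (opp_ring R)"

lemma two_sided_qf_opp [simp]: "two_sided_qf (opp_ring R) \<longleftrightarrow> two_sided_qf R"
  by (auto simp: two_sided_qf_def)

context ring
begin

lemma left_ideal_rann: "right_ideal T R \<Longrightarrow> left_ideal (rann R T) R"
  using ring.right_ideal_lann[OF opp] by simp

text \<open>
  A left ideal \<open>H\<close> that is minimal with \<open>H + R a = R\<close> satisfies \<open>H \<inter> R a \<subseteq> J\<close>, since it could be cut down by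
  a maximal left ideal missing an element of \<open>H \<inter> R a\<close>. If \<open>1 = h + c a\<close> with \<open>h \<in> H\<close>, then
  \<open>a h = a - a c a\<close> is in \<open>H \<inter> R a\<close>.
\<close>

lemma regular_mod_jac:
  assumes art: "left_artinian R" and a: "a \<in> carrier R"
  obtains c where "c \<in> carrier R" "a \<ominus> a \<otimes> c \<otimes> a \<in> jac R"
proof -
  let ?F = "{H. left_ideal H R \<and> (\<exists>h\<in>H. \<exists>c\<in>carrier R. \<one> = h \<oplus> c \<otimes> a)}"
  have "carrier R \<in> ?F"
  proof -
    have "\<one> = \<one> \<oplus> \<zero> \<otimes> a" using a by simp
    then show ?thesis using left_ideal_carrier by blast
  qed
  then obtain H where H: "H \<in> ?F" "\<And>K. K \<in> ?F \<Longrightarrow> K \<subseteq> H \<Longrightarrow> K = H"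
    by (rule artinian_minimal[OF art]) auto
  then obtain h c where Hl: "left_ideal H R" and hc: "h \<in> H" "c \<in> carrier R" "\<one> = h \<oplus> c \<otimes> a" by auto
  note HD = left_idealD[OF Hl]
  have hcc: "h \<in> carrier R" using HD(1) hc(1) .
  have small: "y \<in> M" if y: "y \<in> H" "y = d \<otimes> a" "d \<in> carrier R" and M: "maximal_left R M" for y d M
  proof (rule ccontr)
    assume yM: "y \<notin> M"
    note MD = left_idealD[OF maximal_leftD(1)[OF M]]
    have yc: "y \<in> carrier R" using HD(1) y(1) .
    have "\<exists>k\<in>H \<inter> M. \<exists>e\<in>carrier R. \<one> = k \<oplus> e \<otimes> a"
    proof -
      obtain z where z: "z \<in> carrier R" "\<one> \<ominus> z \<otimes> y \<in> M" using maximal_leftD(3)[OF M yc yM] by blast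
      let ?k = "h \<ominus> (h \<otimes> z) \<otimes> y"
      have "?k = h \<otimes> (\<one> \<ominus> z \<otimes> y)" using hcc z(1) yc by (simp add: mult_one_minus m_assoc)
      then have "?k \<in> M" using MD(4)[OF hcc z(2)] by simp
      moreover have "?k \<in> H" using HD(6)[OF hc(1)] HD(4)[OF _ y(1), of "h \<otimes> z"] hcc z(1) by simp
      moreover have "\<one> = ?k \<oplus> (c \<oplus> (h \<otimes> z) \<otimes> d) \<otimes> a"
      proof -
        have "?k \<oplus> (c \<oplus> (h \<otimes> z) \<otimes> d) \<otimes> a = h \<oplus> c \<otimes> a"
          unfolding y(2) using hcc z(1) y(3) hc(2) a by algebra
        then show ?thesis using hc(3) by simp
      qed
      moreover have "c \<oplus> (h \<otimes> z) \<otimes> d \<in> carrier R" using hcc z(1) y(3) hc(2) by simp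
      ultimately show ?thesis by blast
    qed
    then have "H \<inter> M \<in> ?F" using left_ideal_Int[OF Hl maximal_leftD(1)[OF M]] by simp
    then have "H \<inter> M = H" by (rule H(2)) blast
    then show False using y(1) yM by blast
  qed
  have "a \<otimes> h = a \<ominus> a \<otimes> c \<otimes> a"
  proof -
    have "a = a \<otimes> (h \<oplus> c \<otimes> a)" unfolding hc(3)[symmetric] using a by simp
    then have "a = a \<otimes> h \<oplus> a \<otimes> c \<otimes> a" using a hcc hc(2) by (simp add: r_distr m_assoc)
    moreover have "(a \<otimes> h \<oplus> a \<otimes> c \<otimes> a) \<ominus> a \<otimes> c \<otimes> a = a \<otimes> h" using a hcc hc(2) by algebra
    ultimately show ?thesis by simp
  qed
  moreover have "a \<otimes> h \<in> H" using HD(4)[OF a hc(1)] .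
  moreover have "a \<ominus> a \<otimes> c \<otimes> a = (\<one> \<ominus> a \<otimes> c) \<otimes> a" using a hc(2) by (simp add: mult_one_minus)
  ultimately have "a \<ominus> a \<otimes> c \<otimes> a \<in> M" if "maximal_left R M" for M
    using small[of "a \<ominus> a \<otimes> c \<otimes> a" "\<one> \<ominus> a \<otimes> c"] that a hc(2) by simp
  then show thesis using that[OF hc(2)] a hc(2) by (simp add: jac_def)
qed

text \<open>
  \<open>R/J\<close> is semisimple on the right and hence on the left: \<open>M\<close> is generated modulo \<open>J\<close> by an idempotent
  \<open>e\<close>, and \<open>t = 1 - e\<close>. As only right ideals are known to satisfy a chain condition, the element \<open>g\<close> that
  yields \<open>e\<close> is chosen in \<open>M\<close> with minimal right annihilator modulo \<open>J\<close>. An \<open>m \<in> M\<close> with \<open>m t \<notin> J\<close> would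
  allow a smaller one.
\<close>

lemma maximal_left_annihilated_mod_jac:
  assumes art: "left_artinian (opp_ring R)" and M: "maximal_left R M"
  obtains t where "t \<in> carrier R" "t \<notin> M" "\<And>m. m \<in> M \<Longrightarrow> m \<otimes> t \<in> jac R"
proof -
  interpret op: ring "opp_ring R" by (rule opp)
  note MD = left_idealD[OF maximal_leftD(1)[OF M]]
  note JL = left_idealD[OF left_ideal_jac] and JR = right_idealD[OF right_ideal_jac]
  define D where "D g = {x \<in> carrier R. g \<otimes> x \<in> jac R}" for g
  have Dr: "right_ideal (D g) R" if "g \<in> carrier R" for g
    using op.left_ideal_quot[of "jac R" g] right_ideal_jac that by (simp add: D_def)
  have "D \<zero> \<in> D ` M" using MD(2) by blast
  then obtain I where I: "I \<in> D ` M" "\<And>K. K \<in> D ` M \<Longrightarrow> K \<subseteq> I \<Longrightarrow> K = I"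
    by (rule op.artinian_minimal[OF art]) (use Dr MD(1) in auto)
  obtain g where g: "g \<in> M" "I = D g" using I(1) by blast
  have gc: "g \<in> carrier R" using MD(1) g(1) .
  have reg: "\<exists>c\<in>carrier R. a \<ominus> a \<otimes> c \<otimes> a \<in> jac R" if "a \<in> carrier R" for a
    using op.regular_mod_jac[OF art, of a] that by (auto simp: m_assoc)
  obtain c where c: "c \<in> carrier R" "g \<ominus> g \<otimes> c \<otimes> g \<in> jac R" using reg[OF gc] by blast
  let ?e = "c \<otimes> g"
  have eM: "?e \<in> M" using MD(4)[OF c(1) g(1)] .
  have ec: "?e \<in> carrier R" using c gc by simp
  have gt: "g \<otimes> (\<one> \<ominus> ?e) \<in> jac R" using c gc by (simp add: mult_one_minus m_assoc)
  have De: "D ?e \<subseteq> D g"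
  proof
    fix x assume "x \<in> D ?e"
    then have x: "x \<in> carrier R" "?e \<otimes> x \<in> jac R" by (auto simp: D_def)
    have "g \<otimes> x = (g \<otimes> (\<one> \<ominus> ?e)) \<otimes> x \<oplus> g \<otimes> (?e \<otimes> x)"
    proof -
      have "(g \<otimes> (\<one> \<ominus> ?e)) \<otimes> x = (g \<ominus> g \<otimes> ?e) \<otimes> x" using gc ec by (simp add: mult_one_minus)
      then show ?thesis using gc ec x(1) by algebra
    qed
    then show "x \<in> D g" using JL(3)[OF JR(4)[OF x(1) gt] JL(4)[OF gc x(2)]] x(1) by (simp add: D_def)
  qed
  define t where "t = \<one> \<ominus> ?e"
  have tc: "t \<in> carrier R" using ec by (simp add: t_def)
  have "t \<notin> M"
  proof
    assume "t \<in> M"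
    then have "t \<oplus> ?e \<in> M" using eM MD(3) by blast
    moreover have "t \<oplus> ?e = \<one>" unfolding t_def using ec by algebra
    ultimately show False using maximal_leftD(2)[OF M] by simp
  qed
  have et: "?e \<otimes> t \<in> jac R"
    using JL(4)[OF c(1) gt] gc c(1) by (simp add: t_def m_assoc)
  have "m \<otimes> t \<in> jac R" if m: "m \<in> M" for m
  proof -
    have mc: "m \<in> carrier R" using MD(1) m .
    define f where "f = m \<otimes> t"
    have fc: "f \<in> carrier R" using mc tc by (simp add: f_def)
    have fM: "f \<in> M"
    proof -
      have "f = m \<ominus> m \<otimes> ?e" unfolding f_def t_def using mc ec by (simp add: mult_one_minus)
      then show ?thesis using MD(6)[OF m MD(4)[OF mc eM]] by simp
    qed
    obtain d where d: "d \<in> carrier R" "f \<ominus> f \<otimes> d \<otimes> f \<in> jac R" using reg[OF fc] by blast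
    \<comment> \<open>Modulo \<open>J\<close>, \<open>h\<close> is the generator of \<open>R e + R f\<close> in a regular ring; its annihilator is the
      intersection of those of \<open>e\<close> and \<open>f\<close>.\<close>
    define h where "h = ?e \<oplus> t \<otimes> (d \<otimes> f)"
    have hM: "h \<in> M" unfolding h_def using MD(3,4) eM fM tc d(1) m_closed by presburger
    have fe: "f \<otimes> ?e \<in> jac R"
    proof -
      have "f \<otimes> ?e = m \<otimes> (?e \<otimes> t)"
        unfolding f_def t_def mult_one_minus(1)[OF mc ec] mult_one_minus(1)[OF ec ec]
        using mc ec by algebra
      then show ?thesis using JL(4)[OF mc et] by simp
    qed
    have key: "D h \<subseteq> D f \<inter> D ?e"
    proof
      fix x assume "x \<in> D h"
      then have x: "x \<in> carrier R" "h \<otimes> x \<in> jac R" by (auto simp: D_def)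
      have tt: "f \<otimes> t \<ominus> f \<in> jac R"
      proof -
        have "f \<otimes> t \<ominus> f = \<ominus> (f \<otimes> ?e)"
          unfolding t_def using fc ec by (simp add: mult_one_minus) algebra
        then show ?thesis using JL(5)[OF fe] by simp
      qed
      have "f \<otimes> x = f \<otimes> (h \<otimes> x) \<ominus> (f \<otimes> ?e) \<otimes> x \<ominus> (f \<otimes> t \<ominus> f) \<otimes> (d \<otimes> (f \<otimes> x))
        \<oplus> (f \<ominus> f \<otimes> d \<otimes> f) \<otimes> x"
        unfolding h_def using fc x(1) ec tc d(1) by algebra
      moreover have "\<dots> \<in> jac R"
        using JL(4)[OF fc x(2)] JR(4)[OF x(1) fe] JR(4)[OF _ tt, of "d \<otimes> (f \<otimes> x)"] JR(4)[OF x(1) d(2)]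
          d(1) fc x(1) by (intro JL(3) JL(6)) simp_all
      ultimately have fx: "f \<otimes> x \<in> jac R" by simp
      have "?e \<otimes> x = h \<otimes> x \<ominus> (t \<otimes> d) \<otimes> (f \<otimes> x)"
        unfolding h_def using fc x(1) ec tc d(1) by algebra
      moreover have "\<dots> \<in> jac R" using JL(6)[OF x(2) JL(4)[OF _ fx]] tc d(1) by simp
      ultimately have "?e \<otimes> x \<in> jac R" by simp
      then show "x \<in> D f \<inter> D ?e" using fx x(1) by (simp add: D_def)
    qed
    then have "D h \<subseteq> I" using De g(2) by blast
    then have "D h = I" using I(2) hM by blast
    then have "D g \<subseteq> D f" using key g(2) by blast
    moreover have "t \<in> D g" using gt tc by (simp add: D_def t_def)
    ultimately have ft: "f \<otimes> t \<in> jac R" by (auto simp: D_def)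
    have "f = f \<otimes> t \<oplus> f \<otimes> ?e"
    proof -
      have "f \<otimes> t = f \<ominus> f \<otimes> ?e" unfolding t_def using fc ec by (simp add: mult_one_minus)
      then show ?thesis using fc ec by algebra
    qed
    then show ?thesis using JL(3)[OF ft fe] f_def by metis
  qed
  then show thesis using that tc \<open>t \<notin> M\<close> by blast
qed

text \<open>
  For \<open>k \<noteq> 0\<close> take the last \<open>n\<close> with \<open>J\<^sup>n k \<noteq> 0\<close>.
\<close>

lemma rann_jac_essential:
  assumes art: "left_artinian (opp_ring R)" and k: "k \<in> carrier R" "k \<noteq> \<zero>"
  obtains a where "a \<in> carrier R" "a \<otimes> k \<noteq> \<zero>" "a \<otimes> k \<in> rann R (jac R)"
proof -
  interpret op: ring "opp_ring R" by (rule opp)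
  let ?P = "\<lambda>n. \<forall>a\<in>jpow (opp_ring R) n. a \<otimes> k = \<zero>"
  obtain m where m: "jpow (opp_ring R) m = {\<zero>}" using op.jac_nilpotent[OF art] by auto
  have "?P m" using k by (simp add: m)
  moreover have "\<not> ?P 0" using k by (auto intro!: bexI[of _ \<one>])
  then have "\<exists>n. \<not> ?P n \<and> ?P (Suc n)" if "?P m" using that
    by (induction m) blast+
  ultimately obtain n where n: "\<not> ?P n" "?P (Suc n)" by blast
  then obtain a where a: "a \<in> jpow (opp_ring R) n" "a \<otimes> k \<noteq> \<zero>" by blast
  have ac: "a \<in> carrier R" using op.left_idealD(1)[OF op.jpow_props(1) a(1)] by simp
  have "j \<otimes> (a \<otimes> k) = \<zero>" if j: "j \<in> jac R" for j
    using op.jpow_step[OF a(1), of j] n(2) j jac_carrier[OF j] ac k by (auto simp: m_assoc)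
  then show thesis using that[OF ac a(2)] ac k by (simp add: mem_rann)
qed

text \<open>
  Put \<open>W = r(J)\<close> and \<open>\<theta>(F) = l(l(F) \<inter> W)\<close> for two-sided ideals \<open>F \<supseteq> J\<close>. Because \<open>r(W) = J\<close>, self-injectivity
  gives \<open>r(l(F) \<inter> W) = r(l(F)) + r(W) = F\<close>, so \<open>r(r(\<theta>(F))) = F\<close> and \<open>\<theta>\<close> is injective. The chain
  \<open>J \<subseteq> \<theta>(J) \<subseteq> \<theta>(\<theta>(J)) \<subseteq> \<dots>\<close> of right ideals stops, and by injectivity it stops at the start:
  \<open>\<theta>(J) = J\<close>. As \<open>l(W) \<subseteq> \<theta>(J)\<close>, this is the claim. The argument replaces the count of simple modules on
  the two sides.
\<close>

lemma lann_rann_jac: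
  assumes lb: "left_baer R" and art: "left_artinian (opp_ring R)"
    and rl: "\<And>F. right_ideal F R \<Longrightarrow> rann R (lann R F) = F"
  shows "lann R (rann R (jac R)) \<subseteq> jac R"
proof -
  interpret op: ring "opp_ring R" by (rule opp)
  let ?W = "rann R (jac R)"
  have JJ: "left_ideal (jac R) R" "right_ideal (jac R) R" by (rule left_ideal_jac right_ideal_jac)+
  have Jc: "jac R \<subseteq> carrier R" using jac_carrier by blast
  have W: "left_ideal ?W R" "right_ideal ?W R"
    using left_ideal_rann[OF JJ(2)] right_ideal_rann[OF Jc] .
  have rr: "rann R ?W \<subseteq> jac R"
  proof
    fix x assume x: "x \<in> rann R ?W"
    show "x \<in> jac R"
    proof (rule jac_of_essential_annihilator[OF lb])
      show "x \<in> carrier R" using x by (simp add: mem_rann)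
      fix k assume "k \<in> carrier R" "k \<noteq> \<zero>"
      then obtain a where "a \<in> carrier R" "a \<otimes> k \<noteq> \<zero>" "a \<otimes> k \<in> ?W"
        using rann_jac_essential[OF art] by metis
      then show "\<exists>r\<in>carrier R. r \<otimes> k \<noteq> \<zero> \<and> (r \<otimes> k) \<otimes> x = \<zero>" using x by (auto simp: mem_rann)
    qed
  qed
  define \<theta> where "\<theta> F = lann R (lann R F \<inter> ?W)" for F
  let ?two = "\<lambda>F. left_ideal F R \<and> right_ideal F R \<and> jac R \<subseteq> F"
  have two: "?two (\<theta> F)" if F: "?two F" for F
  proof -
    have Fc: "F \<subseteq> carrier R" using F left_idealD(1) by blast
    have G: "left_ideal (lann R F \<inter> ?W) R" "right_ideal (lann R F \<inter> ?W) R"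
      using left_ideal_Int[OF left_ideal_lann[OF Fc] W(1)]
        op.left_ideal_Int[OF right_ideal_lann W(2)] F by auto
    then have Gc: "lann R F \<inter> ?W \<subseteq> carrier R" using left_idealD(1) by blast
    have "jac R \<subseteq> \<theta> F" using Jc by (auto simp: \<theta>_def mem_lann mem_rann)
    then show ?thesis
      unfolding \<theta>_def using left_ideal_lann[OF Gc] right_ideal_lann[OF G(1)] by simp
  qed
  have inverse: "rann R (rann R (\<theta> F)) = F" if F: "?two F" for F
  proof -
    have Fc: "F \<subseteq> carrier R" using F left_idealD(1) by blast
    have "right_ideal (lann R F \<inter> ?W) R"
      using op.left_ideal_Int[OF right_ideal_lann W(2)] F by auto
    then have 1: "rann R (\<theta> F) = lann R F \<inter> ?W" unfolding \<theta>_def by (rule rl)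
    have "b \<in> F" if b: "b \<in> rann R (lann R F \<inter> ?W)" for b
    proof -
      obtain c d where cd: "c \<in> rann R (lann R F)" "d \<in> rann R ?W" "b = c \<oplus> d"
        using rann_Int[OF lb left_ideal_lann[OF Fc] W(1) b] .
      then have "c \<in> F" "d \<in> F" using rl[of F] F rr by auto
      then show ?thesis using cd(3) F left_idealD(3) by blast
    qed
    moreover have "F \<subseteq> rann R (lann R F \<inter> ?W)" using Fc by (auto simp: mem_lann mem_rann)
    ultimately show ?thesis unfolding 1 by blast
  qed
  define T where "T n = (\<theta> ^^ n) (jac R)" for n
  have T0: "T 0 = jac R" and TS: "T (Suc n) = \<theta> (T n)" for n by (simp_all add: T_def)
  have T: "?two (T n)" for n
  proof (induction n)
    case 0
    then show ?case using JJ by (simp add: T0)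
  next
    case (Suc n)
    then show ?case using two by (simp add: TS)
  qed
  have mono: "\<theta> F \<subseteq> \<theta> F'" if "F \<subseteq> F'" for F F'
    unfolding \<theta>_def using lann_antimono[OF that] by (intro lann_antimono) blast
  have inc: "T n \<subseteq> T (Suc n)" for n
  proof (induction n)
    case 0
    show ?case using T[of "Suc 0"] by (simp add: T0)
  next
    case (Suc n)
    then show ?case using mono by (simp add: TS)
  qed
  have "right_ideal (T n) R" for n using T by blast
  from op.acc_of_lfg[of T, OF op.lfg_of_artinian[OF art] this inc]
  obtain m where m: "\<forall>n\<ge>m. T n = T m" by (rule exE)
  have "T (Suc n) = T n \<Longrightarrow> T 1 = T 0" for n
  proof (induction n)
    case (Suc n)
    have "rann R (rann R (T (Suc (Suc n)))) = rann R (rann R (T (Suc n)))" using Suc.prems by simp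
    then have "T (Suc n) = T n" unfolding TS[of "Suc n"] TS[of n] using inverse[OF T[of n]] inverse[OF T[of "Suc n"]]
      by (simp add: TS)
    then show ?case by (rule Suc.IH)
  qed simp
  moreover have "T (Suc m) = T m" by (rule m[rule_format]) simp
  ultimately have "\<theta> (jac R) = jac R" using TS[of 0] T0 by auto
  moreover have "lann R ?W \<subseteq> \<theta> (jac R)" unfolding \<theta>_def by (intro lann_antimono) blast
  ultimately show ?thesis by simp
qed

text \<open>
  For a maximal left ideal \<open>M\<close> choose \<open>t \<notin> M\<close> with \<open>M t \<subseteq> J\<close>. Then \<open>M\<close> kills \<open>t r(J)\<close>, which is not zero
  because \<open>t \<notin> J = l(r(J))\<close>.
\<close>

lemma elementwise_kasch_of_right_artinian:
  assumes lb: "left_baer R" and art: "left_artinian (opp_ring R)"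
    and rl: "\<And>F. right_ideal F R \<Longrightarrow> rann R (lann R F) = F"
  shows "elementwise_kasch R"
  unfolding elementwise_kasch_def
proof (intro allI impI, elim conjE)
  interpret op: ring "opp_ring R" by (rule opp)
  fix I assume "left_ideal I R" "\<one> \<notin> I"
  then obtain M where M: "maximal_left R M" "I \<subseteq> M" using maximal_left_exists by blast
  obtain t where t: "t \<in> carrier R" "t \<notin> M" "\<And>m. m \<in> M \<Longrightarrow> m \<otimes> t \<in> jac R"
    using maximal_left_annihilated_mod_jac[OF art M(1)] by metis
  have "t \<notin> jac R" using t(2) M(1) by (auto simp: jac_def)
  then have "t \<notin> lann R (rann R (jac R))" using lann_rann_jac[OF lb art rl] by blast
  then obtain w where w: "w \<in> rann R (jac R)" "t \<otimes> w \<noteq> \<zero>" using t(1) by (auto simp: mem_lann)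
  have wc: "w \<in> carrier R" using w(1) by (simp add: mem_rann)
  have "m \<otimes> (t \<otimes> w) = \<zero>" if "m \<in> I" for m
  proof -
    have "m \<in> M" "m \<in> carrier R" using that M left_idealD(1)[OF maximal_leftD(1)[OF M(1)]] by auto
    then show ?thesis using t(3)[of m] w(1) t(1) wc by (simp add: mem_rann flip: m_assoc)
  qed
  then show "\<exists>s\<in>carrier R. s \<noteq> \<zero> \<and> (\<forall>x\<in>I. x \<otimes> s = \<zero>)"
    using w(2) t(1) wc by (intro bexI[of _ "t \<otimes> w"]) auto
qed

text \<open>
  Ikeda and Nakayama: a homomorphism is given by an element \<open>c\<close> on \<open>F\<close> and by an element \<open>d\<close> on \<open>R y\<close>, the
  latter because \<open>r(l(y)) = yR\<close>. Now \<open>c - d\<close> kills \<open>F \<inter> R y\<close>, and \<open>r(F \<inter> R y) = r(F) + r(R y)\<close> by duality, so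
  \<open>c\<close> and \<open>d\<close> can be changed to a common element.
\<close>

lemma left_baer_of_duality:
  assumes lr: "\<And>I. left_ideal I R \<Longrightarrow> lann R (rann R I) = I"
    and rl: "\<And>F. right_ideal F R \<Longrightarrow> rann R (lann R F) = F"
    and fg: "\<And>I. left_ideal I R \<Longrightarrow> lfg R I"
  shows "left_baer R"
proof -
  have *: "\<exists>c\<in>carrier R. \<forall>x\<in>lspan R {\<zero>} ys. f x = x \<otimes> c"
    if "set ys \<subseteq> carrier R" "left_ideal_hom R (lspan R {\<zero>} ys) f" for ys f
    using that
  proof (induction ys)
    case Nil
    then show ?case using left_ideal_homD(5)[OF Nil(2)] by auto
  next
    case (Cons y ys)
    let ?F = "lspan R {\<zero>} ys" and ?Y = "lsum R {\<zero>} y"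
    have yc: "y \<in> carrier R" and ysc: "set ys \<subseteq> carrier R" using Cons.prems(1) by auto
    have F: "left_ideal ?F R" using lspan_ideal[OF left_ideal_zero ysc] .
    have Y: "left_ideal ?Y R" "y \<in> ?Y" using lsum_I[OF left_ideal_zero yc] by auto
    have FD: "?F \<subseteq> lspan R {\<zero>} (y # ys)" "y \<in> lspan R {\<zero>} (y # ys)"
      using lsum_I(2,4)[OF F yc] by auto
    note f = left_ideal_homD[OF Cons.prems(2)]
    have "left_ideal_hom R ?F f"
      using Cons.prems(2) F FD(1) by (auto simp: left_ideal_hom_def subset_iff)
    then obtain c where c: "c \<in> carrier R" "\<forall>x\<in>?F. f x = x \<otimes> c" using Cons.IH[OF ysc] by blast
    have fy: "f y \<in> carrier R" using f(2)[OF FD(2)] .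
    obtain d where d: "d \<in> carrier R" "f y = y \<otimes> d"
    proof -
      let ?T = "lsum (opp_ring R) {\<zero>} y"
      have Tr: "right_ideal ?T R" "y \<in> ?T"
        using ring.lsum_I(1,4)[OF opp ring.left_ideal_zero[OF opp], of y] yc by auto
      have "f y \<in> rann R (lann R ?T)"
      proof -
        have "a \<otimes> f y = \<zero>" if "a \<in> lann R ?T" for a
        proof -
          have a: "a \<in> carrier R" "a \<otimes> y = \<zero>" using that Tr(2) by (auto simp: mem_lann)
          have "a \<otimes> f y = f (a \<otimes> y)" using f(4)[OF a(1) FD(2)] by simp
          then show ?thesis using a(2) f(5) by simp
        qed
        then show ?thesis using fy by (simp add: mem_rann)
      qed
      then have "f y \<in> ?T" using rl[OF Tr(1)] by simp
      then obtain r where "r \<in> carrier R" "f y = y \<otimes> r" using yc by (auto simp: lsum_def)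
      then show thesis using that by blast
    qed
    let ?S = "{u \<oplus> v | u v. u \<in> rann R ?F \<and> v \<in> rann R ?Y}"
    have Fc: "?F \<subseteq> carrier R" and Yc: "?Y \<subseteq> carrier R" using left_idealD(1) F Y(1) by auto
    have rF: "right_ideal (rann R ?F) R" and rY: "right_ideal (rann R ?Y) R"
      using right_ideal_rann Fc Yc by auto
    note FD' = right_idealD[OF rF] and YD' = right_idealD[OF rY]
    have memS: "u \<oplus> v \<in> ?S" if "u \<in> rann R ?F" "v \<in> rann R ?Y" for u v using that by blast
    have S: "right_ideal ?S R"
      unfolding right_ideal_iff
    proof (intro conjI ballI)
      show "?S \<subseteq> carrier R" using FD'(1) YD'(1) by auto
      show "\<zero> \<in> ?S" using memS[OF FD'(2) YD'(2)] by simp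
    next
      fix p q assume "p \<in> ?S" "q \<in> ?S"
      then obtain u v u' v' where *: "p = u \<oplus> v" "q = u' \<oplus> v'"
        "u \<in> rann R ?F" "v \<in> rann R ?Y" "u' \<in> rann R ?F" "v' \<in> rann R ?Y" by blast
      have "p \<oplus> q = (u \<oplus> u') \<oplus> (v \<oplus> v')"
        unfolding *(1,2) using *(3,5)[THEN FD'(1)] *(4,6)[THEN YD'(1)] by algebra
      then show "p \<oplus> q \<in> ?S" using memS[OF FD'(3)[OF *(3,5)] YD'(3)[OF *(4,6)]] by simp
    next
      fix r p assume r: "r \<in> carrier R" "p \<in> ?S"
      then obtain u v where *: "p = u \<oplus> v" "u \<in> rann R ?F" "v \<in> rann R ?Y" by blast
      then have "p \<otimes> r = u \<otimes> r \<oplus> v \<otimes> r" using FD'(1) YD'(1) r(1) by (simp add: l_distr)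
      then show "p \<otimes> r \<in> ?S" using memS[OF FD'(4)[OF r(1) *(2)] YD'(4)[OF r(1) *(3)]] by simp
    qed
    have sub: "rann R ?F \<subseteq> ?S" "rann R ?Y \<subseteq> ?S"
    proof -
      show "rann R ?F \<subseteq> ?S"
      proof
        fix u assume u: "u \<in> rann R ?F"
        show "u \<in> ?S" using memS[OF u YD'(2)] FD'(1)[OF u] by simp
      qed
      show "rann R ?Y \<subseteq> ?S"
      proof
        fix v assume v: "v \<in> rann R ?Y"
        show "v \<in> ?S" using memS[OF FD'(2) v] YD'(1)[OF v] by simp
      qed
    qed
    have "lann R ?S \<subseteq> ?F \<inter> ?Y"
      using lann_antimono[OF sub(1), of R] lann_antimono[OF sub(2), of R] lr[OF F] lr[OF Y(1)] by simp
    then have SS: "rann R (?F \<inter> ?Y) \<subseteq> ?S"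
      using lann_antimono[of "lann R ?S" "?F \<inter> ?Y" "opp_ring R"] rl[OF S] by simp
    have "c \<ominus> d \<in> rann R (?F \<inter> ?Y)"
    proof -
      have "x \<otimes> (c \<ominus> d) = \<zero>" if x: "x \<in> ?F \<inter> ?Y" for x
      proof -
        obtain r where r: "r \<in> carrier R" "x = r \<otimes> y" using x yc by (auto simp: lsum_def)
        have xc: "x \<in> carrier R" using r yc by simp
        have "x \<otimes> c = f x" using c(2) x by simp
        also have "\<dots> = r \<otimes> f y" using r f(4)[OF r(1) FD(2)] by simp
        also have "\<dots> = x \<otimes> d" unfolding d(2) r(2) using r(1) yc d(1) by (simp add: m_assoc)
        finally have "x \<otimes> c = x \<otimes> d" .
        moreover have "x \<otimes> (c \<ominus> d) = x \<otimes> c \<ominus> x \<otimes> d" using xc c(1) d(1) by algebra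
        ultimately show ?thesis using xc d(1) by (simp add: r_right_minus_eq)
      qed
      then show ?thesis using c(1) d(1) by (simp add: mem_rann)
    qed
    then obtain u v where uv: "u \<in> rann R ?F" "v \<in> rann R ?Y" "c \<ominus> d = u \<oplus> v" using SS by blast
    have uc: "u \<in> carrier R" and vc: "v \<in> carrier R" using uv FD'(1) YD'(1) by auto
    define e where "e = c \<ominus> u"
    have ec: "e \<in> carrier R" using c(1) uc by (simp add: e_def)
    have e2: "e = d \<oplus> v"
    proof -
      have "c \<ominus> u = (c \<ominus> d) \<oplus> d \<ominus> u" using c(1) d(1) uc by algebra
      also have "\<dots> = d \<oplus> v" unfolding uv(3) using uc vc d(1) by algebra
      finally show ?thesis by (simp add: e_def)
    qed
    have "f x = x \<otimes> e" if x: "x \<in> lspan R {\<zero>} (y # ys)" for x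
    proof -
      obtain z r where zr: "x = z \<oplus> r \<otimes> y" "z \<in> ?F" "r \<in> carrier R" using x by (auto simp: lsum_def)
      have zc: "z \<in> carrier R" using zr(2) Fc by blast
      have zu: "z \<otimes> u = \<zero>" using uv(1) zr(2) by (simp add: mem_rann)
      have yv: "y \<otimes> v = \<zero>" using uv(2) Y(2) by (simp add: mem_rann)
      have "r \<otimes> y \<in> lspan R {\<zero>} (y # ys)" using left_idealD(4)[OF f(1) zr(3) FD(2)] .
      then have "f x = f z \<oplus> r \<otimes> f y"
        unfolding zr(1) using f(3)[of z "r \<otimes> y"] f(4)[OF zr(3) FD(2)] FD(1) zr(2) by auto
      also have "f z = z \<otimes> e"
      proof -
        have "z \<otimes> e = z \<otimes> c \<ominus> z \<otimes> u" unfolding e_def using zc c(1) uc by algebra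
        then show ?thesis using c(2) zr(2) zu zc c(1) by (simp add: a_minus_def)
      qed
      also have "f y = y \<otimes> e" unfolding e2 d(2) using yc d(1) vc yv by (simp add: r_distr)
      finally show ?thesis unfolding zr(1) using zc zr(3) yc ec by (simp add: l_distr m_assoc)
    qed
    then show ?case using ec by blast
  qed
  show ?thesis
    unfolding left_baer_def
  proof (intro allI impI)
    fix I f assume f: "left_ideal_hom R I f"
    obtain ys where ys: "set ys \<subseteq> I" "I = lspan R {\<zero>} ys"
      using fg[OF left_ideal_homD(1)[OF f]] unfolding lfg_def by blast
    have "set ys \<subseteq> carrier R" using ys(1) left_idealD(1)[OF left_ideal_homD(1)[OF f]] by blast
    then show "\<exists>c\<in>carrier R. \<forall>x\<in>I. f x = x \<otimes> c" using *[of ys f] f ys(2) by simp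
  qed
qed

text \<open>
  All right ideals are finitely generated, so \<open>r(l(F)) = F\<close> holds for all of them. The left Kasch
  condition supplies the other half of the duality, which then transports injectivity and chain
  conditions between the two sides.
\<close>

lemma two_sided_qf_of_right_artinian:
  assumes lb: "left_baer R" and art: "left_artinian (opp_ring R)"
  shows "two_sided_qf R"
proof -
  interpret op: ring "opp_ring R" by (rule opp)
  have fg: "lfg (opp_ring R) F" if "right_ideal F R" for F
    using op.lfg_of_artinian[OF art that] .
  have rl: "rann R (lann R F) = F" if F: "right_ideal F R" for F
  proof -
    obtain ys where ys: "set ys \<subseteq> F" "F = lspan (opp_ring R) {\<zero>} ys"
      using fg[OF F] unfolding lfg_def by auto
    have "set ys \<subseteq> carrier R" using ys(1) right_idealD(1)[OF F] by blast
    then show ?thesis using rann_lann_fg[OF lb, of ys] ys(2) by simp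
  qed
  have lk: "elementwise_kasch R" using elementwise_kasch_of_right_artinian[OF lb art rl] .
  have lr: "lann R (rann R I) = I" if "left_ideal I R" for I
    using lann_rann_of_kasch[OF lb lk that] .
  have rb: "left_baer (opp_ring R)"
    using op.left_baer_of_duality fg rl lr by simp
  have rk: "elementwise_kasch (opp_ring R)"
    unfolding elementwise_kasch_def
  proof (intro allI impI, elim conjE, rule ccontr)
    fix F assume F: "right_ideal F R" and one: "\<one>\<^bsub>opp_ring R\<^esub> \<notin> F"
      and no: "\<not> (\<exists>s\<in>carrier (opp_ring R). s \<noteq> \<zero>\<^bsub>opp_ring R\<^esub> \<and>
        (\<forall>x\<in>F. x \<otimes>\<^bsub>opp_ring R\<^esub> s = \<zero>\<^bsub>opp_ring R\<^esub>))"
    then have "a = \<zero>" if "a \<in> lann R F" for a using that by (auto simp: mem_lann)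
    then have "lann R F \<subseteq> {\<zero>}" by blast
    then have "\<one> \<in> rann R (lann R F)" by (auto simp: mem_rann)
    then show False using rl[OF F] one by simp
  qed
  have la: "left_artinian R"
    unfolding left_artinian_def
  proof (intro allI impI, elim conjE)
    fix C :: "nat \<Rightarrow> 'a set"
    assume "\<forall>n. left_ideal (C n) R" "\<forall>n. C (Suc n) \<subseteq> C n"
    then have C: "\<And>n. left_ideal (C n) R" "\<And>n. C (Suc n) \<subseteq> C n" by auto
    have Cc: "C n \<subseteq> carrier R" for n using left_idealD(1)[OF C(1)] by blast
    have "rann R (C n) \<subseteq> rann R (C (Suc n))" for n by (rule lann_antimono[OF C(2)])
    from op.acc_of_lfg[of "\<lambda>n. rann R (C n)", OF fg right_ideal_rann[OF Cc] this]
    obtain m where m: "\<forall>n\<ge>m. rann R (C n) = rann R (C m)" by (rule exE)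
    have "\<forall>n\<ge>m. C n = C m" using m lr[OF C(1)] by metis
    then show "\<exists>m. \<forall>n\<ge>m. C n = C m" by blast
  qed
  show ?thesis unfolding two_sided_qf_def using lb rb lk rk la art by simp
qed

lemma two_sided_qf_of_left_artinian:
  assumes "left_baer R" "left_artinian R"
  shows "two_sided_qf R"
  using two_sided_qf_of_right_artinian[OF assms(1) right_artinian_of_left[OF assms]] .

end

section \<open>Extending homomorphisms from simple submodules\<close>

context left_module
begin

lemma submoduleD:
  assumes "submodule H R M"
  shows "x \<in> H \<Longrightarrow> x \<in> carrier M" "\<zero>\<^bsub>M\<^esub> \<in> H" "x \<in> H \<Longrightarrow> y \<in> H \<Longrightarrow> x \<oplus>\<^bsub>M\<^esub> y \<in> H"
    "a \<in> carrier R \<Longrightarrow> x \<in> H \<Longrightarrow> a \<odot>\<^bsub>M\<^esub> x \<in> H" "x \<in> H \<Longrightarrow> \<ominus>\<^bsub>M\<^esub> x \<in> H"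
    "x \<in> H \<Longrightarrow> y \<in> H \<Longrightarrow> x \<ominus>\<^bsub>M\<^esub> y \<in> H"
proof -
  interpret H: submodule H R M by fact
  show "x \<in> H \<Longrightarrow> x \<in> carrier M" "\<zero>\<^bsub>M\<^esub> \<in> H" "x \<in> H \<Longrightarrow> y \<in> H \<Longrightarrow> x \<oplus>\<^bsub>M\<^esub> y \<in> H"
    "a \<in> carrier R \<Longrightarrow> x \<in> H \<Longrightarrow> a \<odot>\<^bsub>M\<^esub> x \<in> H"
    using H.subset H.one_closed H.m_closed H.smult_closed by auto
  show n: "\<ominus>\<^bsub>M\<^esub> x \<in> H" if "x \<in> H" for x
    using H.m_inv_closed[OF that] by (simp add: a_inv_def)
  show "x \<in> H \<Longrightarrow> y \<in> H \<Longrightarrow> x \<ominus>\<^bsub>M\<^esub> y \<in> H"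
    using H.m_closed n by (simp add: a_minus_def)
qed

lemma minus_eq_zero:
  assumes "x \<in> carrier M" "y \<in> carrier M" "x \<ominus>\<^bsub>M\<^esub> y = \<zero>\<^bsub>M\<^esub>"
  shows "x = y"
proof -
  have "x = (x \<ominus>\<^bsub>M\<^esub> y) \<oplus>\<^bsub>M\<^esub> y" using assms(1,2) by (simp add: a_minus_def M.a_assoc M.l_neg)
  then show ?thesis using assms by simp
qed

lemma smult_zero_r: "a \<in> carrier R \<Longrightarrow> a \<odot>\<^bsub>M\<^esub> \<zero>\<^bsub>M\<^esub> = \<zero>\<^bsub>M\<^esub>"
  using smult_r_distr[of a "\<zero>\<^bsub>M\<^esub>" "\<zero>\<^bsub>M\<^esub>"] M.add.l_cancel_one[of "a \<odot>\<^bsub>M\<^esub> \<zero>\<^bsub>M\<^esub>" "a \<odot>\<^bsub>M\<^esub> \<zero>\<^bsub>M\<^esub>"]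
  by simp

lemma smult_zero_l: "x \<in> carrier M \<Longrightarrow> \<zero> \<odot>\<^bsub>M\<^esub> x = \<zero>\<^bsub>M\<^esub>"
  using smult_l_distr[of \<zero> \<zero> x] M.add.l_cancel_one[of "\<zero> \<odot>\<^bsub>M\<^esub> x" "\<zero> \<odot>\<^bsub>M\<^esub> x"] by simp

lemma smult_neg: "a \<in> carrier R \<Longrightarrow> x \<in> carrier M \<Longrightarrow> a \<odot>\<^bsub>M\<^esub> (\<ominus>\<^bsub>M\<^esub> x) = \<ominus>\<^bsub>M\<^esub> (a \<odot>\<^bsub>M\<^esub> x)"
  using smult_r_distr[of a "\<ominus>\<^bsub>M\<^esub> x" x] smult_zero_r[of a] M.l_neg[of x]
  by (metis M.a_inv_closed M.minus_equality smult_closed)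

text \<open>
  Cosets are represented by codes, under an injection \<open>\<iota>\<close>, of chosen representatives. This places the
  quotient \<open>Q\<close> in any type that is large enough for the elements of \<open>M\<close>.
\<close>

lemma quotient_module_exists:
  fixes \<iota> :: "'m \<Rightarrow> 'u"
  assumes K: "submodule K R M" and inj: "inj \<iota>"
  obtains Q :: "('a, 'u) module" and \<pi> where "left_module R Q"
    "\<And>x. x \<in> carrier M \<Longrightarrow> \<pi> x \<in> carrier Q"
    "\<And>u. u \<in> carrier Q \<Longrightarrow> \<exists>x\<in>carrier M. u = \<pi> x"
    "\<And>x y. x \<in> carrier M \<Longrightarrow> y \<in> carrier M \<Longrightarrow> \<pi> (x \<oplus>\<^bsub>M\<^esub> y) = \<pi> x \<oplus>\<^bsub>Q\<^esub> \<pi> y"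
    "\<And>a x. a \<in> carrier R \<Longrightarrow> x \<in> carrier M \<Longrightarrow> \<pi> (a \<odot>\<^bsub>M\<^esub> x) = a \<odot>\<^bsub>Q\<^esub> \<pi> x"
    "\<pi> \<zero>\<^bsub>M\<^esub> = \<zero>\<^bsub>Q\<^esub>"
    "\<And>x y. x \<in> carrier M \<Longrightarrow> y \<in> carrier M \<Longrightarrow> \<pi> x = \<pi> y \<longleftrightarrow> x \<ominus>\<^bsub>M\<^esub> y \<in> K"
proof -
  note KD = submoduleD[OF K]
  define rep where "rep x = (SOME y. y \<in> carrier M \<and> x \<ominus>\<^bsub>M\<^esub> y \<in> K)" for x
  define \<pi> where "\<pi> x = \<iota> (rep x)" for x
  have refl: "x \<ominus>\<^bsub>M\<^esub> x \<in> K" if "x \<in> carrier M" for x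
    using that KD(2) by (simp add: a_minus_def M.r_neg)
  have sym: "y \<ominus>\<^bsub>M\<^esub> x \<in> K" if "x \<ominus>\<^bsub>M\<^esub> y \<in> K" "x \<in> carrier M" "y \<in> carrier M" for x y
    using KD(5)[OF that(1)] that(2,3) by (simp add: a_minus_def M.minus_add M.a_comm)
  have trans: "x \<ominus>\<^bsub>M\<^esub> z \<in> K"
    if "x \<ominus>\<^bsub>M\<^esub> y \<in> K" "y \<ominus>\<^bsub>M\<^esub> z \<in> K" "x \<in> carrier M" "y \<in> carrier M" "z \<in> carrier M" for x y z
  proof -
    have "(x \<ominus>\<^bsub>M\<^esub> y) \<oplus>\<^bsub>M\<^esub> (y \<ominus>\<^bsub>M\<^esub> z) = x \<ominus>\<^bsub>M\<^esub> z"
      using that(3-) by (simp add: a_minus_def M.a_assoc M.r_neg1)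
    then show ?thesis using KD(3)[OF that(1,2)] by simp
  qed
  have rep: "rep x \<in> carrier M" "x \<ominus>\<^bsub>M\<^esub> rep x \<in> K" if "x \<in> carrier M" for x
  proof -
    have "rep x \<in> carrier M \<and> x \<ominus>\<^bsub>M\<^esub> rep x \<in> K"
      unfolding rep_def by (rule someI[of _ x]) (use refl that in blast)
    then show "rep x \<in> carrier M" "x \<ominus>\<^bsub>M\<^esub> rep x \<in> K" by auto
  qed
  have eq: "\<pi> x = \<pi> y \<longleftrightarrow> x \<ominus>\<^bsub>M\<^esub> y \<in> K" if c: "x \<in> carrier M" "y \<in> carrier M" for x y
  proof
    assume "\<pi> x = \<pi> y"
    then have "rep x = rep y" using inj by (simp add: \<pi>_def inj_eq)
    then have "x \<ominus>\<^bsub>M\<^esub> rep y \<in> K" using rep(2)[OF c(1)] by simp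
    then show "x \<ominus>\<^bsub>M\<^esub> y \<in> K" using trans[OF _ sym[OF rep(2)[OF c(2)]]] c rep(1) by simp
  next
    assume xy: "x \<ominus>\<^bsub>M\<^esub> y \<in> K"
    have "x \<ominus>\<^bsub>M\<^esub> z \<in> K \<longleftrightarrow> y \<ominus>\<^bsub>M\<^esub> z \<in> K" if "z \<in> carrier M" for z
      using trans[OF xy _ c that] trans[OF sym[OF xy c] _ c(2,1) that] by blast
    then have "rep x = rep y" unfolding rep_def by (intro arg_cong[where f = Eps] ext) blast
    then show "\<pi> x = \<pi> y" by (simp add: \<pi>_def)
  qed
  define \<sigma> where "\<sigma> u = (SOME x. x \<in> carrier M \<and> \<pi> x = u)" for u
  have \<sigma>: "\<sigma> (\<pi> x) \<in> carrier M \<and> \<pi> (\<sigma> (\<pi> x)) = \<pi> x" if "x \<in> carrier M" for x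
    unfolding \<sigma>_def by (rule someI[of _ x]) (use that in simp)
  define Q :: "('a, 'u) module" where "Q = \<lparr>carrier = \<pi> ` carrier M, monoid.mult = undefined, one = undefined,
    ring.zero = \<pi> \<zero>\<^bsub>M\<^esub>, ring.add = (\<lambda>u v. \<pi> (\<sigma> u \<oplus>\<^bsub>M\<^esub> \<sigma> v)), smult = (\<lambda>a u. \<pi> (a \<odot>\<^bsub>M\<^esub> \<sigma> u))\<rparr>"
  have Q: "carrier Q = \<pi> ` carrier M" "\<zero>\<^bsub>Q\<^esub> = \<pi> \<zero>\<^bsub>M\<^esub>"
    "\<And>u v. u \<oplus>\<^bsub>Q\<^esub> v = \<pi> (\<sigma> u \<oplus>\<^bsub>M\<^esub> \<sigma> v)" "\<And>a u. a \<odot>\<^bsub>Q\<^esub> u = \<pi> (a \<odot>\<^bsub>M\<^esub> \<sigma> u)"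
    by (simp_all add: Q_def)
  have add: "\<pi> x \<oplus>\<^bsub>Q\<^esub> \<pi> y = \<pi> (x \<oplus>\<^bsub>M\<^esub> y)" if c: "x \<in> carrier M" "y \<in> carrier M" for x y
  proof -
    have s: "\<sigma> (\<pi> x) \<in> carrier M" "\<sigma> (\<pi> y) \<in> carrier M" using \<sigma> c by auto
    have "\<sigma> (\<pi> x) \<ominus>\<^bsub>M\<^esub> x \<in> K" "\<sigma> (\<pi> y) \<ominus>\<^bsub>M\<^esub> y \<in> K"
      using eq[OF s(1) c(1)] eq[OF s(2) c(2)] \<sigma> c by auto
    then have "(\<sigma> (\<pi> x) \<ominus>\<^bsub>M\<^esub> x) \<oplus>\<^bsub>M\<^esub> (\<sigma> (\<pi> y) \<ominus>\<^bsub>M\<^esub> y) \<in> K" by (rule KD(3))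
    moreover have "(\<sigma> (\<pi> x) \<ominus>\<^bsub>M\<^esub> x) \<oplus>\<^bsub>M\<^esub> (\<sigma> (\<pi> y) \<ominus>\<^bsub>M\<^esub> y)
      = (\<sigma> (\<pi> x) \<oplus>\<^bsub>M\<^esub> \<sigma> (\<pi> y)) \<ominus>\<^bsub>M\<^esub> (x \<oplus>\<^bsub>M\<^esub> y)"
      using s c by (simp add: a_minus_def M.minus_add M.a_ac)
    ultimately show ?thesis unfolding Q(3) using eq s c by simp
  qed
  have smult: "a \<odot>\<^bsub>Q\<^esub> \<pi> x = \<pi> (a \<odot>\<^bsub>M\<^esub> x)" if c: "a \<in> carrier R" "x \<in> carrier M" for a x
  proof -
    have s: "\<sigma> (\<pi> x) \<in> carrier M" using \<sigma> c by auto
    have "\<sigma> (\<pi> x) \<ominus>\<^bsub>M\<^esub> x \<in> K" using eq[OF s c(2)] \<sigma> c by auto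
    then have "a \<odot>\<^bsub>M\<^esub> (\<sigma> (\<pi> x) \<ominus>\<^bsub>M\<^esub> x) \<in> K" using KD(4) c(1) by blast
    moreover have "a \<odot>\<^bsub>M\<^esub> (\<sigma> (\<pi> x) \<ominus>\<^bsub>M\<^esub> x) = a \<odot>\<^bsub>M\<^esub> \<sigma> (\<pi> x) \<ominus>\<^bsub>M\<^esub> a \<odot>\<^bsub>M\<^esub> x"
      using s c by (simp add: a_minus_def smult_r_distr smult_neg)
    ultimately show ?thesis unfolding Q(4) using eq s c by simp
  qed
  have "abelian_group Q"
  proof (rule abelian_groupI)
    fix u assume "u \<in> carrier Q"
    then obtain x where x: "u = \<pi> x" "x \<in> carrier M" unfolding Q(1) by blast
    then have "\<pi> (\<ominus>\<^bsub>M\<^esub> x) \<oplus>\<^bsub>Q\<^esub> u = \<zero>\<^bsub>Q\<^esub>" by (simp add: add M.l_neg Q(2))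
    then show "\<exists>y\<in>carrier Q. y \<oplus>\<^bsub>Q\<^esub> u = \<zero>\<^bsub>Q\<^esub>" unfolding Q(1) using x by blast
  qed (auto simp: Q(1,2) add M.a_ac)
  then have "left_module R Q"
    by (intro left_module.intro R.ring_axioms left_module_axioms.intro)
      (auto simp: Q(1) smult add smult_l_distr smult_r_distr smult_assoc1)
  then show thesis
    by (rule that[of Q \<pi>]) (auto simp: Q(1,2) add smult eq)
qed

end

lemma left_module_restrict:
  assumes "left_module R M" "submodule V R M"
  shows "left_module R (M\<lparr>carrier := V\<rparr>)"
proof -
  interpret M: left_module R M by fact
  note VD = M.submoduleD[OF assms(2)]
  have "abelian_group (M\<lparr>carrier := V\<rparr>)"
  proof (rule abelian_groupI)
    fix x assume x: "x \<in> carrier (M\<lparr>carrier := V\<rparr>)"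
    then show "\<exists>y\<in>carrier (M\<lparr>carrier := V\<rparr>). y \<oplus>\<^bsub>M\<lparr>carrier := V\<rparr>\<^esub> x = \<zero>\<^bsub>M\<lparr>carrier := V\<rparr>\<^esub>"
      using VD(1,5)[of x] M.M.l_neg[of x] by auto
  qed (use VD in \<open>auto simp: M.M.a_ac\<close>)
  then show ?thesis
    by (intro left_module.intro M.R.ring_axioms left_module_axioms.intro)
      (use VD in \<open>auto simp: M.smult_l_distr M.smult_r_distr M.smult_assoc1\<close>)
qed

lemma module_homI:
  assumes "\<And>x. x \<in> carrier M \<Longrightarrow> f x \<in> carrier N"
    "\<And>x y. x \<in> carrier M \<Longrightarrow> y \<in> carrier M \<Longrightarrow> f (x \<oplus>\<^bsub>M\<^esub> y) = f x \<oplus>\<^bsub>N\<^esub> f y"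
    "\<And>a x. a \<in> carrier R \<Longrightarrow> x \<in> carrier M \<Longrightarrow> f (a \<odot>\<^bsub>M\<^esub> x) = a \<odot>\<^bsub>N\<^esub> f x"
  shows "f \<in> module_hom R M N"
  using assms by (auto simp: module_hom_def)

lemma module_homD:
  assumes "f \<in> module_hom R M N"
  shows "x \<in> carrier M \<Longrightarrow> f x \<in> carrier N"
    "x \<in> carrier M \<Longrightarrow> y \<in> carrier M \<Longrightarrow> f (x \<oplus>\<^bsub>M\<^esub> y) = f x \<oplus>\<^bsub>N\<^esub> f y"
    "a \<in> carrier R \<Longrightarrow> x \<in> carrier M \<Longrightarrow> f (a \<odot>\<^bsub>M\<^esub> x) = a \<odot>\<^bsub>N\<^esub> f x"
  using assms by (auto simp: module_hom_def)

lemma semisimple_of_simple: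
  assumes N: "left_module R N" and simple: "simple_module R N"
  shows "semisimple_module R N"
  unfolding semisimple_module_def
proof (intro conjI)
  interpret N: left_module R N by fact
  have all: "submodule (carrier N) R N" unfolding submodule_iff[OF N] by auto
  have "carrier N \<in> {S. submodule S R N \<and> simple_module R (N\<lparr>carrier := S\<rparr>)}"
    using all simple by simp
  then show "carrier N = submodule_Sum R N {S. submodule S R N \<and> simple_module R (N\<lparr>carrier := S\<rparr>)}"
    using all N.submoduleD(1) unfolding submodule_Sum_def by blast
qed (rule N)

lemma extends_from_simple_summand:
  assumes N: "left_module R N" and V: "submodule V R N" and L: "submodule L R N"
    and sum: "V <+>\<^bsub>N\<^esub> L = carrier N" and disj: "V \<inter> L = {\<zero>\<^bsub>N\<^esub>}"
    and f: "f \<in> module_hom R (N\<lparr>carrier := V\<rparr>) E"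
  shows "\<exists>g\<in>module_hom R N E. \<forall>x\<in>V. g x = f x"
proof -
  interpret N: left_module R N by fact
  note VD = N.submoduleD[OF V] and LD = N.submoduleD[OF L]
  have "\<exists>v. v \<in> V \<and> n \<ominus>\<^bsub>N\<^esub> v \<in> L" if n: "n \<in> carrier N" for n
  proof -
    obtain v l where vl: "v \<in> V" "l \<in> L" "n = v \<oplus>\<^bsub>N\<^esub> l"
      using n unfolding sum[symmetric] set_add_def' by blast
    then have "n \<ominus>\<^bsub>N\<^esub> v = l" using VD(1)[OF vl(1)] LD(1)[OF vl(2)]
      by (simp add: a_minus_def N.M.a_ac N.M.r_neg)
    then show ?thesis using vl by blast
  qed
  then obtain p where p: "\<And>n. n \<in> carrier N \<Longrightarrow> p n \<in> V \<and> n \<ominus>\<^bsub>N\<^esub> p n \<in> L" by metis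
  have uniq: "p n = v" if n: "n \<in> carrier N" and v: "v \<in> V" "n \<ominus>\<^bsub>N\<^esub> v \<in> L" for n v
  proof -
    have pc: "p n \<in> carrier N" "v \<in> carrier N" using VD(1) p[OF n] v(1) by auto
    have "(n \<ominus>\<^bsub>N\<^esub> v) \<ominus>\<^bsub>N\<^esub> (n \<ominus>\<^bsub>N\<^esub> p n) = p n \<ominus>\<^bsub>N\<^esub> v"
      using pc n by (simp add: a_minus_def N.M.minus_add N.M.a_ac N.M.r_neg1 N.M.r_neg2)
    then have "p n \<ominus>\<^bsub>N\<^esub> v \<in> L" using LD(6)[OF v(2)] p[OF n] by metis
    moreover have "p n \<ominus>\<^bsub>N\<^esub> v \<in> V" using VD(6) p[OF n] v(1) by blast
    ultimately have "p n \<ominus>\<^bsub>N\<^esub> v = \<zero>\<^bsub>N\<^esub>" using disj by blast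
    then show ?thesis by (rule N.minus_eq_zero[OF pc])
  qed
  have "(\<lambda>n. f (p n)) \<in> module_hom R N E"
  proof (rule module_homI)
    show "f (p n) \<in> carrier E" if "n \<in> carrier N" for n
      using module_homD(1)[OF f] p[OF that] by simp
  next
    fix x y assume xy: "x \<in> carrier N" "y \<in> carrier N"
    have pc: "p x \<in> carrier N" "p y \<in> carrier N" using VD(1) p xy by auto
    have "(x \<oplus>\<^bsub>N\<^esub> y) \<ominus>\<^bsub>N\<^esub> (p x \<oplus>\<^bsub>N\<^esub> p y) = (x \<ominus>\<^bsub>N\<^esub> p x) \<oplus>\<^bsub>N\<^esub> (y \<ominus>\<^bsub>N\<^esub> p y)"
      using pc xy by (simp add: a_minus_def N.M.minus_add N.M.a_ac)
    then have "p (x \<oplus>\<^bsub>N\<^esub> y) = p x \<oplus>\<^bsub>N\<^esub> p y"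
      using xy p VD(3) LD(3) by (intro uniq) auto
    then show "f (p (x \<oplus>\<^bsub>N\<^esub> y)) = f (p x) \<oplus>\<^bsub>E\<^esub> f (p y)"
      using module_homD(2)[OF f, of "p x" "p y"] p xy by simp
  next
    fix a x assume ax: "a \<in> carrier R" "x \<in> carrier N"
    have pc: "p x \<in> carrier N" using VD(1) p ax by auto
    have "a \<odot>\<^bsub>N\<^esub> x \<ominus>\<^bsub>N\<^esub> a \<odot>\<^bsub>N\<^esub> p x = a \<odot>\<^bsub>N\<^esub> (x \<ominus>\<^bsub>N\<^esub> p x)"
      using pc ax by (simp add: a_minus_def N.smult_r_distr N.smult_neg)
    then have "p (a \<odot>\<^bsub>N\<^esub> x) = a \<odot>\<^bsub>N\<^esub> p x"
      using ax p VD(4) LD(4) by (intro uniq) auto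
    then show "f (p (a \<odot>\<^bsub>N\<^esub> x)) = a \<odot>\<^bsub>E\<^esub> f (p x)"
      using module_homD(3)[OF f, of a "p x"] p ax by simp
  qed
  moreover have "p v = v" if "v \<in> V" for v
    using VD(1)[OF that] that LD(2) by (intro uniq) (auto simp: a_minus_def N.M.r_neg)
  ultimately show ?thesis by (intro bexI[of _ "\<lambda>n. f (p n)"]) auto
qed

text \<open>
  For small \<open>V\<close> this is strong ss-injectivity. Otherwise \<open>V + L = N\<close> for a proper submodule \<open>L\<close>, which
  does not contain \<open>V\<close> and so, \<open>V\<close> being simple, meets it in \<open>0\<close>.
\<close>

lemma extends_from_simple:
  fixes N :: "('a, 'u) module"
  assumes ss: "strongly_left_ss_injective TYPE('u) R"
    and N: "left_module R N" and V: "submodule V R N" and simple: "simple_module R (N\<lparr>carrier := V\<rparr>)"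
    and f: "f \<in> module_hom R (N\<lparr>carrier := V\<rparr>) (regular_module R)"
  shows "\<exists>g\<in>module_hom R N (regular_module R). \<forall>x\<in>V. g x = f x"
proof (cases "small_submodule V R N")
  case True
  have "semisimple_module R (N\<lparr>carrier := V\<rparr>)"
    using semisimple_of_simple[OF left_module_restrict[OF N V] simple] .
  then have "homs_extend R N V (regular_module R)"
    using ss N True unfolding strongly_left_ss_injective_def by blast
  then show ?thesis using f unfolding homs_extend_def by blast
next
  case False
  interpret N: left_module R N by fact
  note VD = N.submoduleD[OF V]
  obtain L where L: "submodule L R N" "L \<noteq> carrier N" "V <+>\<^bsub>N\<^esub> L = carrier N"
    using False V unfolding small_submodule_def by blast
  note LD = N.submoduleD[OF L(1)]
  have "submodule (V \<inter> L) R (N\<lparr>carrier := V\<rparr>)"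
    unfolding submodule_iff[OF left_module_restrict[OF N V]] using VD LD by auto
  then have "V \<inter> L = {\<zero>\<^bsub>N\<^esub>} \<or> V \<inter> L = V"
    using simple unfolding simple_module_def by auto
  moreover have "V \<inter> L \<noteq> V"
  proof
    assume "V \<inter> L = V"
    then have VL: "V \<subseteq> L" by blast
    have "carrier N \<subseteq> L"
      unfolding L(3)[symmetric] set_add_def' using VL LD(3) by blast
    then show False using L(2) LD(1) by blast
  qed
  ultimately have disj: "V \<inter> L = {\<zero>\<^bsub>N\<^esub>}" by blast
  show ?thesis using extends_from_simple_summand[OF N V L(1,3) disj f] .
qed

definition pair_module :: "('a, 'r) ring_scheme \<Rightarrow> ('a, 'a \<times> 'a) module"
  where "pair_module R = \<lparr>carrier = carrier R \<times> carrier R, monoid.mult = undefined, one = undefined,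
    ring.zero = (\<zero>\<^bsub>R\<^esub>, \<zero>\<^bsub>R\<^esub>), ring.add = (\<lambda>(x, y) (x', y'). (x \<oplus>\<^bsub>R\<^esub> x', y \<oplus>\<^bsub>R\<^esub> y')),
    smult = (\<lambda>a (x, y). (a \<otimes>\<^bsub>R\<^esub> x, a \<otimes>\<^bsub>R\<^esub> y))\<rparr>"

text \<open>
  Codes for the elements of \<open>R \<oplus> R\<close> and of \<open>R\<close> in the universe; the tags \<open>0\<close> and \<open>1\<close> recover the order
  of the two components.
\<close>

definition pair_code :: "'a \<times> 'a \<Rightarrow> ('a, 'm) module_universe"
  where "pair_code p = Inr {(fst p, 0), (snd p, 1)}"

definition elem_code :: "'a \<Rightarrow> ('a, 'm) module_universe"
  where "elem_code a = Inr {(a, 0)}"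

lemma inj_pair_code: "inj pair_code"
  by (rule injI) (auto simp: pair_code_def prod_eq_iff doubleton_eq_iff)

lemma inj_elem_code: "inj elem_code"
  by (rule injI) (auto simp: elem_code_def)

context ring
begin

lemma pair_module_simps [simp]:
  "carrier (pair_module R) = carrier R \<times> carrier R" "\<zero>\<^bsub>pair_module R\<^esub> = (\<zero>, \<zero>)"
  "(x, y) \<oplus>\<^bsub>pair_module R\<^esub> (x', y') = (x \<oplus> x', y \<oplus> y')"
  "a \<odot>\<^bsub>pair_module R\<^esub> (x, y) = (a \<otimes> x, a \<otimes> y)"
  by (simp_all add: pair_module_def)

lemma left_module_pair: "left_module R (pair_module R)"
proof -
  have inverse: "\<exists>y\<in>carrier R. y \<oplus> x = \<zero>" if "x \<in> carrier R" for x
    using that by (metis a_inv_closed l_neg)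
  have "abelian_group (pair_module R)"
    by (rule abelian_groupI) (auto simp: a_ac inverse)
  then show ?thesis
    by (intro left_module.intro ring_axioms left_module_axioms.intro)
      (auto simp: l_distr r_distr m_assoc)
qed

text \<open>
  The module \<open>N\<close> is the quotient of \<open>R \<oplus> R\<close> by the graph of \<open>-f\<close>. The second copy of \<open>R\<close> embeds in it
  by \<open>i\<close>, and \<open>i(Rs)\<close> is a simple submodule. If \<open>g : N \<rightarrow> R\<close> extends the inverse of \<open>i\<close> on it, then
  \<open>u = g(i(1))\<close>, and \<open>v\<close> is the value of \<open>g\<close> at the class of \<open>(1, 0)\<close>.
\<close>

lemma pushout_extension:
  assumes ss: "strongly_left_ss_injective TYPE(('a, 'm) module_universe) R"
    and f: "left_ideal_hom R I f" and s: "s \<in> simple_mod R {\<zero>}" "s \<noteq> \<zero>"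
  obtains u v where "u \<in> carrier R" "v \<in> carrier R" "s \<otimes> u = s" "\<And>x. x \<in> I \<Longrightarrow> f x \<otimes> u = x \<otimes> v"
proof -
  note fD = left_ideal_homD[OF f]
  note ID = left_idealD[OF fD(1)]
  have sc: "s \<in> carrier R" using simple_modD(1)[OF s(1)] .
  interpret D: left_module R "pair_module R" by (rule left_module_pair)
  define K where "K = {(x, \<ominus> f x) | x. x \<in> I}"
  have K: "submodule K R (pair_module R)"
    unfolding submodule_iff[OF left_module_pair]
  proof (intro conjI ballI)
    show "K \<subseteq> carrier (pair_module R)" using ID(1) fD(2) by (auto simp: K_def)
    show "\<zero>\<^bsub>pair_module R\<^esub> \<in> K" using ID(2) fD(5) by (force simp: K_def)
  next
    fix p q assume "p \<in> K" "q \<in> K"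
    then obtain x y where "p = (x, \<ominus> f x)" "q = (y, \<ominus> f y)" "x \<in> I" "y \<in> I" by (auto simp: K_def)
    then have "p \<oplus>\<^bsub>pair_module R\<^esub> q = (x \<oplus> y, \<ominus> f (x \<oplus> y))" "x \<oplus> y \<in> I"
      using fD(2,3) ID(3) by (simp_all add: minus_add)
    then show "p \<oplus>\<^bsub>pair_module R\<^esub> q \<in> K" by (auto simp: K_def)
  next
    fix a p assume a: "a \<in> carrier R" and "p \<in> K"
    then obtain x where "p = (x, \<ominus> f x)" "x \<in> I" by (auto simp: K_def)
    then have "a \<odot>\<^bsub>pair_module R\<^esub> p = (a \<otimes> x, \<ominus> f (a \<otimes> x))" "a \<otimes> x \<in> I"
      using fD(2,4) ID(4) a by (simp_all add: r_minus)
    then show "a \<odot>\<^bsub>pair_module R\<^esub> p \<in> K" by (auto simp: K_def)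
  qed
  obtain N :: "('a, ('a, 'm) module_universe) module" and \<pi> where N: "left_module R N"
    and \<pi>: "\<And>x. x \<in> carrier (pair_module R) \<Longrightarrow> \<pi> x \<in> carrier N"
    "\<And>x y. x \<in> carrier (pair_module R) \<Longrightarrow> y \<in> carrier (pair_module R) \<Longrightarrow>
      \<pi> (x \<oplus>\<^bsub>pair_module R\<^esub> y) = \<pi> x \<oplus>\<^bsub>N\<^esub> \<pi> y"
    "\<And>a x. a \<in> carrier R \<Longrightarrow> x \<in> carrier (pair_module R) \<Longrightarrow>
      \<pi> (a \<odot>\<^bsub>pair_module R\<^esub> x) = a \<odot>\<^bsub>N\<^esub> \<pi> x"
    "\<pi> \<zero>\<^bsub>pair_module R\<^esub> = \<zero>\<^bsub>N\<^esub>"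
    "\<And>x y. x \<in> carrier (pair_module R) \<Longrightarrow> y \<in> carrier (pair_module R) \<Longrightarrow>
      \<pi> x = \<pi> y \<longleftrightarrow> x \<ominus>\<^bsub>pair_module R\<^esub> y \<in> K"
    by (rule D.quotient_module_exists[OF K inj_pair_code]) blast
  interpret N: left_module R N by fact
  define i where "i b = \<pi> (\<zero>, b)" for b
  have ic: "i b \<in> carrier N" if "b \<in> carrier R" for b using \<pi>(1) that by (simp add: i_def)
  have ia: "i (b \<oplus> c) = i b \<oplus>\<^bsub>N\<^esub> i c" if "b \<in> carrier R" "c \<in> carrier R" for b c
    using \<pi>(2)[of "(\<zero>, b)" "(\<zero>, c)"] that by (simp add: i_def)
  have im: "i (a \<otimes> b) = a \<odot>\<^bsub>N\<^esub> i b" if "a \<in> carrier R" "b \<in> carrier R" for a b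
    using \<pi>(3)[of a "(\<zero>, b)"] that by (simp add: i_def)
  have i0: "i \<zero> = \<zero>\<^bsub>N\<^esub>" using \<pi>(4) by (simp add: i_def)
  have neg: "\<ominus>\<^bsub>pair_module R\<^esub> (\<zero>, b) = (\<zero>, \<ominus> b)" if "b \<in> carrier R" for b
    using D.M.minus_equality[of "(\<zero>, \<ominus> b)" "(\<zero>, b)"] that by (simp add: l_neg)
  have inj: "b = c" if bc: "b \<in> carrier R" "c \<in> carrier R" "i b = i c" for b c
  proof -
    have "(\<zero>, b) \<ominus>\<^bsub>pair_module R\<^esub> (\<zero>, c) \<in> K"
      using \<pi>(5)[of "(\<zero>, b)" "(\<zero>, c)"] bc by (simp add: i_def)
    moreover have "(\<zero>, b) \<ominus>\<^bsub>pair_module R\<^esub> (\<zero>, c) = (\<zero>, b \<ominus> c)"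
      using bc neg by (simp add: a_minus_def)
    ultimately have "b \<ominus> c = \<zero>" using fD(5) by (auto simp: K_def)
    then show ?thesis using bc by (simp add: r_right_minus_eq)
  qed
  have inj0: "b = \<zero>" if "b \<in> carrier R" "i b = \<zero>\<^bsub>N\<^esub>" for b
    using inj[OF that(1) zero_closed] that(2) i0 by simp
  define V where "V = (\<lambda>r. i (r \<otimes> s)) ` carrier R"
  have V: "submodule V R N"
    unfolding submodule_iff[OF N]
  proof (intro conjI ballI)
    show "V \<subseteq> carrier N" using ic sc by (auto simp: V_def)
    show "\<zero>\<^bsub>N\<^esub> \<in> V" unfolding V_def using sc i0 by (intro image_eqI[of _ _ \<zero>]) auto
  next
    fix p q assume "p \<in> V" "q \<in> V"
    then obtain r t where "p = i (r \<otimes> s)" "q = i (t \<otimes> s)" "r \<in> carrier R" "t \<in> carrier R" by (auto simp: V_def)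
    then have "p \<oplus>\<^bsub>N\<^esub> q = i ((r \<oplus> t) \<otimes> s)" "r \<oplus> t \<in> carrier R" using ia sc by (simp_all add: l_distr)
    then show "p \<oplus>\<^bsub>N\<^esub> q \<in> V" unfolding V_def by blast
  next
    fix a p assume a: "a \<in> carrier R" and "p \<in> V"
    then obtain r where "p = i (r \<otimes> s)" "r \<in> carrier R" by (auto simp: V_def)
    then have "a \<odot>\<^bsub>N\<^esub> p = i ((a \<otimes> r) \<otimes> s)" "a \<otimes> r \<in> carrier R" using im sc a by (simp_all add: m_assoc)
    then show "a \<odot>\<^bsub>N\<^esub> p \<in> V" unfolding V_def by blast
  qed
  have sV: "i s \<in> V" unfolding V_def using sc by (intro image_eqI[of _ _ \<one>]) auto
  have simple: "simple_module R (N\<lparr>carrier := V\<rparr>)"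
    unfolding simple_module_def
  proof (intro conjI allI impI)
    show lm: "left_module R (N\<lparr>carrier := V\<rparr>)" using left_module_restrict[OF N V] .
    show "carrier (N\<lparr>carrier := V\<rparr>) \<noteq> {\<zero>\<^bsub>N\<lparr>carrier := V\<rparr>\<^esub>}" using sV inj0[OF sc] s(2) by auto
    fix H assume "submodule H R (N\<lparr>carrier := V\<rparr>)"
    then have H: "H \<subseteq> V" "\<zero>\<^bsub>N\<^esub> \<in> H" "\<And>a x. a \<in> carrier R \<Longrightarrow> x \<in> H \<Longrightarrow> a \<odot>\<^bsub>N\<^esub> x \<in> H"
      unfolding submodule_iff[OF lm] by auto
    have "V \<subseteq> H" if h: "h \<in> H" "h \<noteq> \<zero>\<^bsub>N\<^esub>" for h
    proof -
      obtain r where r: "h = i (r \<otimes> s)" "r \<in> carrier R" using h H(1) by (auto simp: V_def)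
      have "r \<otimes> s \<notin> {\<zero>}" using h(2) r i0 by auto
      then obtain b where b: "b \<in> carrier R" "b \<otimes> (r \<otimes> s) \<ominus> s \<in> {\<zero>}" using simple_modD(2)[OF s(1) r(2)] by blast
      then have "b \<otimes> (r \<otimes> s) = s" using r(2) sc by (simp add: r_right_minus_eq)
      then have "i s = b \<odot>\<^bsub>N\<^esub> h" using im[OF b(1), of "r \<otimes> s"] r sc by simp
      then have "i s \<in> H" using H(3) b(1) h(1) by simp
      then have "a \<odot>\<^bsub>N\<^esub> i s \<in> H" if "a \<in> carrier R" for a using H(3) that by blast
      then show ?thesis using im sc by (auto simp: V_def)
    qed
    then show "H = {\<zero>\<^bsub>N\<lparr>carrier := V\<rparr>\<^esub>} \<or> H = carrier (N\<lparr>carrier := V\<rparr>)" using H(1,2) by auto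
  qed
  define j where "j w = (SOME b. b \<in> carrier R \<and> i b = w)" for w
  have j: "j (i b) = b" if "b \<in> carrier R" for b
  proof -
    have "j (i b) \<in> carrier R \<and> i (j (i b)) = i b"
      unfolding j_def by (rule someI[of _ b]) (use that in simp)
    then show ?thesis using inj that by blast
  qed
  have "j \<in> module_hom R (N\<lparr>carrier := V\<rparr>) (regular_module R)"
  proof (rule module_homI)
    fix x assume "x \<in> carrier (N\<lparr>carrier := V\<rparr>)"
    then show "j x \<in> carrier (regular_module R)" using j sc by (auto simp: V_def)
  next
    fix x y assume "x \<in> carrier (N\<lparr>carrier := V\<rparr>)" "y \<in> carrier (N\<lparr>carrier := V\<rparr>)"
    then obtain r t where "x = i (r \<otimes> s)" "y = i (t \<otimes> s)" "r \<in> carrier R" "t \<in> carrier R"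
      by (auto simp: V_def)
    then show "j (x \<oplus>\<^bsub>N\<lparr>carrier := V\<rparr>\<^esub> y) = j x \<oplus>\<^bsub>regular_module R\<^esub> j y"
      using ia[of "r \<otimes> s" "t \<otimes> s"] j[of "r \<otimes> s \<oplus> t \<otimes> s"] j sc by simp
  next
    fix a x assume "a \<in> carrier R" "x \<in> carrier (N\<lparr>carrier := V\<rparr>)"
    then obtain r where "a \<in> carrier R" "x = i (r \<otimes> s)" "r \<in> carrier R" by (auto simp: V_def)
    then show "j (a \<odot>\<^bsub>N\<lparr>carrier := V\<rparr>\<^esub> x) = a \<odot>\<^bsub>regular_module R\<^esub> j x"
      using im[of a "r \<otimes> s"] j[of "a \<otimes> (r \<otimes> s)"] j sc by simp
  qed
  then obtain g where g: "g \<in> module_hom R N (regular_module R)" "\<And>x. x \<in> V \<Longrightarrow> g x = j x"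
    using extends_from_simple[OF ss N V simple] by blast
  note gD = module_homD[OF g(1)]
  define u where "u = g (i \<one>)"
  define v where "v = g (\<pi> (\<one>, \<zero>))"
  have uc: "u \<in> carrier R" using gD(1)[OF ic[OF one_closed]] by (simp add: u_def)
  have vc: "v \<in> carrier R" using gD(1)[OF \<pi>(1), of "(\<one>, \<zero>)"] by (simp add: v_def)
  have gi: "g (i b) = b \<otimes> u" if "b \<in> carrier R" for b
    using im[OF that one_closed] gD(3)[OF that ic[OF one_closed]] that by (simp add: u_def)
  have "g (\<pi> (x, \<zero>)) = x \<otimes> v" if "x \<in> carrier R" for x
    using \<pi>(3)[OF that, of "(\<one>, \<zero>)"] gD(3)[OF that \<pi>(1), of "(\<one>, \<zero>)"] that by (simp add: v_def)
  then have rel: "x \<otimes> v = f x \<otimes> u" if x: "x \<in> I" for x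
  proof -
    have xc: "x \<in> carrier R" "f x \<in> carrier R" using ID(1) fD(2) x by auto
    have "(x, \<zero>) \<ominus>\<^bsub>pair_module R\<^esub> (\<zero>, f x) = (x, \<ominus> f x)"
      using neg[OF xc(2)] xc by (simp add: a_minus_def)
    then have "(x, \<zero>) \<ominus>\<^bsub>pair_module R\<^esub> (\<zero>, f x) \<in> K" using x by (auto simp: K_def)
    then have "\<pi> (x, \<zero>) = i (f x)" using \<pi>(5)[of "(x, \<zero>)" "(\<zero>, f x)"] xc by (simp add: i_def)
    then show ?thesis using \<open>\<And>x. x \<in> carrier R \<Longrightarrow> g (\<pi> (x, \<zero>)) = x \<otimes> v\<close>[OF xc(1)] gi[OF xc(2)] by simp
  qed
  have "s \<otimes> u = s" using gi[OF sc] g(2)[OF sV] j[OF sc] by simp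
  then show thesis using that[OF uc vc] rel by simp
qed

text \<open>
  If \<open>R s\<close> is simple and \<open>s a \<noteq> 0\<close>, then \<open>R s a \<rightarrow> R s\<close>, \<open>r s a \<mapsto> r s\<close>, is well defined. For this map the
  pushout lemma yields \<open>v\<close> with \<open>s a v = s u = s\<close>, so \<open>sR\<close> is simple as well.
\<close>

lemma simple_mod_opp:
  assumes ss: "strongly_left_ss_injective TYPE(('a, 'm) module_universe) R"
    and s: "s \<in> simple_mod R {\<zero>}"
  shows "s \<in> simple_mod (opp_ring R) {\<zero>}"
proof -
  interpret op: ring "opp_ring R" by (rule opp)
  have sc: "s \<in> carrier R" using simple_modD(1)[OF s] .
  have "\<exists>b\<in>carrier R. s \<otimes> a \<otimes> b = s" if a: "a \<in> carrier R" "s \<otimes> a \<noteq> \<zero>" for a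
  proof -
    have s0: "s \<noteq> \<zero>" using a by auto
    have kill: "r \<otimes> s = \<zero>" if r: "r \<in> carrier R" "r \<otimes> (s \<otimes> a) = \<zero>" for r
    proof (rule ccontr)
      assume "r \<otimes> s \<noteq> \<zero>"
      then obtain b where b: "b \<in> carrier R" "b \<otimes> (r \<otimes> s) \<ominus> s \<in> {\<zero>}" using simple_modD(2)[OF s r(1)] by blast
      then have "b \<otimes> (r \<otimes> s) = s" using r(1) sc by (simp add: r_right_minus_eq)
      then have "s \<otimes> a = b \<otimes> (r \<otimes> (s \<otimes> a))" using b(1) r(1) sc a(1) by (metis m_assoc m_closed)
      then show False using r(2) a(2) b(1) by simp
    qed
    define \<phi> where "\<phi> y = (SOME z. \<exists>r\<in>carrier R. y = r \<otimes> (s \<otimes> a) \<and> z = r \<otimes> s)" for y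
    have \<phi>: "\<phi> (r \<otimes> (s \<otimes> a)) = r \<otimes> s" if r: "r \<in> carrier R" for r
    proof -
      have "\<exists>t\<in>carrier R. r \<otimes> (s \<otimes> a) = t \<otimes> (s \<otimes> a) \<and> \<phi> (r \<otimes> (s \<otimes> a)) = t \<otimes> s"
        unfolding \<phi>_def by (rule someI[of _ "r \<otimes> s"]) (use r in blast)
      then obtain t where t: "t \<in> carrier R" "r \<otimes> (s \<otimes> a) = t \<otimes> (s \<otimes> a)" "\<phi> (r \<otimes> (s \<otimes> a)) = t \<otimes> s" by blast
      have "(r \<ominus> t) \<otimes> (s \<otimes> a) = r \<otimes> (s \<otimes> a) \<ominus> t \<otimes> (s \<otimes> a)" using r t(1) sc a(1) by algebra
      then have "(r \<ominus> t) \<otimes> (s \<otimes> a) = \<zero>" using t r sc a(1) by (simp add: r_right_minus_eq)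
      then have "(r \<ominus> t) \<otimes> s = \<zero>" using kill[of "r \<ominus> t"] r t(1) by simp
      moreover have "(r \<ominus> t) \<otimes> s = r \<otimes> s \<ominus> t \<otimes> s" using r t(1) sc by algebra
      ultimately show ?thesis using t r sc by (simp add: r_right_minus_eq)
    qed
    let ?I = "lsum R {\<zero>} (s \<otimes> a)"
    have sac: "s \<otimes> a \<in> carrier R" using sc a by simp
    have I: "left_ideal ?I R" "s \<otimes> a \<in> ?I" using lsum_I(1,4)[OF left_ideal_zero sac] .
    have Imem: "\<exists>r\<in>carrier R. y = r \<otimes> (s \<otimes> a)" if "y \<in> ?I" for y
      using that sac by (auto simp: lsum_def)
    have "left_ideal_hom R ?I \<phi>"
      unfolding left_ideal_hom_def
    proof (intro conjI ballI)
      show "\<phi> \<in> ?I \<rightarrow> carrier R"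
      proof
        fix y assume "y \<in> ?I"
        then obtain r where "r \<in> carrier R" "y = r \<otimes> (s \<otimes> a)" using Imem by blast
        then show "\<phi> y \<in> carrier R" using \<phi>[of r] sc by simp
      qed
    next
      fix x y assume "x \<in> ?I" "y \<in> ?I"
      then obtain r t where *: "r \<in> carrier R" "x = r \<otimes> (s \<otimes> a)" "t \<in> carrier R" "y = t \<otimes> (s \<otimes> a)" using Imem by meson
      have "x \<oplus> y = (r \<oplus> t) \<otimes> (s \<otimes> a)" using * sac by (simp add: l_distr)
      then show "\<phi> (x \<oplus> y) = \<phi> x \<oplus> \<phi> y" using \<phi>[of "r \<oplus> t"] \<phi>[of r] \<phi>[of t] * sc by (simp add: l_distr)
    next
      fix c x assume c: "c \<in> carrier R" and "x \<in> ?I"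
      then obtain r where *: "r \<in> carrier R" "x = r \<otimes> (s \<otimes> a)" using Imem by meson
      have "c \<otimes> x = (c \<otimes> r) \<otimes> (s \<otimes> a)" using * sac c by (simp add: m_assoc)
      then show "\<phi> (c \<otimes> x) = c \<otimes> \<phi> x" using \<phi>[of "c \<otimes> r"] \<phi>[of r] * sc c by (simp add: m_assoc)
    qed (rule I(1))
    then obtain u v where uv: "u \<in> carrier R" "v \<in> carrier R" "s \<otimes> u = s"
      "\<And>x. x \<in> ?I \<Longrightarrow> \<phi> x \<otimes> u = x \<otimes> v" using pushout_extension[OF ss _ s s0] by metis
    have "\<phi> (s \<otimes> a) = s" using \<phi>[of \<one>] sc sac by simp
    then have "s \<otimes> a \<otimes> v = s" using uv(4)[OF I(2)] uv(3) by simp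
    then show ?thesis using uv(2) by blast
  qed
  then show ?thesis
    using sc by (auto simp: r_right_minus_eq intro!: op.simple_mod_I) (metis m_closed r_right_minus_eq)
qed

text \<open>
  The \<open>g\<close> such that \<open>x \<mapsto> f(x) g\<close> extends to \<open>R\<close> form a right ideal \<open>G\<close>. A maximal right ideal
  containing it would be \<open>r(s)\<close> for some \<open>s\<close> that is simple on both sides, but \<open>G\<close> contains some \<open>u\<close> with
  \<open>s u = s\<close>. So \<open>G\<close> contains \<open>1\<close>.
\<close>

lemma left_baer_of_ss_injective:
  assumes ss: "strongly_left_ss_injective TYPE(('a, 'm) module_universe) R"
    and ssr: "strongly_left_ss_injective TYPE(('a, 'm) module_universe) (opp_ring R)"
    and rk: "elementwise_kasch (opp_ring R)"
  shows "left_baer R"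
  unfolding left_baer_def
proof (intro allI impI)
  interpret op: ring "opp_ring R" by (rule opp)
  fix I f assume f: "left_ideal_hom R I f"
  note fD = left_ideal_homD[OF f]
  note ID = left_idealD[OF fD(1)]
  let ?G = "{g \<in> carrier R. \<exists>v\<in>carrier R. \<forall>x\<in>I. f x \<otimes> g = x \<otimes> v}"
  have G: "right_ideal ?G R"
    unfolding right_ideal_iff
  proof (intro conjI ballI)
    show "\<zero> \<in> ?G" using fD(2) ID(1) by (auto intro!: bexI[of _ \<zero>])
  next
    fix g h assume "g \<in> ?G" "h \<in> ?G"
    then obtain v w where "g \<in> carrier R" "h \<in> carrier R" "v \<in> carrier R" "w \<in> carrier R"
      "\<forall>x\<in>I. f x \<otimes> g = x \<otimes> v" "\<forall>x\<in>I. f x \<otimes> h = x \<otimes> w" by blast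
    then show "g \<oplus> h \<in> ?G" using fD(2) ID(1) by (auto simp: r_distr intro!: bexI[of _ "v \<oplus> w"])
  next
    fix a g assume "a \<in> carrier R" "g \<in> ?G"
    then obtain v where "a \<in> carrier R" "g \<in> carrier R" "v \<in> carrier R"
      "\<forall>x\<in>I. f x \<otimes> g = x \<otimes> v" by blast
    then show "g \<otimes> a \<in> ?G"
      using fD(2) ID(1) by (auto simp: m_assoc[symmetric] intro!: bexI[of _ "v \<otimes> a"])
  qed auto
  have "\<one> \<in> ?G"
  proof (rule ccontr)
    assume "\<one> \<notin> ?G"
    then obtain F where F: "maximal_left (opp_ring R) F" "?G \<subseteq> F" using op.maximal_left_exists[OF G] by auto
    obtain s where s: "s \<in> carrier R" "s \<noteq> \<zero>" "\<And>x. x \<in> F \<Longrightarrow> s \<otimes> x = \<zero>"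
      using rk op.maximal_leftD(1,2)[OF F(1)] unfolding elementwise_kasch_def by auto
    have "s \<in> simple_mod (opp_ring R) {\<zero>}" using op.simple_mod_of_maximal_left(2)[OF F(1), of s] s by simp
    then have "s \<in> simple_mod R {\<zero>}" using op.simple_mod_opp[OF ssr] by simp
    then obtain u v where uv: "u \<in> carrier R" "v \<in> carrier R" "s \<otimes> u = s"
      "\<And>x. x \<in> I \<Longrightarrow> f x \<otimes> u = x \<otimes> v" using pushout_extension[OF ss f _ s(2)] by metis
    then have "u \<in> ?G" by blast
    then have "s \<otimes> u = \<zero>" using s(3) F(2) by blast
    then show False using uv(3) s(2) by simp
  qed
  then obtain v where v: "v \<in> carrier R" "\<forall>x\<in>I. f x \<otimes> \<one> = x \<otimes> v" by blast
  have "f x = x \<otimes> v" if "x \<in> I" for x using bspec[OF v(2) that] fD(2)[OF that] by simp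
  then show "\<exists>c\<in>carrier R. \<forall>x\<in>I. f x = x \<otimes> c" using v(1) by blast
qed

end

section \<open>From ideals back to modules\<close>

context ring
begin

lemma regular_minus: "x \<in> carrier R \<Longrightarrow> y \<in> carrier R \<Longrightarrow> x \<ominus>\<^bsub>regular_module R\<^esub> y = x \<ominus> y"
proof -
  interpret M: left_module R "regular_module R" by (rule left_module_regular_module[OF ring_axioms])
  assume "x \<in> carrier R" "y \<in> carrier R"
  then show ?thesis
    using M.M.minus_equality[of "\<ominus> y" y] by (simp add: a_minus_def l_neg)
qed

text \<open>
  For a maximal left ideal \<open>M \<supseteq> I\<close>, the image of the generator of \<open>R/M\<close> under an embedding in \<open>R\<close> is
  the required \<open>s\<close>.
\<close>

lemma elementwise_kasch_of_left_kasch: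
  assumes "left_kasch TYPE(('a, 'm) module_universe) R"
  shows "elementwise_kasch R"
  unfolding elementwise_kasch_def
proof (intro allI impI, elim conjE)
  interpret D: left_module R "regular_module R" by (rule left_module_regular_module[OF ring_axioms])
  fix I assume "left_ideal I R" "\<one> \<notin> I"
  then obtain M where M: "maximal_left R M" "I \<subseteq> M" using maximal_left_exists by blast
  note MD = left_idealD[OF maximal_leftD(1)[OF M(1)]]
  have Ms: "submodule M R (regular_module R)" using maximal_leftD(1)[OF M(1)] by (simp add: left_ideal_def)
  obtain Q :: "('a, ('a, 'm) module_universe) module" and \<pi> where Q: "left_module R Q"
    and \<pi>': "\<And>x. x \<in> carrier (regular_module R) \<Longrightarrow> \<pi> x \<in> carrier Q"
    "\<And>u. u \<in> carrier Q \<Longrightarrow> \<exists>x\<in>carrier (regular_module R). u = \<pi> x"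
    "\<And>a x. a \<in> carrier R \<Longrightarrow> x \<in> carrier (regular_module R) \<Longrightarrow>
      \<pi> (a \<odot>\<^bsub>regular_module R\<^esub> x) = a \<odot>\<^bsub>Q\<^esub> \<pi> x"
    "\<pi> \<zero>\<^bsub>regular_module R\<^esub> = \<zero>\<^bsub>Q\<^esub>"
    "\<And>x y. x \<in> carrier (regular_module R) \<Longrightarrow> y \<in> carrier (regular_module R) \<Longrightarrow>
      \<pi> x = \<pi> y \<longleftrightarrow> x \<ominus>\<^bsub>regular_module R\<^esub> y \<in> M"
    by (rule D.quotient_module_exists[OF Ms inj_elem_code]) blast
  have \<pi>: "\<pi> x \<in> carrier Q" if "x \<in> carrier R" for x using \<pi>'(1) that by simp
  have surj: "\<exists>x\<in>carrier R. u = \<pi> x" if "u \<in> carrier Q" for u using \<pi>'(2)[OF that] by simp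
  have sm: "\<pi> (a \<otimes> x) = a \<odot>\<^bsub>Q\<^esub> \<pi> x" if "a \<in> carrier R" "x \<in> carrier R" for a x using \<pi>'(3) that by simp
  have ker: "\<pi> x = \<zero>\<^bsub>Q\<^esub> \<longleftrightarrow> x \<in> M" if "x \<in> carrier R" for x
    using \<pi>'(4) \<pi>'(5)[of x \<zero>] regular_minus[OF that zero_closed] that by (simp add: a_minus_def)
  interpret Q: left_module R Q by fact
  have "simple_module R Q"
    unfolding simple_module_def
  proof (intro conjI allI impI)
    show "carrier Q \<noteq> {\<zero>\<^bsub>Q\<^esub>}" using \<pi>[OF one_closed] ker[OF one_closed] maximal_leftD(2)[OF M(1)] by auto
    fix H assume "submodule H R Q"
    note HD = Q.submoduleD[OF this]
    have "carrier Q \<subseteq> H" if h: "h \<in> H" "h \<noteq> \<zero>\<^bsub>Q\<^esub>" for h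
    proof
      fix w assume "w \<in> carrier Q"
      then obtain b where b: "b \<in> carrier R" "w = \<pi> b" using surj by blast
      obtain x where x: "x \<in> carrier R" "h = \<pi> x" using surj[OF HD(1)[OF h(1)]] by blast
      then have "x \<notin> M" using h(2) ker by simp
      then obtain y where y: "y \<in> carrier R" "\<one> \<ominus> y \<otimes> x \<in> M" using maximal_leftD(3)[OF M(1) x(1)] by blast
      have "b \<otimes> (\<one> \<ominus> y \<otimes> x) \<in> M" using MD(4)[OF b(1) y(2)] .
      then have "b \<ominus> (b \<otimes> y) \<otimes> x \<in> M" using b(1) y(1) x(1) by (simp add: mult_one_minus m_assoc)
      then have "w = \<pi> ((b \<otimes> y) \<otimes> x)"
        using \<pi>'(5)[of b "(b \<otimes> y) \<otimes> x"] regular_minus[of b "(b \<otimes> y) \<otimes> x"] b y(1) x(1) by simp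
      also have "\<dots> = (b \<otimes> y) \<odot>\<^bsub>Q\<^esub> h" using sm[of "b \<otimes> y" x] b(1) y(1) x by simp
      finally show "w \<in> H" using HD(4)[OF _ h(1), of "b \<otimes> y"] b(1) y(1) by simp
    qed
    then show "H = {\<zero>\<^bsub>Q\<^esub>} \<or> H = carrier Q" using HD(1,2) by blast
  qed (rule Q)
  then have "embeds R Q (regular_module R)" using assms unfolding left_kasch_def by blast
  then obtain f where f: "f \<in> module_hom R Q (regular_module R)" "inj_on f (carrier Q)"
    unfolding embeds_def by blast
  note fD = module_homD[OF f(1)]
  define s where "s = f (\<pi> \<one>)"
  have sc: "s \<in> carrier R" using fD(1)[OF \<pi>[OF one_closed]] by (simp add: s_def)
  have fx: "f (\<pi> x) = x \<otimes> s" if "x \<in> carrier R" for x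
    using sm[OF that one_closed] fD(3)[OF that \<pi>[OF one_closed]] that by (simp add: s_def)
  have f0: "f \<zero>\<^bsub>Q\<^esub> = \<zero>" using fx[OF zero_closed] \<pi>'(4) sc by simp
  have "s \<noteq> \<zero>"
  proof
    assume "s = \<zero>"
    then have "f (\<pi> \<one>) = f \<zero>\<^bsub>Q\<^esub>" using f0 by (simp add: s_def)
    then have "\<pi> \<one> = \<zero>\<^bsub>Q\<^esub>" using f(2) \<pi> by (auto dest: inj_onD)
    then show False using ker[OF one_closed] maximal_leftD(2)[OF M(1)] by simp
  qed
  moreover have "x \<otimes> s = \<zero>" if "x \<in> I" for x
  proof -
    have "x \<in> M" "x \<in> carrier R" using that M(2) MD(1) by auto
    then show ?thesis using fx ker f0 by metis
  qed
  ultimately show "\<exists>s\<in>carrier R. s \<noteq> \<zero> \<and> (\<forall>x\<in>I. x \<otimes> s = \<zero>)" using sc by blast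
qed

text \<open>
  A simple module is \<open>R x\<close> for any nonzero \<open>x\<close>. The annihilator of \<open>x\<close> is proper, hence kills some
  \<open>s \<noteq> 0\<close>, and \<open>r x \<mapsto> r s\<close> is an embedding.
\<close>

lemma left_kasch_of_elementwise_kasch:
  assumes lk: "elementwise_kasch R"
  shows "left_kasch TYPE('u) R"
  unfolding left_kasch_def
proof (intro allI impI)
  fix M :: "('a, 'u) module"
  assume simple: "simple_module R M"
  then have lm: "left_module R M" by (simp add: simple_module_def)
  interpret M: left_module R M by fact
  obtain x where x: "x \<in> carrier M" "x \<noteq> \<zero>\<^bsub>M\<^esub>"
    using simple M.M.zero_closed unfolding simple_module_def by blast
  let ?A = "{a \<in> carrier R. a \<odot>\<^bsub>M\<^esub> x = \<zero>\<^bsub>M\<^esub>}"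
  have "left_ideal ?A R"
    using x(1) M.smult_zero_r by (auto simp: left_ideal_iff M.smult_zero_l M.smult_l_distr M.smult_assoc1)
  moreover have "\<one> \<notin> ?A" using x by simp
  ultimately obtain s where s: "s \<in> carrier R" "s \<noteq> \<zero>" "\<And>a. a \<in> ?A \<Longrightarrow> a \<otimes> s = \<zero>"
    using lk unfolding elementwise_kasch_def by blast
  have gen: "\<exists>r\<in>carrier R. w = r \<odot>\<^bsub>M\<^esub> y" if y: "y \<in> carrier M" "y \<noteq> \<zero>\<^bsub>M\<^esub>" and w: "w \<in> carrier M" for y w
  proof -
    let ?H = "(\<lambda>r. r \<odot>\<^bsub>M\<^esub> y) ` carrier R"
    have "submodule ?H R M"
      unfolding submodule_iff[OF lm]
    proof (intro conjI ballI)
      show "?H \<subseteq> carrier M" using y(1) by auto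
      show "\<zero>\<^bsub>M\<^esub> \<in> ?H" using M.smult_zero_l[OF y(1)] by (intro image_eqI[of _ _ \<zero>]) auto
    next
      fix p q assume "p \<in> ?H" "q \<in> ?H"
      then obtain r t where "p = r \<odot>\<^bsub>M\<^esub> y" "q = t \<odot>\<^bsub>M\<^esub> y" "r \<in> carrier R" "t \<in> carrier R" by blast
      then show "p \<oplus>\<^bsub>M\<^esub> q \<in> ?H" using y(1) by (intro image_eqI[of _ _ "r \<oplus> t"]) (auto simp: M.smult_l_distr)
    next
      fix a p assume "a \<in> carrier R" "p \<in> ?H"
      then obtain r where "a \<in> carrier R" "p = r \<odot>\<^bsub>M\<^esub> y" "r \<in> carrier R" by blast
      then show "a \<odot>\<^bsub>M\<^esub> p \<in> ?H" using y(1) by (intro image_eqI[of _ _ "a \<otimes> r"]) (auto simp: M.smult_assoc1)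
    qed
    moreover have "y \<in> ?H" using y(1) by (intro image_eqI[of _ _ \<one>]) auto
    ultimately have "?H = carrier M" using simple y(2) unfolding simple_module_def by blast
    then show ?thesis using w by blast
  qed
  define f where "f w = (SOME z. \<exists>r\<in>carrier R. w = r \<odot>\<^bsub>M\<^esub> x \<and> z = r \<otimes> s)" for w
  have f: "f (r \<odot>\<^bsub>M\<^esub> x) = r \<otimes> s" if r: "r \<in> carrier R" for r
  proof -
    have "\<exists>t\<in>carrier R. r \<odot>\<^bsub>M\<^esub> x = t \<odot>\<^bsub>M\<^esub> x \<and> f (r \<odot>\<^bsub>M\<^esub> x) = t \<otimes> s"
      unfolding f_def by (rule someI[of _ "r \<otimes> s"]) (use r in blast)
    then obtain t where t: "t \<in> carrier R" "r \<odot>\<^bsub>M\<^esub> x = t \<odot>\<^bsub>M\<^esub> x" "f (r \<odot>\<^bsub>M\<^esub> x) = t \<otimes> s" by blast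
    have "(r \<ominus> t) \<odot>\<^bsub>M\<^esub> x \<oplus>\<^bsub>M\<^esub> t \<odot>\<^bsub>M\<^esub> x = t \<odot>\<^bsub>M\<^esub> x"
      using r t(1,2) x(1) by (simp add: a_minus_def a_assoc l_neg flip: M.smult_l_distr)
    then have "r \<ominus> t \<in> ?A" using r t(1) x(1) M.M.add.r_cancel_one by simp
    then have "(r \<ominus> t) \<otimes> s = \<zero>" by (rule s(3))
    moreover have "(r \<ominus> t) \<otimes> s = r \<otimes> s \<ominus> t \<otimes> s" using r t(1) s(1) by algebra
    ultimately show ?thesis using t r s(1) by (simp add: r_right_minus_eq)
  qed
  have hom: "f \<in> module_hom R M (regular_module R)"
  proof (rule module_homI)
    fix w assume "w \<in> carrier M"
    then obtain r where "r \<in> carrier R" "w = r \<odot>\<^bsub>M\<^esub> x" using gen[OF x] by blast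
    then show "f w \<in> carrier (regular_module R)" using f s(1) by simp
  next
    fix w z assume "w \<in> carrier M" "z \<in> carrier M"
    then obtain r t where *: "r \<in> carrier R" "w = r \<odot>\<^bsub>M\<^esub> x" "t \<in> carrier R" "z = t \<odot>\<^bsub>M\<^esub> x"
      using gen[OF x] by meson
    then have "w \<oplus>\<^bsub>M\<^esub> z = (r \<oplus> t) \<odot>\<^bsub>M\<^esub> x" using x(1) by (simp add: M.smult_l_distr)
    then show "f (w \<oplus>\<^bsub>M\<^esub> z) = f w \<oplus>\<^bsub>regular_module R\<^esub> f z"
      using f[of "r \<oplus> t"] f[of r] f[of t] * s(1) by (simp add: l_distr)
  next
    fix a w assume a: "a \<in> carrier R" and "w \<in> carrier M"
    then obtain r where *: "r \<in> carrier R" "w = r \<odot>\<^bsub>M\<^esub> x" using gen[OF x] by blast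
    then have "a \<odot>\<^bsub>M\<^esub> w = (a \<otimes> r) \<odot>\<^bsub>M\<^esub> x" using x(1) a by (simp add: M.smult_assoc1)
    then show "f (a \<odot>\<^bsub>M\<^esub> w) = a \<odot>\<^bsub>regular_module R\<^esub> f w"
      using f[of "a \<otimes> r"] f[of r] * a s(1) by (simp add: m_assoc)
  qed
  note hD = module_homD[OF hom]
  have ker: "w = \<zero>\<^bsub>M\<^esub>" if w: "w \<in> carrier M" "f w = \<zero>" for w
  proof (rule ccontr)
    assume "w \<noteq> \<zero>\<^bsub>M\<^esub>"
    then obtain b where b: "b \<in> carrier R" "x = b \<odot>\<^bsub>M\<^esub> w" using gen[OF w(1) _ x(1)] by blast
    have "f x = s" using f[of \<one>] x(1) s(1) by simp
    moreover have "f x = b \<otimes> f w" using hD(3)[OF b(1) w(1)] b(2) by simp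
    ultimately show False using s(2) w(2) b(1) by simp
  qed
  have "inj_on f (carrier M)"
  proof (rule inj_onI)
    fix w z assume wz: "w \<in> carrier M" "z \<in> carrier M" "f w = f z"
    have d: "w \<ominus>\<^bsub>M\<^esub> z \<in> carrier M" using wz by simp
    have "f w = f (w \<ominus>\<^bsub>M\<^esub> z) \<oplus> f z"
      using hD(2)[OF d wz(2)] wz by (simp add: a_minus_def M.M.a_assoc M.M.l_neg)
    then have "f (w \<ominus>\<^bsub>M\<^esub> z) = \<zero>"
      using wz hD(1)[OF d] hD(1)[OF wz(2)] add.r_cancel_one[of "f z" "f (w \<ominus>\<^bsub>M\<^esub> z)"] by simp
    then show "w = z" using ker[OF d] M.minus_eq_zero[OF wz(1,2)] by simp
  qed
  then show "embeds R M (regular_module R)" using hom unfolding embeds_def by blast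
qed

text \<open>
  Self-injectivity is tested on the copy of \<open>R\<close> inside the universe, obtained as the quotient by \<open>0\<close>.
\<close>

lemma left_baer_of_left_self_injective:
  assumes "left_self_injective TYPE(('a, 'm) module_universe) R"
  shows "left_baer R"
  unfolding left_baer_def
proof (intro allI impI)
  interpret D: left_module R "regular_module R" by (rule left_module_regular_module[OF ring_axioms])
  fix I f assume f: "left_ideal_hom R I f"
  note fD = left_ideal_homD[OF f] note ID = left_idealD[OF fD(1)]
  have z: "submodule {\<zero>} R (regular_module R)" using left_ideal_zero by (simp add: left_ideal_def)
  obtain Q :: "('a, ('a, 'm) module_universe) module" and \<pi> where Q: "left_module R Q"
    and \<pi>': "\<And>x. x \<in> carrier (regular_module R) \<Longrightarrow> \<pi> x \<in> carrier Q"
    "\<And>x y. x \<in> carrier (regular_module R) \<Longrightarrow> y \<in> carrier (regular_module R) \<Longrightarrow>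
      \<pi> (x \<oplus>\<^bsub>regular_module R\<^esub> y) = \<pi> x \<oplus>\<^bsub>Q\<^esub> \<pi> y"
    "\<And>a x. a \<in> carrier R \<Longrightarrow> x \<in> carrier (regular_module R) \<Longrightarrow>
      \<pi> (a \<odot>\<^bsub>regular_module R\<^esub> x) = a \<odot>\<^bsub>Q\<^esub> \<pi> x"
    "\<pi> \<zero>\<^bsub>regular_module R\<^esub> = \<zero>\<^bsub>Q\<^esub>"
    "\<And>x y. x \<in> carrier (regular_module R) \<Longrightarrow> y \<in> carrier (regular_module R) \<Longrightarrow>
      \<pi> x = \<pi> y \<longleftrightarrow> x \<ominus>\<^bsub>regular_module R\<^esub> y \<in> {\<zero>}"
    by (rule D.quotient_module_exists[OF z inj_elem_code]) blast
  have \<pi>c: "\<pi> x \<in> carrier Q" if "x \<in> carrier R" for x using \<pi>'(1) that by simp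
  have add: "\<pi> (x \<oplus> y) = \<pi> x \<oplus>\<^bsub>Q\<^esub> \<pi> y" if "x \<in> carrier R" "y \<in> carrier R" for x y
    using \<pi>'(2)[of x y] that by simp
  have sm: "\<pi> (a \<otimes> x) = a \<odot>\<^bsub>Q\<^esub> \<pi> x" if "a \<in> carrier R" "x \<in> carrier R" for a x
    using \<pi>'(3) that by simp
  have inj: "x = y" if "x \<in> carrier R" "y \<in> carrier R" "\<pi> x = \<pi> y" for x y
    using \<pi>'(5)[of x y] that regular_minus[OF that(1,2)] by (simp add: r_right_minus_eq)
  have sub: "submodule (\<pi> ` I) R Q"
    unfolding submodule_iff[OF Q]
  proof (intro conjI ballI)
    show "\<pi> ` I \<subseteq> carrier Q" using \<pi>c ID(1) by auto
    show "\<zero>\<^bsub>Q\<^esub> \<in> \<pi> ` I" using \<pi>'(4) ID(2) by (intro image_eqI[of _ _ \<zero>]) auto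
  next
    fix p q assume "p \<in> \<pi> ` I" "q \<in> \<pi> ` I"
    then obtain x y where "p = \<pi> x" "q = \<pi> y" "x \<in> I" "y \<in> I" by blast
    then show "p \<oplus>\<^bsub>Q\<^esub> q \<in> \<pi> ` I" using add ID(1,3) by (intro image_eqI[of _ _ "x \<oplus> y"]) auto
  next
    fix a p assume "a \<in> carrier R" "p \<in> \<pi> ` I"
    then obtain x where "a \<in> carrier R" "p = \<pi> x" "x \<in> I" by blast
    then show "a \<odot>\<^bsub>Q\<^esub> p \<in> \<pi> ` I" using sm ID(1,4) by (intro image_eqI[of _ _ "a \<otimes> x"]) auto
  qed
  define h where "h w = f (SOME x. x \<in> carrier R \<and> \<pi> x = w)" for w
  have h: "h (\<pi> x) = f x" if x: "x \<in> carrier R" for x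
  proof -
    have "(SOME y. y \<in> carrier R \<and> \<pi> y = \<pi> x) = x" using x inj by (intro some_equality) auto
    then show ?thesis by (simp add: h_def)
  qed
  have "h \<in> module_hom R (Q\<lparr>carrier := \<pi> ` I\<rparr>) (regular_module R)"
  proof (rule module_homI)
    fix w assume "w \<in> carrier (Q\<lparr>carrier := \<pi> ` I\<rparr>)"
    then show "h w \<in> carrier (regular_module R)" using h ID(1) fD(2) by auto
  next
    fix p q assume "p \<in> carrier (Q\<lparr>carrier := \<pi> ` I\<rparr>)" "q \<in> carrier (Q\<lparr>carrier := \<pi> ` I\<rparr>)"
    then obtain x y where "p = \<pi> x" "q = \<pi> y" "x \<in> I" "y \<in> I" by auto
    then show "h (p \<oplus>\<^bsub>Q\<lparr>carrier := \<pi> ` I\<rparr>\<^esub> q) = h p \<oplus>\<^bsub>regular_module R\<^esub> h q"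
      using add[of x y] h[of "x \<oplus> y"] h[of x] h[of y] ID(1) fD(3) by simp
  next
    fix a p assume "a \<in> carrier R" "p \<in> carrier (Q\<lparr>carrier := \<pi> ` I\<rparr>)"
    then obtain x where "a \<in> carrier R" "p = \<pi> x" "x \<in> I" by auto
    then show "h (a \<odot>\<^bsub>Q\<lparr>carrier := \<pi> ` I\<rparr>\<^esub> p) = a \<odot>\<^bsub>regular_module R\<^esub> h p"
      using sm[of a x] h[of "a \<otimes> x"] h[of x] ID(1) fD(4) by simp
  qed
  moreover have "homs_extend R Q (\<pi> ` I) (regular_module R)"
    using assms Q sub unfolding left_self_injective_def injective_module_def by blast
  ultimately obtain g where g: "g \<in> module_hom R Q (regular_module R)" "\<And>w. w \<in> \<pi> ` I \<Longrightarrow> g w = h w"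
    unfolding homs_extend_def by blast
  have "f x = x \<otimes> g (\<pi> \<one>)" if x: "x \<in> I" for x
  proof -
    have "f x = g (\<pi> x)" using g(2) h ID(1) x by simp
    also have "\<dots> = g (x \<odot>\<^bsub>Q\<^esub> \<pi> \<one>)" using sm[OF ID(1)[OF x] one_closed] ID(1)[OF x] by simp
    also have "\<dots> = x \<otimes> g (\<pi> \<one>)"
      using module_homD(3)[OF g(1) ID(1)[OF x] \<pi>c[OF one_closed]] by simp
    finally show ?thesis .
  qed
  moreover have "g (\<pi> \<one>) \<in> carrier R" using module_homD(1)[OF g(1) \<pi>c[OF one_closed]] by simp
  ultimately show "\<exists>c\<in>carrier R. \<forall>x\<in>I. f x = x \<otimes> c" by blast
qed

text \<open>
  Zorn's lemma is applied to the graphs \<open>G\<close> of linear maps from submodules of \<open>N\<close> to \<open>R\<close> that extend \<open>f\<close>.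
  If \<open>z\<close> is outside the domain of a maximal one, then \<open>a \<mapsto> G(a z)\<close> is defined on a left ideal and given
  by some \<open>c\<close>, so \<open>z \<mapsto> c\<close> enlarges \<open>G\<close>.
\<close>

lemma baer_criterion:
  fixes N :: "('a, 'u) module"
  assumes lb: "left_baer R" and N: "left_module R N" and K: "submodule K R N"
  shows "homs_extend R N K (regular_module R)"
  unfolding homs_extend_def
proof
  interpret N: left_module R N by fact
  note KD = N.submoduleD[OF K]
  fix f assume f: "f \<in> module_hom R (N\<lparr>carrier := K\<rparr>) (regular_module R)"
  have fc: "\<And>x. x \<in> K \<Longrightarrow> f x \<in> carrier R" and fa: "\<And>x y. x \<in> K \<Longrightarrow> y \<in> K \<Longrightarrow> f (x \<oplus>\<^bsub>N\<^esub> y) = f x \<oplus> f y"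
    and fm: "\<And>a x. a \<in> carrier R \<Longrightarrow> x \<in> K \<Longrightarrow> f (a \<odot>\<^bsub>N\<^esub> x) = a \<otimes> f x"
    using module_homD[OF f] by simp_all
  define lin where "lin G \<longleftrightarrow> G \<subseteq> carrier N \<times> carrier R \<and>
    (\<forall>x y x' y'. (x, y) \<in> G \<and> (x', y') \<in> G \<longrightarrow> (x \<oplus>\<^bsub>N\<^esub> x', y \<oplus> y') \<in> G) \<and>
    (\<forall>a x y. a \<in> carrier R \<and> (x, y) \<in> G \<longrightarrow> (a \<odot>\<^bsub>N\<^esub> x, a \<otimes> y) \<in> G) \<and>
    (\<forall>y. (\<zero>\<^bsub>N\<^esub>, y) \<in> G \<longrightarrow> y = \<zero>)" for G
  have linD: "G \<subseteq> carrier N \<times> carrier R"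
    "\<And>x y x' y'. (x, y) \<in> G \<Longrightarrow> (x', y') \<in> G \<Longrightarrow> (x \<oplus>\<^bsub>N\<^esub> x', y \<oplus> y') \<in> G"
    "\<And>a x y. a \<in> carrier R \<Longrightarrow> (x, y) \<in> G \<Longrightarrow> (a \<odot>\<^bsub>N\<^esub> x, a \<otimes> y) \<in> G"
    "\<And>y. (\<zero>\<^bsub>N\<^esub>, y) \<in> G \<Longrightarrow> y = \<zero>" if "lin G" for G
    using that unfolding lin_def by simp_all
  let ?F = "{(x, f x) | x. x \<in> K}"
  let ?A = "{G. lin G \<and> ?F \<subseteq> G}"
  have f0: "f \<zero>\<^bsub>N\<^esub> = \<zero>"
    using fm[OF zero_closed KD(2)] N.smult_zero_r[OF zero_closed] fc[OF KD(2)] by simp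
  have "lin ?F"
    unfolding lin_def
  proof (intro conjI allI impI)
    show "?F \<subseteq> carrier N \<times> carrier R" using KD(1) fc by auto
    show "(x \<oplus>\<^bsub>N\<^esub> x', y \<oplus> y') \<in> ?F" if "(x, y) \<in> ?F \<and> (x', y') \<in> ?F" for x y x' y'
      using that KD(3) fa by auto
    show "(a \<odot>\<^bsub>N\<^esub> x, a \<otimes> y) \<in> ?F" if "a \<in> carrier R \<and> (x, y) \<in> ?F" for a x y
      using that KD(4) fm by auto
    show "y = \<zero>" if "(\<zero>\<^bsub>N\<^esub>, y) \<in> ?F" for y using that f0 by auto
  qed
  have "\<exists>M\<in>?A. \<forall>T\<in>?A. M \<subseteq> T \<longrightarrow> T = M"
  proof (rule subset_Zorn_nonempty)
    show "?A \<noteq> {}" using \<open>lin ?F\<close> by blast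
  next
    fix \<C> assume ne: "\<C> \<noteq> {}" and ch: "subset.chain ?A \<C>"
    then have sub: "\<And>G. G \<in> \<C> \<Longrightarrow> lin G \<and> ?F \<subseteq> G" by (auto simp: subset.chain_def)
    have "lin (\<Union>\<C>)"
      unfolding lin_def
    proof (intro conjI allI impI)
      show "\<Union>\<C> \<subseteq> carrier N \<times> carrier R" using sub linD(1) by (intro Union_least) simp
      show "(x \<oplus>\<^bsub>N\<^esub> x', y \<oplus> y') \<in> \<Union>\<C>" if "(x, y) \<in> \<Union>\<C> \<and> (x', y') \<in> \<Union>\<C>" for x y x' y'
      proof -
        from that obtain G G' where G: "G \<in> \<C>" "G' \<in> \<C>" "(x, y) \<in> G" "(x', y') \<in> G'" by blast
        then have "G \<subseteq> G' \<or> G' \<subseteq> G" using ch unfolding subset.chain_def by blast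
        then obtain H where "H \<in> \<C>" "(x, y) \<in> H" "(x', y') \<in> H" using G by blast
        then show ?thesis using linD(2)[of H x y x' y'] sub[of H] by auto
      qed
      show "(a \<odot>\<^bsub>N\<^esub> x, a \<otimes> y) \<in> \<Union>\<C>" if "a \<in> carrier R \<and> (x, y) \<in> \<Union>\<C>" for a x y
      proof -
        from that obtain G where "G \<in> \<C>" "(x, y) \<in> G" by blast
        then show ?thesis using linD(3)[of G a x y] sub[of G] that by auto
      qed
      show "y = \<zero>" if "(\<zero>\<^bsub>N\<^esub>, y) \<in> \<Union>\<C>" for y
      proof -
        from that obtain G where "G \<in> \<C>" "(\<zero>\<^bsub>N\<^esub>, y) \<in> G" by blast
        then show ?thesis using linD(4)[of G y] sub[of G] by auto
      qed
    qed
    then show "\<Union>\<C> \<in> ?A" using sub ne by blast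
  qed
  then obtain G where GA: "G \<in> ?A" and max: "\<forall>T\<in>?A. G \<subseteq> T \<longrightarrow> T = G" by (rule bexE)
  then have G: "lin G" "?F \<subseteq> G" by simp_all
  have Gc: "x \<in> carrier N" "y \<in> carrier R" if "(x, y) \<in> G" for x y
    using linD(1)[OF G(1)] that by blast+
  note Ga = linD(2)[OF G(1)] and Gm = linD(3)[OF G(1)] and G0 = linD(4)[OF G(1)]
  have Gz: "(\<zero>\<^bsub>N\<^esub>, \<zero>) \<in> G" using G(2) KD(2) f0 by force
  have neg1: "(\<ominus> \<one>) \<odot>\<^bsub>N\<^esub> x = \<ominus>\<^bsub>N\<^esub> x" if x: "x \<in> carrier N" for x
  proof -
    have "(\<ominus> \<one>) \<odot>\<^bsub>N\<^esub> x \<oplus>\<^bsub>N\<^esub> \<one> \<odot>\<^bsub>N\<^esub> x = \<zero>\<^bsub>N\<^esub>"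
      using x by (simp add: l_neg N.smult_zero_l flip: N.smult_l_distr del: N.smult_one)
    then show ?thesis using x N.M.minus_equality[of "(\<ominus> \<one>) \<odot>\<^bsub>N\<^esub> x" x] by simp
  qed
  have Gn: "(\<ominus>\<^bsub>N\<^esub> x, \<ominus> y) \<in> G" if "(x, y) \<in> G" for x y
    using Gm[OF a_inv_closed[OF one_closed] that] neg1[OF Gc(1)[OF that]] Gc(2)[OF that] by (simp add: l_minus)
  have Geq: "y = y'" if "(x, y) \<in> G" "(x, y') \<in> G" for x y y'
  proof -
    have "(x \<oplus>\<^bsub>N\<^esub> \<ominus>\<^bsub>N\<^esub> x, y \<oplus> \<ominus> y') \<in> G" using Ga[OF that(1) Gn[OF that(2)]] .
    then have "y \<oplus> \<ominus> y' = \<zero>" using G0 Gc(1)[OF that(1)] by (simp add: N.M.r_neg)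
    then show ?thesis using Gc(2)[OF that(1)] Gc(2)[OF that(2)] r_right_minus_eq[of y y'] by (simp add: a_minus_def)
  qed
  have total: "\<exists>y. (z, y) \<in> G" if z: "z \<in> carrier N" for z
  proof (rule ccontr)
    assume no: "\<nexists>y. (z, y) \<in> G"
    let ?H = "{(a, y) | a y. a \<in> carrier R \<and> (a \<odot>\<^bsub>N\<^esub> z, y) \<in> G}"
    have "\<exists>c\<in>carrier R. \<forall>a y. (a, y) \<in> ?H \<longrightarrow> y = a \<otimes> c"
    proof (rule left_baer_relation[OF lb])
      show "?H \<subseteq> carrier R \<times> carrier R" using Gc(2) by blast
      show "(\<zero>, \<zero>) \<in> ?H" using Gz z by (simp add: N.smult_zero_l)
      show "(a \<oplus> a', y \<oplus> y') \<in> ?H" if "(a, y) \<in> ?H" "(a', y') \<in> ?H" for a y a' y'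
        using that Ga[of "a \<odot>\<^bsub>N\<^esub> z" y "a' \<odot>\<^bsub>N\<^esub> z" y'] z by (simp add: N.smult_l_distr)
      show "(b \<otimes> a, b \<otimes> y) \<in> ?H" if "b \<in> carrier R" "(a, y) \<in> ?H" for b a y
        using that Gm[of b "a \<odot>\<^bsub>N\<^esub> z" y] z by (simp add: N.smult_assoc1)
      show "y = \<zero>" if "(\<zero>, y) \<in> ?H" for y using that G0 z by (simp add: N.smult_zero_l)
    qed
    then obtain c where c: "c \<in> carrier R" "\<And>a y. a \<in> carrier R \<Longrightarrow> (a \<odot>\<^bsub>N\<^esub> z, y) \<in> G \<Longrightarrow> y = a \<otimes> c"
      by blast
    let ?G = "{(x \<oplus>\<^bsub>N\<^esub> a \<odot>\<^bsub>N\<^esub> z, y \<oplus> a \<otimes> c) | x y a. (x, y) \<in> G \<and> a \<in> carrier R}"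
    have memG: "(x \<oplus>\<^bsub>N\<^esub> a \<odot>\<^bsub>N\<^esub> z, y \<oplus> a \<otimes> c) \<in> ?G" if "(x, y) \<in> G" "a \<in> carrier R" for x y a
      using that by blast
    have "lin ?G"
      unfolding lin_def
    proof (intro conjI allI impI)
      show "?G \<subseteq> carrier N \<times> carrier R" using Gc z c(1) by auto
    next
      fix p q p' q' assume "(p, q) \<in> ?G \<and> (p', q') \<in> ?G"
      then obtain x y a x' y' a' where *: "p = x \<oplus>\<^bsub>N\<^esub> a \<odot>\<^bsub>N\<^esub> z" "q = y \<oplus> a \<otimes> c" "p' = x' \<oplus>\<^bsub>N\<^esub> a' \<odot>\<^bsub>N\<^esub> z"
        "q' = y' \<oplus> a' \<otimes> c" "(x, y) \<in> G" "(x', y') \<in> G" "a \<in> carrier R" "a' \<in> carrier R" by blast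
      have "p \<oplus>\<^bsub>N\<^esub> p' = (x \<oplus>\<^bsub>N\<^esub> x') \<oplus>\<^bsub>N\<^esub> (a \<oplus> a') \<odot>\<^bsub>N\<^esub> z" "q \<oplus> q' = (y \<oplus> y') \<oplus> (a \<oplus> a') \<otimes> c"
        unfolding *(1-4) using Gc[OF *(5)] Gc[OF *(6)] *(7,8) z c(1)
        by (simp_all add: N.smult_l_distr l_distr N.M.a_ac a_ac)
      then show "(p \<oplus>\<^bsub>N\<^esub> p', q \<oplus> q') \<in> ?G" using memG[OF Ga[OF *(5,6)], of "a \<oplus> a'"] *(7,8) by simp
    next
      fix b p q assume "b \<in> carrier R \<and> (p, q) \<in> ?G"
      then obtain x y a where *: "p = x \<oplus>\<^bsub>N\<^esub> a \<odot>\<^bsub>N\<^esub> z" "q = y \<oplus> a \<otimes> c" "(x, y) \<in> G" "a \<in> carrier R"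
        "b \<in> carrier R" by blast
      have "b \<odot>\<^bsub>N\<^esub> p = b \<odot>\<^bsub>N\<^esub> x \<oplus>\<^bsub>N\<^esub> (b \<otimes> a) \<odot>\<^bsub>N\<^esub> z" "b \<otimes> q = b \<otimes> y \<oplus> (b \<otimes> a) \<otimes> c"
        unfolding *(1,2) using Gc[OF *(3)] *(4,5) z c(1)
        by (simp_all add: N.smult_r_distr N.smult_assoc1 r_distr m_assoc)
      then show "(b \<odot>\<^bsub>N\<^esub> p, b \<otimes> q) \<in> ?G" using memG[OF Gm[OF *(5,3)], of "b \<otimes> a"] *(4,5) by simp
    next
      fix w assume "(\<zero>\<^bsub>N\<^esub>, w) \<in> ?G"
      then obtain x y a where *: "\<zero>\<^bsub>N\<^esub> = x \<oplus>\<^bsub>N\<^esub> a \<odot>\<^bsub>N\<^esub> z" "w = y \<oplus> a \<otimes> c" "(x, y) \<in> G" "a \<in> carrier R" by blast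
      have xc: "x \<in> carrier N" "y \<in> carrier R" using Gc[OF *(3)] .
      have "a \<odot>\<^bsub>N\<^esub> z \<oplus>\<^bsub>N\<^esub> x = \<zero>\<^bsub>N\<^esub>" using *(1,4) xc z by (simp add: N.M.a_comm)
      then have "\<ominus>\<^bsub>N\<^esub> x = a \<odot>\<^bsub>N\<^esub> z" using *(4) xc z by (intro N.M.minus_equality) auto
      then have "\<ominus> y = a \<otimes> c" using c(2)[OF *(4)] Gn[OF *(3)] by metis
      then show "w = \<zero>" unfolding *(2) using xc by (metis r_neg)
    qed
    moreover have GG: "G \<subseteq> ?G"
    proof
      fix p assume "p \<in> G"
      then obtain x y where p: "p = (x, y)" "(x, y) \<in> G" by (cases p) auto
      then show "p \<in> ?G" using memG[OF p(2) zero_closed] Gc[OF p(2)] z c(1) by (simp add: N.smult_zero_l)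
    qed
    moreover have "?F \<subseteq> ?G" using G(2) GG by (rule order_trans)
    ultimately have "?G = G" using max by simp
    moreover have "(z, c) \<in> ?G" using memG[OF Gz one_closed] z c(1) by simp
    ultimately show False using no by blast
  qed
  define g where "g x = (THE y. (x, y) \<in> G)" for x
  have g: "g x = y" if "(x, y) \<in> G" for x y
    unfolding g_def using that Geq by blast
  have "g \<in> module_hom R N (regular_module R)"
  proof (rule module_homI)
    fix x assume "x \<in> carrier N"
    then obtain y where "(x, y) \<in> G" using total by blast
    then show "g x \<in> carrier (regular_module R)" using g Gc by simp
  next
    fix x x' assume "x \<in> carrier N" "x' \<in> carrier N"
    then obtain y y' where *: "(x, y) \<in> G" "(x', y') \<in> G" using total by blast
    then show "g (x \<oplus>\<^bsub>N\<^esub> x') = g x \<oplus>\<^bsub>regular_module R\<^esub> g x'" using g[OF Ga[OF *]] g by simp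
  next
    fix a x assume a: "a \<in> carrier R" and "x \<in> carrier N"
    then obtain y where *: "(x, y) \<in> G" using total by blast
    then show "g (a \<odot>\<^bsub>N\<^esub> x) = a \<odot>\<^bsub>regular_module R\<^esub> g x" using g[OF Gm[OF a *]] g by simp
  qed
  moreover have "g x = f x" if "x \<in> K" for x using g G(2) that by blast
  ultimately show "\<exists>g\<in>module_hom R N (regular_module R). \<forall>x\<in>K. g x = f x" by blast
qed

lemma left_self_injective_of_left_baer: "left_baer R \<Longrightarrow> left_self_injective TYPE('u) R"
  unfolding left_self_injective_def injective_module_def
  using baer_criterion left_module_regular_module[OF ring_axioms] by blast

lemma ss_injective_of_left_baer: "left_baer R \<Longrightarrow> strongly_left_ss_injective TYPE('u) R"
  unfolding strongly_left_ss_injective_def small_submodule_def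
  using baer_criterion by blast

section \<open>The singular ideal and the chain condition\<close>

lemma singular_chains_terminate_of_artinian:
  assumes "left_artinian R"
  shows "singular_annihilator_chains_terminate R"
  unfolding singular_annihilator_chains_terminate_def
proof (intro allI impI)
  fix a :: "nat \<Rightarrow> 'a" assume "\<forall>n. a n \<in> left_singular_ideal R"
  then have a: "a n \<in> carrier R" for n by (simp add: left_singular_ideal_def)
  have p: "seq_prod R a n \<in> carrier R" for n by (induction n) (auto simp: a)
  have eq: "left_annihilator R (seq_prod R a n) = lann R {seq_prod R a n}" for n
    by (simp add: left_annihilator_def lann_def)
  have L: "left_ideal (left_annihilator R (seq_prod R a n)) R" for n
    unfolding eq using p by (intro left_ideal_lann) simp
  have "left_annihilator R (seq_prod R a n) \<subseteq> left_annihilator R (seq_prod R a (Suc n))" for n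
    using p a by (auto simp: left_annihilator_def simp flip: m_assoc)
  from acc_of_lfg[of "\<lambda>n. left_annihilator R (seq_prod R a n)", OF lfg_of_artinian[OF assms] L this]
  show "\<exists>m. \<forall>n\<ge>m. left_annihilator R (seq_prod R a n) = left_annihilator R (seq_prod R a m)" .
qed

lemma singularD:
  assumes a: "a \<in> left_singular_ideal R" and x: "x \<in> carrier R" "x \<noteq> \<zero>"
  shows "\<exists>r\<in>carrier R. r \<otimes> x \<noteq> \<zero> \<and> (r \<otimes> x) \<otimes> a = \<zero>"
proof -
  let ?L = "lsum R {\<zero>} x"
  have L: "left_ideal ?L R" "x \<in> ?L" using lsum_I(1,4)[OF left_ideal_zero x(1)] .
  have "submodule ?L R (regular_module R) \<and> ?L \<noteq> {\<zero>\<^bsub>regular_module R\<^esub>}"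
    using L x(2) by (auto simp: left_ideal_def)
  then have "left_annihilator R a \<inter> ?L \<noteq> {\<zero>}"
    using a unfolding left_singular_ideal_def essential_submodule_def by simp
  moreover have "\<zero> \<in> left_annihilator R a \<inter> ?L"
    using a left_idealD(2)[OF L(1)] by (simp add: left_annihilator_def left_singular_ideal_def)
  ultimately obtain y where "y \<in> left_annihilator R a" "y \<in> ?L" "y \<noteq> \<zero>" by blast
  then show ?thesis using x(1) by (auto simp: left_annihilator_def lsum_def)
qed

text \<open>
  If \<open>l(a) \<inter> L = 0\<close>, then \<open>y a \<mapsto> y\<close> is well defined on \<open>L a\<close>, so \<open>y a b = y\<close> on \<open>L\<close> for some \<open>b\<close>. Since
  \<open>1 - a b\<close> is a unit, \<open>L = 0\<close>.
\<close>

lemma jac_singular: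
  assumes lb: "left_baer R" and a: "a \<in> jac R"
  shows "a \<in> left_singular_ideal R"
proof -
  have ac: "a \<in> carrier R" using jac_carrier[OF a] .
  have eq: "left_annihilator R a = lann R {a}" by (simp add: left_annihilator_def lann_def)
  have li: "left_ideal (left_annihilator R a) R" unfolding eq using ac by (intro left_ideal_lann) simp
  have "left_annihilator R a \<inter> L \<noteq> {\<zero>}" if L: "left_ideal L R" "L \<noteq> {\<zero>}" for L
  proof
    assume disj: "left_annihilator R a \<inter> L = {\<zero>}"
    note LD = left_idealD[OF L(1)]
    have "z \<otimes> \<one> = \<zero>" if "h \<in> {\<zero>}" "z \<in> L" "h \<oplus> z \<otimes> a = \<zero>" for h z
    proof -
      have "z \<in> left_annihilator R a \<inter> L" using that LD(1)[OF that(2)] ac by (simp add: left_annihilator_def)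
      then show ?thesis using disj by auto
    qed
    then have "\<exists>b\<in>carrier R. (\<forall>h\<in>{\<zero>}. h \<otimes> b = \<zero>) \<and> (\<forall>z\<in>L. z \<otimes> a \<otimes> b = z \<otimes> \<one>)"
      using ac by (intro left_baer_two_term lb left_ideal_zero L(1)) blast+
    then obtain b where b: "b \<in> carrier R" "\<forall>z\<in>L. z \<otimes> a \<otimes> b = z \<otimes> \<one>" by blast
    obtain y where y: "y \<in> L" "y \<noteq> \<zero>" using L(2) LD(2) by blast
    have yc: "y \<in> carrier R" using LD(1) y(1) .
    have "y \<otimes> a \<otimes> b = y" using bspec[OF b(2) y(1)] yc by simp
    then have "y \<otimes> (\<one> \<ominus> a \<otimes> b) = \<zero>"
      using mult_one_minus(1)[OF yc, of "a \<otimes> b"] yc ac b(1) by (simp add: r_right_minus_eq m_assoc)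
    moreover have "a \<otimes> b \<in> jac R" using right_idealD(4)[OF right_ideal_jac b(1) a] .
    then obtain c where c: "c \<in> carrier R" "(\<one> \<ominus> a \<otimes> b) \<otimes> c = \<one>" using jac_one_minus by metis
    moreover have "y = (y \<otimes> (\<one> \<ominus> a \<otimes> b)) \<otimes> c" using c yc ac b(1) by (simp add: m_assoc)
    ultimately show False using c(1) y(2) by simp
  qed
  then have "essential_submodule (left_annihilator R a) R (regular_module R)"
    using li unfolding essential_submodule_def left_ideal_def by simp
  then show ?thesis using ac by (simp add: left_singular_ideal_def)
qed

text \<open>
  Otherwise there is a sequence in \<open>J\<close> whose partial products \<open>q\<^sub>n\<close> satisfy \<open>x q\<^sub>n \<notin> B\<close>. Its terms are in
  the left singular ideal, and \<open>l(q\<^sub>n a) = l(q\<^sub>n)\<close> for singular \<open>a\<close> forces \<open>q\<^sub>n = 0\<close>: else \<open>R q\<^sub>n\<close> meets \<open>l(a)\<close>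
  in a nonzero element.
\<close>

lemma essential_socles_opp_of_chains:
  assumes lb: "left_baer R" and chains: "singular_annihilator_chains_terminate R"
  shows "essential_socles (opp_ring R)"
  unfolding essential_socles_def
proof (intro allI impI, elim conjE, rule ccontr)
  fix B x assume B: "right_ideal B R" and "x \<in> carrier (opp_ring R) - B"
    and no: "\<not> (\<exists>a\<in>carrier (opp_ring R). a \<otimes>\<^bsub>opp_ring R\<^esub> x \<notin> B \<and>
      (\<forall>j\<in>jac (opp_ring R). j \<otimes>\<^bsub>opp_ring R\<^esub> (a \<otimes>\<^bsub>opp_ring R\<^esub> x) \<in> B))"
  then have x: "x \<in> carrier R" "x \<notin> B" by auto
  have "\<exists>j. j \<in> jac R \<and> x \<otimes> (a \<otimes> j) \<notin> B" if a: "a \<in> carrier R" "x \<otimes> a \<notin> B" for a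
  proof -
    obtain j where "j \<in> jac R" "(x \<otimes> a) \<otimes> j \<notin> B" using no a by auto
    then show ?thesis using x(1) a(1) jac_carrier[of j] by (auto simp: m_assoc)
  qed
  then obtain f where f: "\<And>a. a \<in> carrier R \<Longrightarrow> x \<otimes> a \<notin> B \<Longrightarrow> f a \<in> jac R \<and> x \<otimes> (a \<otimes> f a) \<notin> B"
    by metis
  define q where "q = rec_nat \<one> (\<lambda>_ a. a \<otimes> f a)"
  have q0: "q 0 = \<one>" and qS: "q (Suc n) = q n \<otimes> f (q n)" for n by (simp_all add: q_def)
  have q: "q n \<in> carrier R \<and> x \<otimes> q n \<notin> B" for n
  proof (induction n)
    case (Suc n)
    then show ?case using f[of "q n"] jac_carrier[of "f (q n)"] by (simp add: qS)
  qed (use x in \<open>simp add: q0\<close>)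
  define a where "a n = f (q n)" for n
  have aJ: "a n \<in> jac R" for n using f q by (simp add: a_def)
  have aZ: "a n \<in> left_singular_ideal R" for n using jac_singular[OF lb aJ] .
  have ac: "a n \<in> carrier R" for n using jac_carrier[OF aJ] .
  have prod: "seq_prod R a n = q (Suc n)" for n
  proof (induction n)
    case 0
    then show ?case using ac[of 0] by (simp add: q0 qS a_def)
  next
    case (Suc n)
    then show ?case by (simp add: qS[of "Suc n"] a_def)
  qed
  obtain m where m: "\<forall>n\<ge>m. left_annihilator R (seq_prod R a n) = left_annihilator R (seq_prod R a m)"
    using chains aZ unfolding singular_annihilator_chains_terminate_def by blast
  have same: "left_annihilator R (q (Suc (Suc m))) = left_annihilator R (q (Suc m))"
    using m[rule_format, of "Suc m"] by (simp only: prod le_Suc_eq) simp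
  let ?p = "q (Suc m)"
  have pc: "?p \<in> carrier R" using q by blast
  have "?p = \<zero>"
  proof (rule ccontr)
    assume "?p \<noteq> \<zero>"
    then obtain r where r: "r \<in> carrier R" "r \<otimes> ?p \<noteq> \<zero>" "(r \<otimes> ?p) \<otimes> a (Suc m) = \<zero>"
      using singularD[OF aZ pc] by blast
    have "r \<in> left_annihilator R (q (Suc (Suc m)))"
      using r(1,3) pc ac[of "Suc m"] unfolding qS[of "Suc m"] a_def[symmetric]
      by (simp add: left_annihilator_def m_assoc)
    then have "r \<in> left_annihilator R ?p" unfolding same .
    then show False using r(2) by (simp add: left_annihilator_def)
  qed
  then have "x \<otimes> q (Suc m) = \<zero>" using x(1) by simp
  then show False using q[of "Suc m"] right_idealD(2)[OF B] by simp
qed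

section \<open>The characterization\<close>

lemma two_sided_qf_of_quasi_frobenius:
  assumes "quasi_frobenius TYPE(('a, 'm) module_universe) R"
  shows "two_sided_qf R"
proof -
  interpret op: ring "opp_ring R" by (rule opp)
  have art: "left_artinian (opp_ring R) \<or> left_artinian R"
    using assms unfolding quasi_frobenius_def right_artinian_def by blast
  have "left_baer (opp_ring R) \<or> left_baer R"
    using assms op.left_baer_of_left_self_injective left_baer_of_left_self_injective
    unfolding quasi_frobenius_def right_self_injective_def by blast
  then show ?thesis
  proof
    assume "left_baer R"
    then show ?thesis using art two_sided_qf_of_right_artinian two_sided_qf_of_left_artinian by blast
  next
    assume "left_baer (opp_ring R)"
    then have "two_sided_qf (opp_ring R)"
      using art op.two_sided_qf_of_right_artinian op.two_sided_qf_of_left_artinian by auto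
    then show ?thesis by simp
  qed
qed

text \<open>
  The finiteness of the left socle gives semisimplicity of \<open>R/J\<close> on the right, and the chain condition
  gives essential socles of right modules; so it is the right artinian property that results.
\<close>

lemma right_artinian_of_duality:
  assumes lb: "left_baer R" "left_baer (opp_ring R)" and lk: "elementwise_kasch R" "elementwise_kasch (opp_ring R)"
    and mininj: "\<And>s. s \<in> simple_mod (opp_ring R) {\<zero>} \<Longrightarrow> s \<in> simple_mod R {\<zero>}"
    and chains: "singular_annihilator_chains_terminate R"
  shows "left_artinian (opp_ring R)"
proof -
  interpret op: ring "opp_ring R" by (rule opp)
  have lr: "lann R (rann R I) = I" if "left_ideal I R" for I
    using lann_rann_of_kasch[OF lb(1) lk(1) that] .
  have rl: "rann R (lann R F) = F" if "right_ideal F R" for F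
    using op.lann_rann_of_kasch[OF lb(2) lk(2) that] by simp
  have fg: "finite_socles R" "finite_socles (opp_ring R)"
    using finite_socles_of_duality[OF lb(1) lr rl] op.finite_socles_of_duality[OF lb(2)] lr rl by simp_all
  show ?thesis
    using op.artinian_of_socles[OF fg(2) semilocal_opp_of_socle[OF fg(1) lk(2) mininj]
        essential_socles_opp_of_chains[OF lb(1) chains]] .
qed

end

theorem theorem5p16:
  fixes R :: "('a, 'r) ring_scheme"
  assumes "ring R"
  shows "quasi_frobenius TYPE(('a, 'm) module_universe) R \<longleftrightarrow>
    strongly_left_ss_injective TYPE(('a, 'm) module_universe) R \<and>
    strongly_right_ss_injective TYPE(('a, 'm) module_universe) R \<and>
    left_kasch TYPE(('a, 'm) module_universe) R \<and>
    right_kasch TYPE(('a, 'm) module_universe) R \<and>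
    singular_annihilator_chains_terminate R"
proof -
  interpret ring R by fact
  interpret op: ring "opp_ring R" by (rule opp)
  show ?thesis
    unfolding strongly_right_ss_injective_def right_kasch_def
  proof (intro iffI conjI; (elim conjE)?)
    assume "quasi_frobenius TYPE(('a, 'm) module_universe) R"
    then have qf: "two_sided_qf R" by (rule two_sided_qf_of_quasi_frobenius)
    show "strongly_left_ss_injective TYPE(('a, 'm) module_universe) R"
      "strongly_left_ss_injective TYPE(('a, 'm) module_universe) (opp_ring R)"
      "left_kasch TYPE(('a, 'm) module_universe) R"
      "left_kasch TYPE(('a, 'm) module_universe) (opp_ring R)"
      "singular_annihilator_chains_terminate R"
      using qf ss_injective_of_left_baer op.ss_injective_of_left_baer left_kasch_of_elementwise_kasch
        op.left_kasch_of_elementwise_kasch singular_chains_terminate_of_artinian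
      unfolding two_sided_qf_def by blast+
  next
    assume ss: "strongly_left_ss_injective TYPE(('a, 'm) module_universe) R"
      "strongly_left_ss_injective TYPE(('a, 'm) module_universe) (opp_ring R)"
      and k: "left_kasch TYPE(('a, 'm) module_universe) R"
      "left_kasch TYPE(('a, 'm) module_universe) (opp_ring R)"
      and chains: "singular_annihilator_chains_terminate R"
    have lk: "elementwise_kasch R" "elementwise_kasch (opp_ring R)"
      using elementwise_kasch_of_left_kasch[OF k(1)] op.elementwise_kasch_of_left_kasch[OF k(2)] .
    \<comment> \<open>Injectivity on one side uses the Kasch condition on the other.\<close>
    have lb: "left_baer R" "left_baer (opp_ring R)"
      using left_baer_of_ss_injective[OF ss lk(2)] op.left_baer_of_ss_injective[OF ss(2)] ss(1) lk(1) by simp_all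
    have mininj: "s \<in> simple_mod R {\<zero>\<^bsub>R\<^esub>}" if "s \<in> simple_mod (opp_ring R) {\<zero>\<^bsub>R\<^esub>}" for s
      using op.simple_mod_opp[OF ss(2)] that by simp
    show "quasi_frobenius TYPE(('a, 'm) module_universe) R"
      using right_artinian_of_duality[OF lb lk mininj chains] left_self_injective_of_left_baer[OF lb(1)]
      unfolding quasi_frobenius_def right_artinian_def by blast
  qed
qed

end
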